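(* The following are equivalent: (1) For every measurable $E\subset[0,1]$ with $0<|E|$ there is a finite partition $\{A_j\}_{j=1}^r$ of $\mathbb Z$ such that for all $j=1,\dots,r$, $P_E$ is an isomorphism of $S(A_j)$ onto its range. (2) For every $0\ne\phi\in L^2(\mathbb R)$ and $\lambda_n\in\mathbb R$ for $n\in\Lambda$, if $\{T_{\lambda_n}\phi\}_{n\in\Lambda}$ is a Bessel sequence, then it is a finite union of Riesz basic sequences. (3) For every $\Lambda\subset\mathbb Z$ and every $0\ne\phi\in L^2(\mathbb R)$, if $\{T_n\phi\}_{n\in\Lambda}$ is a Bessel sequence, then it is a finite union of Riesz basic sequences. (4) For every $0\ne\phi\in L^2(\mathbb R)$ and $\lambda_n\in\mathbb R$ for $n\in\Lambda$, if $\{T_{\lambda_n}\phi\}_{n\in\Lambda}$ is a frame sequence, then it is a finite union of Riesz basic sequences. (5) For every $\Lambda\subset\mathbb Z$ and every $0\ne\phi\in L^2(\mathbb R)$, if $\{T_n\phi\}_{n\in\Lambda}$ is a Bessel sequence, then it is a finite union of frame sequences.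
   Context: For $I\subset\mathbb Z$, $S(I)$ is the $L^2([0,1])$-closure of the span of $\{e^{2\pi int}\}_{n\in I}$; $P_Ef=f\cdot\chi_E$ on $L^2[0,1]$; "isomorphism onto its range" means bounded and bounded below. $T_y$ is translation on $L^2(\mathbb R)$: $T_yg(t)=g(t-y)$. In (2) and (4), $\Lambda$ is an arbitrary countable index set. A family $\{f_i\}_{i\in I}$ in a Hilbert space $\mathbb H$ is: a Bessel sequence if there is $B<\infty$ with $\sum_i|\langle f,f_i\rangle|^2\le B\|f\|^2$ for all $f\in\mathbb H$; a frame for $\mathbb H$ if in addition there is $A>0$ with $A\|f\|^2\le\sum_i|\langle f,f_i\rangle|^2$ for all $f\in\mathbb H$; a frame sequence if it is a frame for its closed linear span; a Riesz basic sequence if there are $A,B>0$ with $A\sum|a_i|^2\le\|\sum a_if_i\|^2\le B\sum|a_i|^2$ for all scalars $\{a_i\}$. A family indexed by $\Lambda$ is a finite union of sequences of a given kind if $\Lambda$ can be partitioned into finitely many subsets such that each corresponding subfamily is of that kind. *)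

theory Defs
  imports "HOL-Analysis.Analysis" "HOL-Library.Disjoint_Sets"
begin

text \<open>
  Elements of \<open>L\<^sup>2(M)\<close> are represented by functions rather than by classes modulo equality
  almost everywhere; in particular \<open>l2_norm\<close> is a seminorm, and ``nonzero'' is expressed as
  ``not almost everywhere zero''.
\<close>

definition L2 :: "'a measure \<Rightarrow> ('a \<Rightarrow> complex) set" where
  "L2 M = {f. f \<in> borel_measurable M \<and> integrable M (\<lambda>x. (cmod (f x))\<^sup>2)}"

definition l2_inner :: "'a measure \<Rightarrow> ('a \<Rightarrow> complex) \<Rightarrow> ('a \<Rightarrow> complex) \<Rightarrow> complex" where
  "l2_inner M f g = (LINT x|M. f x * cnj (g x))"

definition l2_norm :: "'a measure \<Rightarrow> ('a \<Rightarrow> complex) \<Rightarrow> real" where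
  "l2_norm M f = sqrt (LINT x|M. (cmod (f x))\<^sup>2)"

definition lin_span :: "'i set \<Rightarrow> ('i \<Rightarrow> 'a \<Rightarrow> complex) \<Rightarrow> ('a \<Rightarrow> complex) set" where
  "lin_span I F = {(\<lambda>x. \<Sum>i\<in>J. a i * F i x) | J a. finite J \<and> J \<subseteq> I}"

definition l2_closure :: "'a measure \<Rightarrow> ('a \<Rightarrow> complex) set \<Rightarrow> ('a \<Rightarrow> complex) set" where
  "l2_closure M V = {f \<in> L2 M. \<forall>\<epsilon>>0. \<exists>g\<in>V. l2_norm M (\<lambda>x. f x - g x) < \<epsilon>}"

definition closed_span ::
  "'a measure \<Rightarrow> 'i set \<Rightarrow> ('i \<Rightarrow> 'a \<Rightarrow> complex) \<Rightarrow> ('a \<Rightarrow> complex) set" where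
  "closed_span M I F = l2_closure M (lin_span I F)"

text \<open>In the next two definitions the ambient Hilbert space is a closed subspace \<open>V\<close> of \<open>L\<^sup>2(M)\<close>.\<close>

definition bessel_in ::
  "'a measure \<Rightarrow> ('a \<Rightarrow> complex) set \<Rightarrow> 'i set \<Rightarrow> ('i \<Rightarrow> 'a \<Rightarrow> complex) \<Rightarrow> bool" where
  "bessel_in M V I F \<longleftrightarrow> (\<forall>i\<in>I. F i \<in> V) \<and>
    (\<exists>B. \<forall>f\<in>V. (\<lambda>i. (cmod (l2_inner M f (F i)))\<^sup>2) summable_on I \<and>
           (\<Sum>\<^sub>\<infinity>i\<in>I. (cmod (l2_inner M f (F i)))\<^sup>2) \<le> B * (l2_norm M f)\<^sup>2)"

definition frame_for ::
  "'a measure \<Rightarrow> ('a \<Rightarrow> complex) set \<Rightarrow> 'i set \<Rightarrow> ('i \<Rightarrow> 'a \<Rightarrow> complex) \<Rightarrow> bool" where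
  "frame_for M V I F \<longleftrightarrow> bessel_in M V I F \<and>
    (\<exists>A>0. \<forall>f\<in>V. A * (l2_norm M f)\<^sup>2 \<le> (\<Sum>\<^sub>\<infinity>i\<in>I. (cmod (l2_inner M f (F i)))\<^sup>2))"

definition bessel_sequence :: "'a measure \<Rightarrow> 'i set \<Rightarrow> ('i \<Rightarrow> 'a \<Rightarrow> complex) \<Rightarrow> bool" where
  "bessel_sequence M I F \<longleftrightarrow> bessel_in M (L2 M) I F"

definition frame_sequence :: "'a measure \<Rightarrow> 'i set \<Rightarrow> ('i \<Rightarrow> 'a \<Rightarrow> complex) \<Rightarrow> bool" where
  "frame_sequence M I F \<longleftrightarrow> (\<forall>i\<in>I. F i \<in> L2 M) \<and> frame_for M (closed_span M I F) I F"

text \<open>As is customary, ``all scalars'' means all finitely supported families of scalars.\<close>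

definition riesz_basic_sequence :: "'a measure \<Rightarrow> 'i set \<Rightarrow> ('i \<Rightarrow> 'a \<Rightarrow> complex) \<Rightarrow> bool" where
  "riesz_basic_sequence M I F \<longleftrightarrow> (\<forall>i\<in>I. F i \<in> L2 M) \<and>
    (\<exists>A>0. \<exists>B>0. \<forall>J a. finite J \<longrightarrow> J \<subseteq> I \<longrightarrow>
       A * (\<Sum>i\<in>J. (cmod (a i))\<^sup>2) \<le> (l2_norm M (\<lambda>x. \<Sum>i\<in>J. a i * F i x))\<^sup>2 \<and>
       (l2_norm M (\<lambda>x. \<Sum>i\<in>J. a i * F i x))\<^sup>2 \<le> B * (\<Sum>i\<in>J. (cmod (a i))\<^sup>2))"

definition finite_union_of :: "('i set \<Rightarrow> bool) \<Rightarrow> 'i set \<Rightarrow> bool" where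
  "finite_union_of K I \<longleftrightarrow> (\<exists>P. finite P \<and> partition_on I P \<and> (\<forall>A\<in>P. K A))"

definition translation :: "real \<Rightarrow> (real \<Rightarrow> complex) \<Rightarrow> real \<Rightarrow> complex" where
  "translation y g = (\<lambda>t. g (t - y))"

definition exponential :: "int \<Rightarrow> real \<Rightarrow> complex" where
  "exponential n = (\<lambda>t. exp (2 * of_real pi * \<i> * of_int n * of_real t))"

definition exp_space :: "int set \<Rightarrow> (real \<Rightarrow> complex) set" where
  "exp_space I = closed_span (lebesgue_on {0..1}) I exponential"

definition cutoff :: "real set \<Rightarrow> (real \<Rightarrow> complex) \<Rightarrow> real \<Rightarrow> complex" where
  "cutoff E f = (\<lambda>t. f t * indicator E t)"

text \<open>The property that a linear operator \<open>T\<close> on \<open>L\<^sup>2(M)\<close> is bounded and bounded below on the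
  subspace \<open>V\<close>. Linearity is not part of the definition; it is evident for \<open>cutoff E\<close>.\<close>

definition iso_onto_range ::
  "'a measure \<Rightarrow> ('a \<Rightarrow> complex) set \<Rightarrow> (('a \<Rightarrow> complex) \<Rightarrow> 'a \<Rightarrow> complex) \<Rightarrow> bool" where
  "iso_onto_range M V T \<longleftrightarrow>
    (\<exists>C. \<forall>f\<in>V. l2_norm M (T f) \<le> C * l2_norm M f) \<and>
    (\<exists>c>0. \<forall>f\<in>V. c * l2_norm M f \<le> l2_norm M (T f))"

definition cutoffs_partition_into_isomorphisms :: bool where
  "cutoffs_partition_into_isomorphisms \<longleftrightarrow>
    (\<forall>E. E \<in> sets lebesgue \<longrightarrow> E \<subseteq> {0..1} \<longrightarrow> 0 < measure lebesgue E \<longrightarrow>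
      (\<exists>P. finite P \<and> partition_on (UNIV :: int set) P \<and>
           (\<forall>A\<in>P. iso_onto_range (lebesgue_on {0..1}) (exp_space A) (cutoff E))))"

text \<open>In the next two conditions, an arbitrary countable index set is represented, up to
  relabelling, by an arbitrary (finite or infinite) set of natural numbers. The translation
  parameters need not be distinct.\<close>

definition bessel_translates_finite_union_riesz :: bool where
  "bessel_translates_finite_union_riesz \<longleftrightarrow>
    (\<forall>\<phi> \<in> L2 lebesgue. \<not> (AE t in lebesgue. \<phi> t = 0) \<longrightarrow>
      (\<forall>(\<Lambda> :: nat set) (\<nu> :: nat \<Rightarrow> real).
        bessel_sequence lebesgue \<Lambda> (\<lambda>n. translation (\<nu> n) \<phi>) \<longrightarrow>
        finite_union_of (\<lambda>A. riesz_basic_sequence lebesgue A (\<lambda>n. translation (\<nu> n) \<phi>)) \<Lambda>))"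

definition frame_translates_finite_union_riesz :: bool where
  "frame_translates_finite_union_riesz \<longleftrightarrow>
    (\<forall>\<phi> \<in> L2 lebesgue. \<not> (AE t in lebesgue. \<phi> t = 0) \<longrightarrow>
      (\<forall>(\<Lambda> :: nat set) (\<nu> :: nat \<Rightarrow> real).
        frame_sequence lebesgue \<Lambda> (\<lambda>n. translation (\<nu> n) \<phi>) \<longrightarrow>
        finite_union_of (\<lambda>A. riesz_basic_sequence lebesgue A (\<lambda>n. translation (\<nu> n) \<phi>)) \<Lambda>))"

definition bessel_integer_translates_finite_union_riesz :: bool where
  "bessel_integer_translates_finite_union_riesz \<longleftrightarrow>
    (\<forall>\<Lambda> :: int set. \<forall>\<phi> \<in> L2 lebesgue. \<not> (AE t in lebesgue. \<phi> t = 0) \<longrightarrow>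
        bessel_sequence lebesgue \<Lambda> (\<lambda>n. translation (of_int n) \<phi>) \<longrightarrow>
        finite_union_of (\<lambda>A. riesz_basic_sequence lebesgue A (\<lambda>n. translation (of_int n) \<phi>)) \<Lambda>)"

definition bessel_integer_translates_finite_union_frame :: bool where
  "bessel_integer_translates_finite_union_frame \<longleftrightarrow>
    (\<forall>\<Lambda> :: int set. \<forall>\<phi> \<in> L2 lebesgue. \<not> (AE t in lebesgue. \<phi> t = 0) \<longrightarrow>
        bessel_sequence lebesgue \<Lambda> (\<lambda>n. translation (of_int n) \<phi>) \<longrightarrow>
        finite_union_of (\<lambda>A. frame_sequence lebesgue A (\<lambda>n. translation (of_int n) \<phi>)) \<Lambda>)"

end

theory Submission
  imports Defs
begin

text \<open>
  Number the five conditions (1) to (5) in the order of the informal statement: cutoffs, Bessel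
  sequences of real translates, Bessel sequences of integer translates, frame sequences of real
  translates, and finite unions of frame sequences. The implications proved are
  (1) \<open>\<Rightarrow>\<close> (2) \<open>\<Rightarrow>\<close> (4) \<open>\<Rightarrow>\<close> (1) and (1) \<open>\<Rightarrow>\<close> (3) \<open>\<Rightarrow>\<close> (5) \<open>\<Rightarrow>\<close> (1). Those from (2) to (4) and from (3) to (5)
  hold because a frame sequence is a Bessel sequence and a Riesz basic sequence is a frame sequence.

  From (1) to (2) and (3), see \<open>cutoffs_imp_bessel_translates_riesz\<close>. By Plancherel's theorem the norm
  of a finite combination of translates of \<open>\<phi>\<close> is the norm of an exponential sum multiplied by the
  Fourier transform of \<open>\<phi>\<close>. This transform is bounded below on an integer translate of some
  \<open>E \<subseteq> [0,1]\<close> of positive measure, so it suffices to bound exponential sums from below on \<open>E\<close>. The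
  Bessel condition limits the number of parameters in short intervals; hence the parameters fall
  into finitely many classes in which they have the form \<open>k + i/N + \<delta>\<close> with distinct integers \<open>k\<close>, a
  fixed \<open>i\<close>, and \<open>0 \<le> \<delta> \<le> 1/N\<close>. The frequency \<open>i/N\<close> only contributes a factor of modulus one, and
  replacing \<open>\<delta>\<close> by \<open>0\<close> costs at most \<open>2\<pi>/N\<close> times the norm of the coefficients
  (\<open>exponential_perturbation\<close>). So the lower bound
  \<open>\<gamma>\<close> that (1) gives for the integers \<open>k\<close> and the set \<open>E\<close> survives once \<open>N\<close> is large; there is no
  circularity, because \<open>\<gamma>\<close> does not depend on \<open>N\<close>.

  For the way back to (1), fix \<open>E\<close> and let \<open>\<phi>\<close> be the step function whose value on \<open>[k, k+1)\<close> is the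
  \<open>k\<close>-th Fourier coefficient of the indicator of \<open>E\<close>. By Parseval's identity the integer translates
  of \<open>\<phi>\<close> have the same geometry as the exponentials cut off to \<open>E\<close>. All of them together form a
  tight frame for their closed span, so (4) splits them into Riesz basic sequences, which is (1) for \<open>E\<close>.

  Under (5) one only gets frame sequences, and these may be linearly dependent in the
  square-summable sense. The remedy is to apply (5) to the nonnegative and to the negative integers
  separately: a square-integrable function without negative frequencies that vanishes on a set of
  positive measure is zero (\<open>analytic_vanishing\<close>). Hence the synthesis operator of such a
  half-line frame sequence is injective, and a frame sequence with injective synthesis operator
  is a Riesz basic sequence (\<open>frame_generator_imp_lower_bound\<close>).
\<close>

section \<open>Square-integrable functions\<close>

lemma L2_integrable: "f \<in> L2 M \<Longrightarrow> integrable M (\<lambda>x. (cmod (f x))\<^sup>2)"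
  by (simp add: L2_def)

lemma L2_dominated:
  assumes "g \<in> L2 M" "f \<in> borel_measurable M" "AE x in M. cmod (f x) \<le> cmod (g x)"
  shows "f \<in> L2 M"
proof -
  have "integrable M (\<lambda>x. (cmod (f x))\<^sup>2)"
    using assms(2,3)
    by (intro Bochner_Integration.integrable_bound[OF L2_integrable[OF assms(1)]])
       (auto intro: power_mono)
  then show ?thesis using assms(2) by (simp add: L2_def)
qed

lemma L2_cmult: "f \<in> L2 M \<Longrightarrow> (\<lambda>x. c * f x) \<in> L2 M"
  by (auto simp: L2_def norm_mult power_mult_distrib)

lemma L2_add:
  assumes "f \<in> L2 M" "g \<in> L2 M"
  shows "(\<lambda>x. f x + g x) \<in> L2 M"
proof -
  have [measurable]: "f \<in> borel_measurable M" "g \<in> borel_measurable M"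
    using assms by (auto simp: L2_def)
  have bnd: "(cmod (a + b))\<^sup>2 \<le> 2 * (cmod a)\<^sup>2 + 2 * (cmod b)\<^sup>2" for a b
  proof -
    have "(cmod (a + b))\<^sup>2 \<le> (cmod a + cmod b)\<^sup>2"
      by (intro power_mono norm_triangle_ineq) auto
    also have "\<dots> \<le> 2 * (cmod a)\<^sup>2 + 2 * (cmod b)\<^sup>2"
      using sum_squares_bound[of "cmod a" "cmod b"] by (simp add: power2_sum)
    finally show ?thesis .
  qed
  have "integrable M (\<lambda>x. 2 * (cmod (f x))\<^sup>2 + 2 * (cmod (g x))\<^sup>2)"
    using assms by (auto simp: L2_def)
  then have "integrable M (\<lambda>x. (cmod (f x + g x))\<^sup>2)"
    using bnd by (intro Bochner_Integration.integrable_bound[where g="\<lambda>x. (cmod (f x + g x))\<^sup>2"])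
      (auto intro!: AE_I2 intro: order_trans[OF bnd])
  then show ?thesis by (simp add: L2_def)
qed

lemma L2_zero: "(\<lambda>x. 0) \<in> L2 M"
  by (simp add: L2_def)

lemma L2_sum: "(\<And>i. i \<in> J \<Longrightarrow> f i \<in> L2 M) \<Longrightarrow> (\<lambda>x. \<Sum>i\<in>J. f i x) \<in> L2 M"
  by (induction J rule: infinite_finite_induct) (auto intro: L2_zero L2_add)

lemma L2_diff:
  assumes "f \<in> L2 M" "g \<in> L2 M"
  shows "(\<lambda>x. f x - g x) \<in> L2 M"
  using L2_add[OF assms(1) L2_cmult[OF assms(2), of "-1"]] by simp

lemma L2_lincomb: "(\<And>i. i \<in> J \<Longrightarrow> F i \<in> L2 M) \<Longrightarrow> (\<lambda>x. \<Sum>i\<in>J. a i * F i x) \<in> L2 M"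
  by (intro L2_sum L2_cmult)

lemma L2_mult_bounded:
  assumes "f \<in> L2 M" "g \<in> borel_measurable M" "\<And>x. x \<in> space M \<Longrightarrow> cmod (g x) \<le> B"
  shows "(\<lambda>x. g x * f x) \<in> L2 M"
proof (rule L2_dominated)
  show "(\<lambda>x. complex_of_real B * f x) \<in> L2 M" by (rule L2_cmult[OF assms(1)])
  show "(\<lambda>x. g x * f x) \<in> borel_measurable M" using assms(1,2) by (auto simp: L2_def)
  show "AE x in M. cmod (g x * f x) \<le> cmod (complex_of_real B * f x)"
    using assms(3) by (intro AE_I2) (auto simp: norm_mult intro!: mult_right_mono order_trans[OF assms(3)])
qed

lemma borel_measurable_cnj: "cnj \<in> borel_measurable borel"
  by (intro borel_measurable_continuous_onI continuous_intros)

lemma L2_cnj: "f \<in> L2 M \<Longrightarrow> (\<lambda>x. cnj (f x)) \<in> L2 M"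
  by (auto simp: L2_def intro: measurable_compose[OF _ borel_measurable_cnj])

lemma L2_mult_integrable:
  assumes "f \<in> L2 M" "g \<in> L2 M"
  shows "integrable M (\<lambda>x. f x * g x)"
proof -
  have [measurable]: "f \<in> borel_measurable M" "g \<in> borel_measurable M"
    using assms by (auto simp: L2_def)
  have "integrable M (\<lambda>x. (cmod (f x))\<^sup>2 + (cmod (g x))\<^sup>2)"
    using assms by (auto simp: L2_def)
  then show ?thesis
  proof (rule Bochner_Integration.integrable_bound)
    show "AE x in M. norm (f x * g x) \<le> norm ((cmod (f x))\<^sup>2 + (cmod (g x))\<^sup>2)"
    proof (intro AE_I2)
      fix x
      have "2 * cmod (f x) * cmod (g x) \<le> (cmod (f x))\<^sup>2 + (cmod (g x))\<^sup>2"
        by (rule sum_squares_bound)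
      moreover have "0 \<le> cmod (f x) * cmod (g x)" "0 \<le> (cmod (f x))\<^sup>2 + (cmod (g x))\<^sup>2" by simp_all
      ultimately show "norm (f x * g x) \<le> norm ((cmod (f x))\<^sup>2 + (cmod (g x))\<^sup>2)"
        unfolding norm_mult real_norm_def by linarith
    qed
  qed simp
qed

lemma l2_inner_integrable:
  "f \<in> L2 M \<Longrightarrow> g \<in> L2 M \<Longrightarrow> integrable M (\<lambda>x. f x * cnj (g x))"
  by (intro L2_mult_integrable L2_cnj)

lemma l2_inner_add_left:
  "f \<in> L2 M \<Longrightarrow> g \<in> L2 M \<Longrightarrow> h \<in> L2 M \<Longrightarrow>
   l2_inner M (\<lambda>x. f x + g x) h = l2_inner M f h + l2_inner M g h"
  by (simp add: l2_inner_def distrib_right Bochner_Integration.integral_add l2_inner_integrable)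

lemma l2_inner_cmult_left: "l2_inner M (\<lambda>x. c * f x) g = c * l2_inner M f g"
  by (simp add: l2_inner_def mult.assoc)

lemma l2_inner_commute: "l2_inner M g f = cnj (l2_inner M f g)"
  unfolding l2_inner_def by (subst Bochner_Integration.integral_cnj[symmetric]) (simp add: mult.commute)

lemma l2_inner_sum_left:
  assumes "\<And>i. i \<in> J \<Longrightarrow> F i \<in> L2 M" "h \<in> L2 M"
  shows "l2_inner M (\<lambda>x. \<Sum>i\<in>J. a i * F i x) h = (\<Sum>i\<in>J. a i * l2_inner M (F i) h)"
  using assms(1)
  by (induction J rule: infinite_finite_induct)
     (auto simp: l2_inner_add_left l2_inner_cmult_left L2_cmult L2_lincomb assms(2),
      auto simp: l2_inner_def)

lemma l2_inner_sum_right: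
  assumes "\<And>i. i \<in> J \<Longrightarrow> F i \<in> L2 M" "h \<in> L2 M"
  shows "l2_inner M h (\<lambda>x. \<Sum>i\<in>J. a i * F i x) = (\<Sum>i\<in>J. cnj (a i) * l2_inner M h (F i))"
  by (subst l2_inner_commute, subst l2_inner_sum_left[OF assms])
     (auto intro!: sum.cong simp: l2_inner_commute[of M h])

lemma l2_inner_diff_left:
  "f \<in> L2 M \<Longrightarrow> g \<in> L2 M \<Longrightarrow> h \<in> L2 M \<Longrightarrow>
   l2_inner M (\<lambda>x. f x - g x) h = l2_inner M f h - l2_inner M g h"
  by (simp add: l2_inner_def left_diff_distrib Bochner_Integration.integral_diff l2_inner_integrable)

lemma l2_norm_nonneg [simp]: "0 \<le> l2_norm M f"
  by (simp add: l2_norm_def)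

lemma l2_norm_sq: "(l2_norm M f)\<^sup>2 = (LINT x|M. (cmod (f x))\<^sup>2)"
  by (simp add: l2_norm_def)

lemma l2_inner_self: "l2_inner M f f = complex_of_real ((l2_norm M f)\<^sup>2)"
  by (simp only: l2_norm_sq l2_inner_def complex_norm_square[symmetric] integral_complex_of_real)

lemma l2_norm_cmult: "l2_norm M (\<lambda>x. c * f x) = cmod c * l2_norm M f"
  by (simp add: l2_norm_def norm_mult power_mult_distrib real_sqrt_mult)

lemma l2_norm_minus_commute: "l2_norm M (\<lambda>x. f x - g x) = l2_norm M (\<lambda>x. g x - f x)"
  by (simp add: l2_norm_def norm_minus_commute)

lemma l2_norm_zero [simp]: "l2_norm M (\<lambda>x. 0) = 0"
  by (simp add: l2_norm_def)

lemma l2_norm_add_sq: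
  assumes "f \<in> L2 M" "g \<in> L2 M"
  shows "(l2_norm M (\<lambda>x. f x + g x))\<^sup>2 = (l2_norm M f)\<^sup>2 + 2 * Re (l2_inner M f g) + (l2_norm M g)\<^sup>2"
proof -
  have "(cmod (f x + g x))\<^sup>2 = (cmod (f x))\<^sup>2 + 2 * Re (f x * cnj (g x)) + (cmod (g x))\<^sup>2" for x
    unfolding cmod_power2 by (simp add: power2_eq_square algebra_simps)
  then have "(l2_norm M (\<lambda>x. f x + g x))\<^sup>2
      = (LINT x|M. (cmod (f x))\<^sup>2 + 2 * Re (f x * cnj (g x)) + (cmod (g x))\<^sup>2)"
    by (simp only: l2_norm_sq)
  also have "\<dots> = (LINT x|M. (cmod (f x))\<^sup>2) + 2 * (LINT x|M. Re (f x * cnj (g x)))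
      + (LINT x|M. (cmod (g x))\<^sup>2)"
    using L2_integrable[OF assms(1)] L2_integrable[OF assms(2)]
      integrable_Re[OF l2_inner_integrable[OF assms]]
    by (simp only: Bochner_Integration.integral_add Bochner_Integration.integrable_add
          integrable_mult_right integral_mult_right_zero)
  also have "(LINT x|M. Re (f x * cnj (g x))) = Re (l2_inner M f g)"
    unfolding l2_inner_def by (rule integral_Re[OF l2_inner_integrable[OF assms]])
  finally show ?thesis by (simp add: l2_norm_sq)
qed

lemma l2_norm_diff_sq:
  assumes "f \<in> L2 M" "g \<in> L2 M"
  shows "(l2_norm M (\<lambda>x. f x - g x))\<^sup>2 = (l2_norm M f)\<^sup>2 - 2 * Re (l2_inner M f g) + (l2_norm M g)\<^sup>2"
proof -
  have "Re (l2_inner M f (\<lambda>x. - 1 * g x)) = - Re (l2_inner M f g)"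
    by (simp add: l2_inner_def)
  moreover have "l2_norm M (\<lambda>x. - 1 * g x) = l2_norm M g"
    by (simp add: l2_norm_def)
  ultimately show ?thesis
    using l2_norm_add_sq[OF assms(1) L2_cmult[OF assms(2), of "-1"]] by simp
qed

lemma l2_Cauchy_Schwarz:
  assumes "f \<in> L2 M" "g \<in> L2 M"
  shows "cmod (l2_inner M f g) \<le> l2_norm M f * l2_norm M g"
proof -
  define z where "z = l2_inner M f g"
  have *: "0 \<le> (l2_norm M f)\<^sup>2 - 2 * t * (cmod z)\<^sup>2 + t\<^sup>2 * (cmod z)\<^sup>2 * (l2_norm M g)\<^sup>2" for t :: real
  proof -
    have "0 \<le> (l2_norm M (\<lambda>x. f x - (of_real t * z) * g x))\<^sup>2" by simp
    also have "\<dots> = (l2_norm M f)\<^sup>2 - 2 * Re (l2_inner M f (\<lambda>x. (of_real t * z) * g x))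
        + (l2_norm M (\<lambda>x. (of_real t * z) * g x))\<^sup>2"
      by (rule l2_norm_diff_sq[OF assms(1) L2_cmult[OF assms(2)]])
    also have "l2_inner M f (\<lambda>x. (of_real t * z) * g x) = of_real t * (z * cnj z)"
      by (subst l2_inner_commute, subst l2_inner_cmult_left)
         (simp add: z_def l2_inner_commute[of M f g])
    also have "Re \<dots> = t * (cmod z)\<^sup>2"
      by (simp only: complex_norm_square[symmetric] of_real_mult[symmetric] Re_complex_of_real)
    also have "(l2_norm M (\<lambda>x. (of_real t * z) * g x))\<^sup>2 = t\<^sup>2 * (cmod z)\<^sup>2 * (l2_norm M g)\<^sup>2"
      by (simp add: l2_norm_cmult norm_mult power_mult_distrib)
    finally show ?thesis by simp
  qed
  have "(cmod z)\<^sup>2 \<le> (l2_norm M f)\<^sup>2 * (l2_norm M g)\<^sup>2"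
  proof (cases "l2_norm M g = 0")
    case True
    have "cmod z = 0"
    proof (rule ccontr)
      assume "cmod z \<noteq> 0"
      then have "(cmod z)\<^sup>2 > 0" by simp
      then show False
        using *[of "((l2_norm M f)\<^sup>2 + 1) / (2 * (cmod z)\<^sup>2)"] True by (simp add: field_simps)
    qed
    then show ?thesis by simp
  next
    case False
    define n where "n = (l2_norm M g)\<^sup>2"
    have n: "n > 0" using False by (simp add: n_def)
    have "(1 / n)\<^sup>2 * (cmod z)\<^sup>2 * n = (1 / n) * (cmod z)\<^sup>2" using n by (simp add: power2_eq_square)
    then have "(1 / n) * (cmod z)\<^sup>2 \<le> (l2_norm M f)\<^sup>2"
      using *[of "1 / n"] unfolding n_def[symmetric] by linarith
    then show ?thesis using n unfolding n_def[symmetric] by (simp add: field_simps)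
  qed
  then have "(cmod z)\<^sup>2 \<le> (l2_norm M f * l2_norm M g)\<^sup>2" by (simp add: power_mult_distrib)
  then show ?thesis unfolding z_def by (rule power2_le_imp_le) simp
qed

lemma l2_triangle:
  assumes "f \<in> L2 M" "g \<in> L2 M"
  shows "l2_norm M (\<lambda>x. f x + g x) \<le> l2_norm M f + l2_norm M g"
proof (rule power2_le_imp_le)
  have "Re (l2_inner M f g) \<le> l2_norm M f * l2_norm M g"
    using l2_Cauchy_Schwarz[OF assms] complex_Re_le_cmod order_trans by blast
  then show "(l2_norm M (\<lambda>x. f x + g x))\<^sup>2 \<le> (l2_norm M f + l2_norm M g)\<^sup>2"
    by (simp add: l2_norm_add_sq[OF assms] power2_sum)
qed simp

lemma l2_triangle_diff:
  assumes "f \<in> L2 M" "g \<in> L2 M"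
  shows "l2_norm M f \<le> l2_norm M g + l2_norm M (\<lambda>x. f x - g x)"
  using l2_triangle[OF assms(2) L2_diff[OF assms]] by simp

lemma l2_norm_sum_le:
  assumes "\<And>i. i \<in> J \<Longrightarrow> f i \<in> L2 M"
  shows "l2_norm M (\<lambda>x. \<Sum>i\<in>J. f i x) \<le> (\<Sum>i\<in>J. l2_norm M (f i))"
  using assms
proof (induction J rule: infinite_finite_induct)
  case (insert i J)
  then show ?case
    using l2_triangle[of "f i" M "\<lambda>x. \<Sum>i\<in>J. f i x"] L2_sum[of J f M] by fastforce
qed auto

lemma l2_norm_mono:
  assumes "g \<in> L2 M" "f \<in> L2 M" "AE x in M. cmod (f x) \<le> cmod (g x)"
  shows "l2_norm M f \<le> l2_norm M g"
  unfolding l2_norm_def using assms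
  by (auto intro!: real_sqrt_le_mono integral_mono_AE L2_integrable elim!: eventually_mono intro: power_mono)

lemma l2_norm_mult_bounded:
  assumes "f \<in> L2 M" "g \<in> borel_measurable M" "\<And>x. x \<in> space M \<Longrightarrow> cmod (g x) \<le> B" "0 \<le> B"
  shows "l2_norm M (\<lambda>x. g x * f x) \<le> B * l2_norm M f"
proof -
  have "l2_norm M (\<lambda>x. g x * f x) \<le> l2_norm M (\<lambda>x. of_real B * f x)"
    using assms by (intro l2_norm_mono L2_cmult L2_mult_bounded[of f M g B])
      (auto intro!: AE_I2 mult_right_mono simp: norm_mult)
  then show ?thesis using assms(4) by (simp add: l2_norm_cmult)
qed

lemma l2_norm_eq_0_iff:
  assumes "f \<in> L2 M"
  shows "l2_norm M f = 0 \<longleftrightarrow> (AE x in M. f x = 0)"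
proof -
  have "l2_norm M f = 0 \<longleftrightarrow> (LINT x|M. (cmod (f x))\<^sup>2) = 0" by (simp add: l2_norm_def)
  also have "\<dots> \<longleftrightarrow> (AE x in M. (cmod (f x))\<^sup>2 = 0)"
    by (rule integral_nonneg_eq_0_iff_AE[OF L2_integrable[OF assms]]) simp
  finally show ?thesis by simp
qed

lemma nn_integral_L2:
  "f \<in> L2 M \<Longrightarrow> (\<integral>\<^sup>+x. ennreal ((cmod (f x))\<^sup>2) \<partial>M) = ennreal ((l2_norm M f)\<^sup>2)"
  by (simp add: l2_norm_sq nn_integral_eq_integral L2_integrable)

lemma L2_nn_integralI:
  assumes "f \<in> borel_measurable M" "(\<integral>\<^sup>+x. ennreal ((cmod (f x))\<^sup>2) \<partial>M) = ennreal c" "0 \<le> c"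
  shows "f \<in> L2 M \<and> (l2_norm M f)\<^sup>2 = c"
proof -
  have "integrable M (\<lambda>x. (cmod (f x))\<^sup>2)"
    using assms by (intro integrableI_bounded) auto
  moreover have "(l2_norm M f)\<^sup>2 = c"
    using assms unfolding l2_norm_sq by (subst integral_eq_nn_integral) auto
  ultimately show ?thesis using assms(1) by (simp add: L2_def)
qed

lemma l2_inner_limit:
  assumes "s \<in> L2 M" "h \<in> L2 M" "\<And>k. u k \<in> L2 M"
    and "(\<lambda>k. l2_norm M (\<lambda>x. s x - u k x)) \<longlonglongrightarrow> 0"
  shows "(\<lambda>k. l2_inner M (u k) h) \<longlonglongrightarrow> l2_inner M s h"
proof (rule Lim_null[THEN iffD2], rule Lim_null_comparison)
  show "\<forall>\<^sub>F k in sequentially. norm (l2_inner M (u k) h - l2_inner M s h)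
      \<le> l2_norm M (\<lambda>x. s x - u k x) * l2_norm M h"
  proof (rule always_eventually, rule allI)
    fix k
    have "norm (l2_inner M (u k) h - l2_inner M s h) = cmod (l2_inner M (\<lambda>x. s x - u k x) h)"
      using assms by (simp add: l2_inner_diff_left norm_minus_commute)
    also have "\<dots> \<le> l2_norm M (\<lambda>x. s x - u k x) * l2_norm M h"
      using assms by (intro l2_Cauchy_Schwarz L2_diff)
    finally show "norm (l2_inner M (u k) h - l2_inner M s h) \<le> l2_norm M (\<lambda>x. s x - u k x) * l2_norm M h" .
  qed
  show "(\<lambda>k. l2_norm M (\<lambda>x. s x - u k x) * l2_norm M h) \<longlonglongrightarrow> 0"
    using tendsto_mult[OF assms(4) tendsto_const[of "l2_norm M h"]] by simp
qed

lemma l2_norm_limit: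
  assumes "s \<in> L2 M" "\<And>k. u k \<in> L2 M"
    and "(\<lambda>k. l2_norm M (\<lambda>x. s x - u k x)) \<longlonglongrightarrow> 0"
  shows "(\<lambda>k. l2_norm M (u k)) \<longlonglongrightarrow> l2_norm M s"
proof (rule Lim_null[THEN iffD2], rule Lim_null_comparison[OF _ assms(3)])
  show "\<forall>\<^sub>F k in sequentially. norm (l2_norm M (u k) - l2_norm M s) \<le> l2_norm M (\<lambda>x. s x - u k x)"
  proof (rule always_eventually, rule allI)
    fix k
    show "norm (l2_norm M (u k) - l2_norm M s) \<le> l2_norm M (\<lambda>x. s x - u k x)"
      using l2_triangle_diff[OF assms(1) assms(2)[of k]] l2_triangle_diff[OF assms(2)[of k] assms(1)]
      by (simp add: l2_norm_minus_commute[of M "u k"] abs_le_iff)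
  qed
qed

lemma l2_norm_dominated_convergence:
  assumes g: "g \<in> L2 M" and u [measurable]: "\<And>k. u k \<in> borel_measurable M"
    and lim: "AE x in M. (\<lambda>k. u k x) \<longlonglongrightarrow> 0" and bound: "\<And>k. AE x in M. cmod (u k x) \<le> cmod (g x)"
  shows "(\<lambda>k. l2_norm M (u k)) \<longlonglongrightarrow> 0"
proof -
  have "(\<lambda>k. LINT x|M. (cmod (u k x))\<^sup>2) \<longlonglongrightarrow> integral\<^sup>L M (\<lambda>x. 0 :: real)"
  proof (rule integral_dominated_convergence[OF _ _ L2_integrable[OF g]])
    show "AE x in M. (\<lambda>k. (cmod (u k x))\<^sup>2) \<longlonglongrightarrow> 0"
      using lim by eventually_elim (use tendsto_power[OF tendsto_norm, of _ 0 _ 2] in simp)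
    show "AE x in M. norm ((cmod (u k x))\<^sup>2) \<le> (cmod (g x))\<^sup>2" for k
      using bound[of k] by eventually_elim (simp add: power_mono)
  qed auto
  then show ?thesis unfolding l2_norm_def using tendsto_real_sqrt by fastforce
qed

text \<open>
  By monotone convergence the pointwise sum of the \<open>|q j|\<close> is square-integrable, with norm at
  most the sum of the norms. It is therefore finite almost everywhere, so the series converges
  there, and twice this sum dominates all the remainders.
\<close>
lemma Riesz_Fischer:
  assumes q: "\<And>j. q j \<in> L2 M" and sm: "summable (\<lambda>j. l2_norm M (q j))"
  shows "\<exists>s\<in>L2 M. (\<lambda>k. l2_norm M (\<lambda>x. s x - (\<Sum>j<k. q j x))) \<longlonglongrightarrow> 0"
proof -
  have qm [measurable]: "q j \<in> borel_measurable M" for j using q by (simp add: L2_def)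
  define C where "C = (\<Sum>j. l2_norm M (q j))"
  define H where "H k x = (\<Sum>j<k. cmod (q j x))" for k x
  have HL2: "(\<lambda>x. complex_of_real (H k x)) \<in> L2 M" for k
  proof -
    have "(\<lambda>x. \<Sum>j<k. complex_of_real (cmod (q j x))) \<in> L2 M"
    proof (rule L2_sum)
      fix j
      show "(\<lambda>x. complex_of_real (cmod (q j x))) \<in> L2 M"
        by (rule L2_dominated[OF q[of j]]) auto
    qed
    then show ?thesis by (simp add: H_def)
  qed
  have Hnorm: "l2_norm M (\<lambda>x. complex_of_real (H k x)) \<le> C" for k
  proof -
    have eq: "l2_norm M (\<lambda>x. complex_of_real (cmod (q j x))) = l2_norm M (q j)" for j
      by (simp add: l2_norm_def)
    have "l2_norm M (\<lambda>x. \<Sum>j<k. complex_of_real (cmod (q j x))) \<le> (\<Sum>j<k. l2_norm M (\<lambda>x. complex_of_real (cmod (q j x))))"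
      by (rule l2_norm_sum_le) (rule L2_dominated[OF q], auto)
    also have "\<dots> \<le> C" unfolding C_def eq by (rule sum_le_suminf[OF sm]) auto
    finally show ?thesis by (simp add: H_def)
  qed
  have HC: "(\<integral>\<^sup>+x. ennreal ((H k x)\<^sup>2) \<partial>M) \<le> ennreal (C\<^sup>2)" for k
    using nn_integral_L2[OF HL2[of k]] power_mono[OF Hnorm[of k], of 2] by (simp add: ennreal_leI)
  have Hpos: "0 \<le> H k x" for k x by (simp add: H_def sum_nonneg)
  have Hmono: "H k x \<le> H l x" if "k \<le> l" for k l x
    unfolding H_def using that by (intro sum_mono2) auto
  have Hm [measurable]: "H k \<in> borel_measurable M" for k unfolding H_def by simp
  define G where "G x = (SUP k. ennreal ((H k x)\<^sup>2))" for x
  have Gint: "(\<integral>\<^sup>+x. G x \<partial>M) \<le> ennreal (C\<^sup>2)"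
  proof -
    have "(\<integral>\<^sup>+x. G x \<partial>M) = (SUP k. \<integral>\<^sup>+x. ennreal ((H k x)\<^sup>2) \<partial>M)"
      unfolding G_def
      by (rule nn_integral_monotone_convergence_SUP)
         (auto simp: incseq_def le_fun_def intro!: ennreal_leI power_mono Hmono Hpos)
    also have "\<dots> \<le> ennreal (C\<^sup>2)" by (rule SUP_least) (rule HC)
    finally show ?thesis .
  qed
  have Gm [measurable]: "G \<in> borel_measurable M" unfolding G_def by simp
  have "(\<integral>\<^sup>+x. G x \<partial>M) \<noteq> \<infinity>" using Gint by (auto simp: top_unique)
  then have fin: "AE x in M. G x \<noteq> \<infinity>" by (intro nn_integral_noteq_infinite) auto
  define g where "g x = sqrt (enn2real (G x))" for x
  have Hg: "H k x \<le> g x" if "G x \<noteq> \<infinity>" for k x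
  proof -
    have "ennreal ((H k x)\<^sup>2) \<le> G x" unfolding G_def by (rule SUP_upper) simp
    then have "ennreal ((H k x)\<^sup>2) \<le> ennreal (enn2real (G x))" using that
      by (metis ennreal_enn2real infinity_ennreal_def less_top)
    then have "(H k x)\<^sup>2 \<le> enn2real (G x)" by (simp add: ennreal_le_iff)
    then show ?thesis unfolding g_def by (rule real_le_rsqrt)
  qed
  have gL2: "(\<lambda>x. complex_of_real (g x)) \<in> L2 M"
  proof -
    have "(\<integral>\<^sup>+x. ennreal ((cmod (complex_of_real (g x)))\<^sup>2) \<partial>M) \<le> (\<integral>\<^sup>+x. G x \<partial>M)"
      by (intro nn_integral_mono) (simp add: g_def, metis ennreal_enn2real_if top_greatest eq_iff)
    also have "\<dots> < \<infinity>" using Gint by (simp add: le_less_trans)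
    finally show ?thesis unfolding L2_def g_def
      by (auto intro!: integrableI_bounded simp: g_def)
  qed
  have summ: "summable (\<lambda>j. q j x)" if "G x \<noteq> \<infinity>" for x
  proof (rule summable_norm_cancel)
    show "summable (\<lambda>j. norm (q j x))"
      by (rule bounded_imp_summable[where B="g x"])
         (use Hg[OF that] in \<open>auto simp: H_def lessThan_Suc_atMost[symmetric] simp del: sum.lessThan_Suc\<close>)
  qed
  define s where "s x = (\<Sum>j. q j x)" for x
  have sm [measurable]: "s \<in> borel_measurable M" unfolding s_def by measurable
  have sb: "cmod (s x) \<le> g x" if "G x \<noteq> \<infinity>" for x
  proof (rule LIMSEQ_le_const2)
    show "(\<lambda>k. cmod (\<Sum>j<k. q j x)) \<longlonglongrightarrow> cmod (s x)"
      unfolding s_def by (intro tendsto_norm summable_LIMSEQ summ that)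
    show "\<exists>N. \<forall>k\<ge>N. cmod (\<Sum>j<k. q j x) \<le> g x"
      using Hg[OF that] by (auto simp: H_def intro!: order_trans[OF norm_sum])
  qed
  have gpos: "0 \<le> g x" for x unfolding g_def by simp
  have sL2: "s \<in> L2 M"
    using fin sb gpos by (intro L2_dominated[OF gL2]) (auto elim!: eventually_mono)
  have "(\<lambda>k. l2_norm M (\<lambda>x. s x - (\<Sum>j<k. q j x))) \<longlonglongrightarrow> 0"
  proof (rule l2_norm_dominated_convergence[OF L2_cmult[OF gL2, of 2]])
    show "AE x in M. (\<lambda>k. s x - (\<Sum>j<k. q j x)) \<longlonglongrightarrow> 0"
      using fin
    proof eventually_elim
      case (elim x)
      have "(\<lambda>k. s x - (\<Sum>j<k. q j x)) \<longlonglongrightarrow> s x - s x"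
        unfolding s_def by (intro tendsto_diff tendsto_const summable_LIMSEQ summ elim)
      then show ?case by simp
    qed
    fix k
    show "AE x in M. cmod (s x - (\<Sum>j<k. q j x)) \<le> cmod (2 * complex_of_real (g x))"
      using fin
    proof eventually_elim
      case (elim x)
      have "cmod (s x - (\<Sum>j<k. q j x)) \<le> cmod (s x) + cmod (\<Sum>j<k. q j x)" by (rule norm_triangle_ineq4)
      also have "\<dots> \<le> g x + g x"
        using Hg[OF elim, of k] sb[OF elim] by (intro add_mono) (auto simp: H_def intro!: order_trans[OF norm_sum])
      finally show ?case using gpos[of x] by (simp add: norm_mult)
    qed
  qed auto
  then show ?thesis using sL2 by blast
qed

text \<open>
  Completeness of \<open>L\<^sup>2\<close>, for sequences whose increments are bounded by a geometric series.
\<close>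
lemma L2_limit_of_fast_Cauchy:
  assumes u: "\<And>k. u k \<in> L2 M" and sm: "summable (\<lambda>k. l2_norm M (\<lambda>x. u (Suc k) x - u k x))"
  shows "\<exists>s\<in>L2 M. (\<lambda>k. l2_norm M (\<lambda>x. s x - u k x)) \<longlonglongrightarrow> 0"
proof -
  define q where "q j x = (if j = 0 then u 0 x else u j x - u (j - 1) x)" for j x
  have qL: "q j \<in> L2 M" for j
    unfolding q_def using u by (cases "j = 0") (auto intro: L2_diff)
  have tele: "(\<Sum>j<Suc k. q j x) = u k x" for k x
    by (induction k) (auto simp: q_def)
  have "q (Suc j) = (\<lambda>x. u (Suc j) x - u j x)" for j by (simp add: q_def fun_eq_iff)
  then have "summable (\<lambda>j. l2_norm M (q (Suc j)))" using sm by simp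
  then have "summable (\<lambda>j. l2_norm M (q j))" by (rule summable_Suc_iff[THEN iffD1])
  from Riesz_Fischer[OF qL this] obtain s where s: "s \<in> L2 M"
    "(\<lambda>k. l2_norm M (\<lambda>x. s x - (\<Sum>j<k. q j x))) \<longlonglongrightarrow> 0" by auto
  show ?thesis using LIMSEQ_Suc[OF s(2)] s(1) unfolding tele by blast
qed

section \<open>Fourier series\<close>

lemma lin_span_add:
  assumes "p \<in> lin_span I F" "q \<in> lin_span I F"
  shows "(\<lambda>x. p x + q x) \<in> lin_span I F"
proof -
  obtain J a where J: "finite J" "J \<subseteq> I" "p = (\<lambda>x. \<Sum>i\<in>J. a i * F i x)"
    using assms(1) by (auto simp: lin_span_def)
  obtain K b where K: "finite K" "K \<subseteq> I" "q = (\<lambda>x. \<Sum>i\<in>K. b i * F i x)"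
    using assms(2) by (auto simp: lin_span_def)
  define c where "c i = (if i \<in> J then a i else 0) + (if i \<in> K then b i else 0)" for i
  have "p x + q x = (\<Sum>i\<in>J \<union> K. c i * F i x)" for x
  proof -
    have "p x = (\<Sum>i\<in>J \<union> K. (if i \<in> J then a i else 0) * F i x)"
      unfolding J(3) by (rule sum.mono_neutral_cong_left) (use J K in auto)
    moreover have "q x = (\<Sum>i\<in>J \<union> K. (if i \<in> K then b i else 0) * F i x)"
      unfolding K(3) by (rule sum.mono_neutral_cong_left) (use J K in auto)
    ultimately show ?thesis by (simp add: c_def distrib_right sum.distrib)
  qed
  then show ?thesis using J(1,2) K(1,2) unfolding lin_span_def
    by (intro CollectI exI[of _ "J \<union> K"] exI[of _ c]) auto
qed

lemma lin_span_cmult: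
  assumes "p \<in> lin_span I F"
  shows "(\<lambda>x. c * p x) \<in> lin_span I F"
proof -
  obtain J a where J: "finite J" "J \<subseteq> I" "p = (\<lambda>x. \<Sum>i\<in>J. a i * F i x)"
    using assms by (auto simp: lin_span_def)
  then show ?thesis unfolding lin_span_def
    by (intro CollectI exI[of _ J] exI[of _ "\<lambda>i. c * a i"]) (auto simp: sum_distrib_left mult.assoc)
qed

lemma lin_span_diff:
  "p \<in> lin_span I F \<Longrightarrow> q \<in> lin_span I F \<Longrightarrow> (\<lambda>x. p x - q x) \<in> lin_span I F"
  using lin_span_add[of p I F "\<lambda>x. -1 * q x"] lin_span_cmult[of q I F "-1"] by simp

lemma lin_span_zero: "(\<lambda>x. 0) \<in> lin_span I F"
  unfolding lin_span_def by (auto intro!: exI[of _ "{}"])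

lemma lin_span_sum:
  "(\<And>k. k \<in> K \<Longrightarrow> f k \<in> lin_span I F) \<Longrightarrow> (\<lambda>x. \<Sum>k\<in>K. f k x) \<in> lin_span I F"
  by (induction K rule: infinite_finite_induct) (auto intro: lin_span_zero lin_span_add)

lemma lin_span_base: "i \<in> I \<Longrightarrow> F i \<in> lin_span I F"
  unfolding lin_span_def by (auto intro!: exI[of _ "{i}"] exI[of _ "\<lambda>_. 1"])

lemma lin_span_L2: "(\<And>i. i \<in> I \<Longrightarrow> F i \<in> L2 M) \<Longrightarrow> p \<in> lin_span I F \<Longrightarrow> p \<in> L2 M"
  unfolding lin_span_def by (auto intro!: L2_lincomb)

abbreviation unit_interval_measure :: "real measure" (\<open>\<mu>\<^sub>I\<close>)
  where "\<mu>\<^sub>I \<equiv> lebesgue_on {0..1}"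

abbreviation norm_I :: "(real \<Rightarrow> complex) \<Rightarrow> real" where
  "norm_I \<equiv> l2_norm \<mu>\<^sub>I"

abbreviation norm_R :: "(real \<Rightarrow> complex) \<Rightarrow> real" where
  "norm_R \<equiv> l2_norm lebesgue"

lemma exponential_cis: "exponential n t = cis (2 * pi * (of_int n * t))"
  by (simp add: exponential_def cis_conv_exp mult_ac)

lemma exponential_0 [simp]: "exponential 0 t = 1"
  by (simp add: exponential_cis)

lemma norm_exponential [simp]: "cmod (exponential n t) = 1"
  by (simp add: exponential_cis)

lemma exponential_mult: "exponential m t * exponential n t = exponential (m + n) t"
  by (simp add: exponential_cis cis_mult algebra_simps)

lemma cnj_exponential: "cnj (exponential n t) = exponential (- n) t"
  by (simp add: exponential_cis cis_cnj)

lemma continuous_exponential: "continuous_on A (exponential n)"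
  unfolding exponential_def by (intro continuous_intros)

lemma exponential_measurable: "exponential n \<in> borel_measurable \<mu>\<^sub>I"
  by (intro continuous_imp_measurable_on_sets_lebesgue continuous_exponential) auto

lemma finite_measure_unit: "finite_measure \<mu>\<^sub>I"
  by (intro finite_measure_lebesgue_on) auto

lemma bounded_L2_unit:
  assumes "f \<in> borel_measurable \<mu>\<^sub>I" "\<And>x. x \<in> {0..1} \<Longrightarrow> cmod (f x) \<le> B"
  shows "f \<in> L2 \<mu>\<^sub>I"
proof -
  interpret finite_measure "\<mu>\<^sub>I" by (rule finite_measure_unit)
  have "integrable \<mu>\<^sub>I (\<lambda>x. (cmod (f x))\<^sup>2)"
    using assms by (intro integrable_const_bound[where B="B\<^sup>2"] AE_I2) (auto intro: power_mono)
  then show ?thesis using assms by (simp add: L2_def)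
qed

lemma exponential_L2: "exponential n \<in> L2 \<mu>\<^sub>I"
  by (rule bounded_L2_unit[OF exponential_measurable, of _ 1]) simp

lemma integral_exponential: "(LINT t|\<mu>\<^sub>I. exponential n t) = (if n = 0 then 1 else 0)"
proof (cases "n = 0")
  case True
  then show ?thesis by (simp add: measure_restrict_space)
next
  case False
  define F where "F t = exponential n t / (2 * of_real pi * \<i> * of_int n)" for t
  have "(exponential n has_integral (F 1 - F 0)) {0..1}"
  proof (rule fundamental_theorem_of_calculus)
    fix t :: real
    have "((\<lambda>z. exp (2 * of_real pi * \<i> * of_int n * z) / (2 * of_real pi * \<i> * of_int n))
        has_field_derivative exp (2 * of_real pi * \<i> * of_int n * of_real t)) (at (of_real t))"
      using False by (auto intro!: derivative_eq_intros)
    from has_vector_derivative_real_field[OF this, of "{0..1}"]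
    show "(F has_vector_derivative exponential n t) (at t within {0..1})"
      by (simp add: F_def[abs_def] exponential_def)
  qed simp
  moreover have "F 1 = F 0"
    by (simp add: F_def exponential_cis)
  moreover have "integrable \<mu>\<^sub>I (exponential n)"
    using finite_measure.square_integrable_imp_integrable[OF finite_measure_unit _ L2_integrable[OF exponential_L2[of n]]]
    by (intro finite_measure.integrable_const_bound[OF finite_measure_unit, where B=1] exponential_measurable) auto
  ultimately show ?thesis using False
    by (simp add: lebesgue_integral_eq_integral integral_unique)
qed

lemma exponential_orthonormal:
  "l2_inner \<mu>\<^sub>I (exponential m) (exponential n) = (if m = n then 1 else 0)"
  unfolding l2_inner_def cnj_exponential exponential_mult integral_exponential by simp

definition fourier_coeff :: "(real \<Rightarrow> complex) \<Rightarrow> int \<Rightarrow> complex" where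
  "fourier_coeff f n = l2_inner \<mu>\<^sub>I f (exponential n)"

abbreviation trig_polys :: "(real \<Rightarrow> complex) set" where
  "trig_polys \<equiv> lin_span UNIV exponential"

lemma trig_polys_mult:
  assumes "p \<in> trig_polys" "q \<in> trig_polys"
  shows "(\<lambda>t. p t * q t) \<in> trig_polys"
proof -
  obtain J a where J: "finite J" "p = (\<lambda>x. \<Sum>i\<in>J. a i * exponential i x)"
    using assms(1) by (auto simp: lin_span_def)
  obtain K b where K: "finite K" "q = (\<lambda>x. \<Sum>i\<in>K. b i * exponential i x)"
    using assms(2) by (auto simp: lin_span_def)
  have "(\<lambda>t. p t * q t) = (\<lambda>t. \<Sum>i\<in>J. \<Sum>k\<in>K. (a i * b k) * exponential (i + k) t)"
    unfolding J(2) K(2) sum_product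
    by (auto simp: exponential_mult[symmetric] mult_ac intro!: sum.cong ext)
  then show ?thesis
    by (simp only:) (intro lin_span_sum lin_span_cmult lin_span_base, simp)
qed

lemma trig_polys_const: "(\<lambda>t. c) \<in> trig_polys"
  using lin_span_cmult[OF lin_span_base[of "0::int" UNIV exponential], of c] by simp

lemma trig_polys_L2: "p \<in> trig_polys \<Longrightarrow> p \<in> L2 \<mu>\<^sub>I"
  by (rule lin_span_L2[OF exponential_L2])

text \<open>
  On the unit circle, \<open>Re z\<close> and \<open>Im z\<close> are combinations of \<open>z\<close> and \<open>1/z\<close>, and trigonometric
  polynomials are closed under products.
\<close>
lemma real_polynomial_circle_trig:
  fixes f :: "complex \<Rightarrow> real"
  assumes "real_polynomial_function f"
  shows "(\<lambda>t. complex_of_real (f (exponential 1 t))) \<in> trig_polys"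
  using assms
proof induction
  case (linear f)
  interpret bounded_linear f by fact
  have fz: "f z = Re z * f 1 + Im z * f \<i>" for z
  proof -
    have "z = Re z *\<^sub>R 1 + Im z *\<^sub>R \<i>" by (simp add: complex_eq_iff)
    then have "f z = f (Re z *\<^sub>R 1 + Im z *\<^sub>R \<i>)" by (rule arg_cong)
    then show ?thesis by (simp only: add scaleR real_scaleR_def)
  qed
  have re: "complex_of_real (Re (exponential 1 t)) = (1/2) * exponential 1 t + (1/2) * exponential (-1) t" for t
    using complex_add_cnj[of "exponential 1 t"] by (simp add: cnj_exponential complex_eq_iff)
  have im: "complex_of_real (Im (exponential 1 t)) = (-\<i>/2) * exponential 1 t + (\<i>/2) * exponential (-1) t" for t
    by (simp add: cnj_exponential[symmetric] complex_eq_iff)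
  have "(\<lambda>t. complex_of_real (f (exponential 1 t)))
      = (\<lambda>t. complex_of_real (f 1) * ((1/2) * exponential 1 t + (1/2) * exponential (-1) t)
         + complex_of_real (f \<i>) * ((-\<i>/2) * exponential 1 t + (\<i>/2) * exponential (-1) t))"
    by (rule ext, subst fz) (simp only: of_real_add of_real_mult re im mult.commute)
  then show ?case
    by (simp only:) (intro lin_span_add lin_span_cmult lin_span_base UNIV_I)
next
  case (const c)
  then show ?case using trig_polys_const by simp
next
  case (add f g)
  then show ?case using lin_span_add by force
next
  case (mult f g)
  then show ?case using trig_polys_mult by force
qed

text \<open>
  A continuous function with equal values at the end points lives on the circle, where the
  Stone-Weierstrass theorem provides polynomial approximations.
\<close>
lemma trig_approx_continuous:
  fixes p :: "real \<Rightarrow> complex"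
  assumes cont: "continuous_on {0..1} p" and ends: "p 0 = p 1" and "0 < \<epsilon>"
  shows "\<exists>t\<in>trig_polys. \<forall>x\<in>{0..1}. cmod (p x - t x) < \<epsilon>"
proof -
  have "homotopic_loops UNIV p p"
    using cont ends by (simp add: homotopic_loops_refl path_def pathstart_def pathfinish_def)
  then have "continuous_on (sphere 0 1) (p \<circ> (\<lambda>z. Arg2pi z / (2 * pi)))"
    using homotopic_loops_imp_homotopic_circlemaps homotopic_with_imp_continuous by blast
  then obtain g :: "complex \<Rightarrow> complex" where g: "polynomial_function g"
    "\<And>z. z \<in> sphere 0 1 \<Longrightarrow> norm ((p \<circ> (\<lambda>z. Arg2pi z / (2 * pi))) z - g z) < \<epsilon>"
    using Stone_Weierstrass_polynomial_function[of "sphere 0 1" "p \<circ> (\<lambda>z. Arg2pi z / (2 * pi))" \<epsilon>]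
      \<open>0 < \<epsilon>\<close> by auto
  define t where "t x = g (exponential 1 x)" for x
  have "real_polynomial_function (\<lambda>z. Re (g z))" "real_polynomial_function (\<lambda>z. Im (g z))"
    using g(1) bounded_linear_Re bounded_linear_Im by (auto simp: polynomial_function_def o_def)
  then have "(\<lambda>x. complex_of_real (Re (t x)) + \<i> * complex_of_real (Im (t x))) \<in> trig_polys"
    unfolding t_def by (intro lin_span_add lin_span_cmult real_polynomial_circle_trig)
  then have "t \<in> trig_polys" by (simp add: complex_eq[symmetric])
  moreover have "cmod (p x - t x) < \<epsilon>" if "x \<in> {0..1}" for x
  proof -
    have e: "exponential 1 x = cis (2 * pi * x)" by (simp add: exponential_cis)
    have "p (Arg2pi (exponential 1 x) / (2 * pi)) = p x"
    proof (cases "x = 1")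
      case True
      moreover have "exponential 1 1 = 1" by (simp add: exponential_cis)
      moreover have "Arg2pi 1 = 0" using Arg2pi_of_real[of 1] by simp
      ultimately show ?thesis using ends by simp
    next
      case False
      then have "Arg2pi (exponential 1 x) = 2 * pi * x"
        using that by (intro Arg2pi_unique[of 1]) (auto simp: e cis_conv_exp)
      then show ?thesis by simp
    qed
    then show ?thesis using g(2)[of "exponential 1 x"] by (simp add: t_def)
  qed
  ultimately show ?thesis by blast
qed

text \<open>
  The uniform bound on the approximants is essential: it allows dominated convergence also for
  integrals against a density that is merely integrable, which \<open>L\<^sup>2\<close> approximation would not.
\<close>
lemma trig_approx_bounded:
  fixes f :: "real \<Rightarrow> complex"
  assumes f: "f \<in> borel_measurable \<mu>\<^sub>I" and B: "\<And>x. x \<in> {0..1} \<Longrightarrow> cmod (f x) \<le> B"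
  shows "\<exists>t. (\<forall>k. t k \<in> trig_polys) \<and> (\<forall>k. \<forall>x\<in>{0..1}. cmod (t k x) \<le> B + 1) \<and>
      (AE x in \<mu>\<^sub>I. (\<lambda>k. t k x) \<longlonglongrightarrow> f x)"
proof -
  have B0: "0 \<le> B" using order_trans[OF norm_ge_zero B[of 0]] by simp
  have "f measurable_on {0..1}"
    using f by (simp add: measurable_on_iff_borel_measurable)
  then obtain N g where N: "negligible N" "\<And>n. continuous_on UNIV (g n)"
    "\<And>x. x \<notin> N \<Longrightarrow> (\<lambda>n. g n x) \<longlonglongrightarrow> (if x \<in> {0..1} then f x else 0)"
    by (auto simp: measurable_on_def)
  \<comment> \<open>truncate radially to norm \<open>B\<close>, and taper at the end points so that the approximants are periodic\<close>
  define T where "T n x = min 1 (real n * (x * (1 - x)))" for n x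
  define h where "h n x = complex_of_real (T n x) * closest_point (cball 0 B) (g n x)" for n :: nat and x :: real
  have hcont: "continuous_on {0..1} (h n)" for n
  proof -
    have "continuous_on UNIV (closest_point (cball (0::complex) B))"
      using B0 by (intro continuous_on_closest_point) auto
    then have "continuous_on UNIV (\<lambda>x. closest_point (cball 0 B) (g n x))"
      by (rule continuous_on_compose2[OF _ N(2)]) simp
    then show ?thesis unfolding h_def T_def
      by (intro continuous_intros) (auto intro: continuous_on_subset)
  qed
  have hb: "cmod (h n x) \<le> B" if "x \<in> {0..1}" for n x
  proof -
    have "cmod (closest_point (cball 0 B) (g n x)) \<le> B"
      using closest_point_in_set[of "cball (0::complex) B" "g n x"] B0 by simp
    moreover have "0 \<le> T n x" "T n x \<le> 1" using that by (auto simp: T_def)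
    ultimately show ?thesis unfolding h_def norm_mult
      by (simp add: mult_le_one order_trans[OF mult_left_le_one_le])
  qed
  have "\<exists>t\<in>trig_polys. \<forall>x\<in>{0..1}. cmod (h n x - t x) < inverse (Suc n)" for n
    by (intro trig_approx_continuous hcont) (auto simp: h_def T_def)
  then obtain t where t: "\<And>n. t n \<in> trig_polys"
     "\<And>n x. x \<in> {0..1} \<Longrightarrow> cmod (h n x - t n x) < inverse (Suc n)" by metis
  show ?thesis
  proof (intro exI[of _ t] conjI allI ballI)
    fix k and x :: real assume x: "x \<in> {0..1}"
    have "cmod (t k x) \<le> cmod (h k x) + cmod (h k x - t k x)"
      by (metis add.commute norm_minus_commute norm_triangle_sub)
    also have "\<dots> \<le> B + inverse (Suc k)" using hb[OF x] t(2)[OF x, of k] by (intro add_mono) auto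
    also have "\<dots> \<le> B + 1" by (simp add: field_simps)
    finally show "cmod (t k x) \<le> B + 1" .
  next
    have "AE x in lebesgue. x \<notin> N \<union> {0, 1}"
      using N(1) by (intro AE_not_in) (auto simp: negligible_iff_null_sets[symmetric] intro: negligible_Un)
    then have "AE x in lebesgue. x \<in> {0..1} \<longrightarrow> (\<lambda>k. t k x) \<longlonglongrightarrow> f x"
    proof eventually_elim
      case (elim x)
      show ?case
      proof
        assume x: "x \<in> {0..1}"
        have "(\<lambda>n. g n x) \<longlonglongrightarrow> f x" using N(3)[of x] elim x by auto
        moreover have "isCont (closest_point (cball 0 B)) (f x)"
          using continuous_at_closest_point[of "cball (0::complex) B" "f x"] B0 by simp
        ultimately have "(\<lambda>n. closest_point (cball 0 B) (g n x)) \<longlonglongrightarrow> closest_point (cball 0 B) (f x)"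
          by (metis isCont_tendsto_compose)
        moreover have "closest_point (cball 0 B) (f x) = f x"
          using B[OF x] by (intro closest_point_self) auto
        moreover have "(\<lambda>n. complex_of_real (T n x)) \<longlonglongrightarrow> 1"
        proof (rule tendsto_eventually)
          have "0 < x * (1 - x)" using elim x by auto
          then obtain n0 where "1 < real n0 * (x * (1 - x))" using reals_Archimedean3 by blast
          then have "T n x = 1" if "n \<ge> n0" for n
            using that \<open>0 < x * (1 - x)\<close> mult_right_mono[of "real n0" "real n" "x * (1 - x)"]
            by (auto simp: T_def min_def)
          then show "\<forall>\<^sub>F n in sequentially. complex_of_real (T n x) = 1"
            by (auto simp: eventually_sequentially)
        qed
        ultimately have "(\<lambda>n. h n x) \<longlonglongrightarrow> 1 * f x"
          unfolding h_def by (intro tendsto_mult) auto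
        moreover have "(\<lambda>n. h n x - t n x) \<longlonglongrightarrow> 0"
          using t(2)[OF x] by (intro Lim_null_comparison[OF _ LIMSEQ_inverse_real_of_nat])
            (auto intro!: always_eventually less_imp_le)
        ultimately have "(\<lambda>n. h n x - (h n x - t n x)) \<longlonglongrightarrow> 1 * f x - 0" by (rule tendsto_diff)
        then show "(\<lambda>n. t n x) \<longlonglongrightarrow> f x" by simp
      qed
    qed
    then show "AE x in \<mu>\<^sub>I. (\<lambda>k. t k x) \<longlonglongrightarrow> f x"
      by (simp add: AE_restrict_space_iff)
  qed (use t in auto)
qed

lemma trig_polys_dense:
  assumes f: "f \<in> L2 \<mu>\<^sub>I" and "0 < \<epsilon>"
  shows "\<exists>t\<in>trig_polys. norm_I (\<lambda>x. f x - t x) < \<epsilon>"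
proof -
  have fm [measurable]: "f \<in> borel_measurable \<mu>\<^sub>I" using f by (simp add: L2_def)
  define F where "F n x = (if cmod (f x) \<le> real n then f x else 0)" for n :: nat and x
  have Fm [measurable]: "F n \<in> borel_measurable \<mu>\<^sub>I" for n unfolding F_def by measurable
  have FL: "F n \<in> L2 \<mu>\<^sub>I" for n
    by (rule L2_dominated[OF f]) (auto simp: F_def)
  have "(\<lambda>n. norm_I (\<lambda>x. f x - F n x)) \<longlonglongrightarrow> 0"
  proof (rule l2_norm_dominated_convergence[OF f])
    show "AE x in \<mu>\<^sub>I. (\<lambda>n. f x - F n x) \<longlonglongrightarrow> 0"
    proof (intro AE_I2 tendsto_eventually)
      fix x
      show "\<forall>\<^sub>F n in sequentially. f x - F n x = 0"
        using eventually_ge_at_top[of "nat \<lceil>cmod (f x)\<rceil>"]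
        by eventually_elim (auto simp: F_def nat_ceiling_le_eq)
    qed
  qed (auto simp: F_def)
  then have "\<forall>\<^sub>F n in sequentially. norm_I (\<lambda>x. f x - F n x) < \<epsilon> / 2"
    using \<open>0 < \<epsilon>\<close> by (intro order_tendstoD) auto
  then obtain n where n: "norm_I (\<lambda>x. f x - F n x) < \<epsilon> / 2"
    by (auto simp: eventually_sequentially)
  have Fb: "cmod (F n x) \<le> real n" for x by (simp add: F_def)
  obtain t where t: "\<And>k. t k \<in> trig_polys" "\<And>k x. x \<in> {0..1} \<Longrightarrow> cmod (t k x) \<le> real n + 1"
     "AE x in \<mu>\<^sub>I. (\<lambda>k. t k x) \<longlonglongrightarrow> F n x"
    using trig_approx_bounded[OF Fm[of n], of "real n"] Fb by blast
  have tL: "t k \<in> L2 \<mu>\<^sub>I" for k using t(1) trig_polys_L2 by blast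
  have tm [measurable]: "t k \<in> borel_measurable \<mu>\<^sub>I" for k using tL[of k] by (simp add: L2_def)
  have "(\<lambda>k. norm_I (\<lambda>x. F n x - t k x)) \<longlonglongrightarrow> 0"
  proof (rule l2_norm_dominated_convergence)
    show "(\<lambda>x. of_nat (2 * n + 1)) \<in> L2 \<mu>\<^sub>I" by (rule bounded_L2_unit) auto
    show "AE x in \<mu>\<^sub>I. (\<lambda>k. F n x - t k x) \<longlonglongrightarrow> 0"
      using t(3)
    proof eventually_elim
      case (elim x)
      then show ?case using tendsto_diff[OF tendsto_const[of "F n x"] elim] by simp
    qed
    fix k
    show "AE x in \<mu>\<^sub>I. cmod (F n x - t k x) \<le> cmod (of_nat (2 * n + 1))"
    proof (intro AE_I2)
      fix x :: real assume "x \<in> space \<mu>\<^sub>I"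
      then have "cmod (F n x - t k x) \<le> real n + (real n + 1)"
        using Fb[of x] t(2)[of x k] by (intro order_trans[OF norm_triangle_ineq4] add_mono) auto
      also have "\<dots> = cmod (of_nat (2 * n + 1))" unfolding norm_of_nat by simp
      finally show "cmod (F n x - t k x) \<le> cmod (of_nat (2 * n + 1))" .
    qed
  qed auto
  then have "\<forall>\<^sub>F k in sequentially. norm_I (\<lambda>x. F n x - t k x) < \<epsilon> / 2"
    using \<open>0 < \<epsilon>\<close> by (intro order_tendstoD) auto
  then obtain k where k: "norm_I (\<lambda>x. F n x - t k x) < \<epsilon> / 2"
    by (auto simp: eventually_sequentially)
  have "norm_I (\<lambda>x. f x - t k x) < \<epsilon>"
    using l2_triangle[OF L2_diff[OF f FL[of n]] L2_diff[OF FL[of n] tL[of k]]] n k by simp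
  then show ?thesis using t(1) by blast
qed

lemma exponential_sum_norm:
  assumes "finite J"
  shows "(norm_I (\<lambda>x. \<Sum>n\<in>J. a n * exponential n x))\<^sup>2 = (\<Sum>n\<in>J. (cmod (a n))\<^sup>2)"
proof -
  have L: "(\<lambda>x. \<Sum>n\<in>J. a n * exponential n x) \<in> L2 \<mu>\<^sub>I" by (rule L2_lincomb[OF exponential_L2])
  have "complex_of_real ((norm_I (\<lambda>x. \<Sum>n\<in>J. a n * exponential n x))\<^sup>2)
    = (\<Sum>n\<in>J. a n * (\<Sum>m\<in>J. cnj (a m) * (if n = m then 1 else 0)))"
    unfolding l2_inner_self[symmetric]
    by (simp only: l2_inner_sum_left[OF exponential_L2 L] l2_inner_sum_right[OF exponential_L2 exponential_L2]
        exponential_orthonormal)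
  also have "\<dots> = (\<Sum>n\<in>J. a n * cnj (a n))"
    using assms by (intro sum.cong) (auto simp: if_distrib cong: if_cong)
  also have "\<dots> = complex_of_real (\<Sum>n\<in>J. (cmod (a n))\<^sup>2)"
    by (simp only: complex_norm_square[symmetric] of_real_sum)
  finally show ?thesis by (simp only: of_real_eq_iff)
qed

text \<open>
  Completing the square. The choice of \<open>a\<close> as the Fourier coefficients gives Bessel's inequality,
  and an arbitrary \<open>a\<close> shows that no other combination over \<open>J\<close> comes closer to \<open>f\<close>.
\<close>
lemma fourier_residual:
  assumes f: "f \<in> L2 \<mu>\<^sub>I" and J: "finite J"
  shows "(norm_I (\<lambda>x. f x - (\<Sum>n\<in>J. a n * exponential n x)))\<^sup>2
    = (norm_I f)\<^sup>2 - (\<Sum>n\<in>J. (cmod (fourier_coeff f n))\<^sup>2) + (\<Sum>n\<in>J. (cmod (a n - fourier_coeff f n))\<^sup>2)"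
proof -
  have "Re (l2_inner \<mu>\<^sub>I f (\<lambda>x. \<Sum>n\<in>J. a n * exponential n x)) = (\<Sum>n\<in>J. Re (cnj (a n) * fourier_coeff f n))"
    by (subst l2_inner_sum_right[OF exponential_L2 f]) (simp add: fourier_coeff_def)
  moreover have "(cmod (a n - fourier_coeff f n))\<^sup>2
     = (cmod (a n))\<^sup>2 - 2 * Re (cnj (a n) * fourier_coeff f n) + (cmod (fourier_coeff f n))\<^sup>2" for n
    unfolding cmod_power2 by (simp add: power2_eq_square algebra_simps)
  ultimately show ?thesis
    using l2_norm_diff_sq[OF f L2_lincomb[OF exponential_L2, where J=J and a=a]] exponential_sum_norm[OF J, of a]
    by (simp add: sum.distrib sum_subtractf sum_distrib_left)
qed

theorem Parseval:
  assumes f: "f \<in> L2 \<mu>\<^sub>I"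
  shows "((\<lambda>n. (cmod (fourier_coeff f n))\<^sup>2) has_sum (norm_I f)\<^sup>2) UNIV"
proof -
  have Bessel: "(\<Sum>n\<in>J. (cmod (fourier_coeff f n))\<^sup>2) \<le> (norm_I f)\<^sup>2" if "finite J" for J
  proof -
    have "0 \<le> (norm_I (\<lambda>x. f x - (\<Sum>n\<in>J. fourier_coeff f n * exponential n x)))\<^sup>2" by simp
    then show ?thesis unfolding fourier_residual[OF f that] by simp
  qed
  have dense: "\<exists>J. finite J \<and> (norm_I f)\<^sup>2 - \<epsilon> < (\<Sum>n\<in>J. (cmod (fourier_coeff f n))\<^sup>2)"
    if "0 < \<epsilon>" for \<epsilon>
  proof -
    obtain t where t: "t \<in> trig_polys" "norm_I (\<lambda>x. f x - t x) < sqrt \<epsilon>"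
      using trig_polys_dense[OF f, of "sqrt \<epsilon>"] \<open>0 < \<epsilon>\<close> by auto
    obtain J a where J: "finite J" "t = (\<lambda>x. \<Sum>n\<in>J. a n * exponential n x)"
      using t(1) by (auto simp: lin_span_def)
    have "(norm_I (\<lambda>x. f x - t x))\<^sup>2 < (sqrt \<epsilon>)\<^sup>2"
      using t(2) by (intro power_strict_mono) auto
    then have "(norm_I f)\<^sup>2 - (\<Sum>n\<in>J. (cmod (fourier_coeff f n))\<^sup>2)
        + (\<Sum>n\<in>J. (cmod (a n - fourier_coeff f n))\<^sup>2) < \<epsilon>"
      using \<open>0 < \<epsilon>\<close> unfolding J(2) fourier_residual[OF f J(1)] by simp
    moreover have "0 \<le> (\<Sum>n\<in>J. (cmod (a n - fourier_coeff f n))\<^sup>2)" by (intro sum_nonneg) simp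
    ultimately show ?thesis using J(1) by (intro exI[of _ J]) linarith
  qed
  show ?thesis unfolding has_sum_def tendsto_iff eventually_finite_subsets_at_top
  proof (intro allI impI)
    fix \<epsilon> :: real assume "0 < \<epsilon>"
    then obtain J where J: "finite J" "(norm_I f)\<^sup>2 - \<epsilon> < (\<Sum>n\<in>J. (cmod (fourier_coeff f n))\<^sup>2)"
      using dense by blast
    show "\<exists>X. finite X \<and> X \<subseteq> UNIV \<and> (\<forall>Y. finite Y \<and> X \<subseteq> Y \<and> Y \<subseteq> UNIV \<longrightarrow>
        dist (\<Sum>n\<in>Y. (cmod (fourier_coeff f n))\<^sup>2) ((norm_I f)\<^sup>2) < \<epsilon>)"
    proof (intro exI[of _ J] conjI allI impI)
      fix Y assume Y: "finite Y \<and> J \<subseteq> Y \<and> Y \<subseteq> UNIV"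
      then have "(\<Sum>n\<in>J. (cmod (fourier_coeff f n))\<^sup>2) \<le> (\<Sum>n\<in>Y. (cmod (fourier_coeff f n))\<^sup>2)"
        by (intro sum_mono2) auto
      then show "dist (\<Sum>n\<in>Y. (cmod (fourier_coeff f n))\<^sup>2) ((norm_I f)\<^sup>2) < \<epsilon>"
        using Bessel[of Y] Y J(2) by (simp add: dist_real_def)
    qed (use J in auto)
  qed
qed

text \<open>
  The integers are enumerated by \<open>h\<close>, which turns Parseval's identity into a series of
  nonnegative terms that can be exchanged with an integral.
\<close>
lemma Parseval_ennreal:
  assumes f: "f \<in> L2 \<mu>\<^sub>I" and h: "bij h"
  shows "(\<Sum>n. ennreal ((cmod (fourier_coeff f (h n)))\<^sup>2)) = ennreal ((norm_I f)\<^sup>2)"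
proof -
  have "((\<lambda>n. (cmod (fourier_coeff f (h n)))\<^sup>2) has_sum (norm_I f)\<^sup>2) UNIV"
    using Parseval[OF f] has_sum_reindex_bij_betw[OF h,
        where f="\<lambda>n. (cmod (fourier_coeff f n))\<^sup>2" and S="(norm_I f)\<^sup>2"] by blast
  then have "(\<lambda>n. (cmod (fourier_coeff f (h n)))\<^sup>2) sums (norm_I f)\<^sup>2"
    by (rule has_sum_imp_sums)
  then show ?thesis by (intro suminf_ennreal_eq) auto
qed

section \<open>Plancherel theorem on the line and translates\<close>

lemma lebesgue_shift_measurable: "(\<lambda>x::real. t + c * x) \<in> lebesgue \<rightarrow>\<^sub>M lebesgue"
proof (cases "c = 0")
  case False
  then show ?thesis using lebesgue_affine_measurable[where c="\<lambda>x::real. c" and t=t] by simp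
qed simp

lemma measurable_affine:
  "f \<in> borel_measurable lebesgue \<Longrightarrow> (\<lambda>x. f (t + c * x)) \<in> borel_measurable lebesgue" for c :: real
  by (rule measurable_compose[OF lebesgue_shift_measurable])

lemma continuous_lebesgue_measurable:
  fixes f :: "real \<Rightarrow> 'a::euclidean_space"
  shows "continuous_on UNIV f \<Longrightarrow> f \<in> borel_measurable lebesgue"
  by (intro measurable_completion) (simp add: borel_measurable_continuous_onI)

lemma cis_measurable: "(\<lambda>x. cis (r * x)) \<in> borel_measurable lebesgue"
  by (intro continuous_lebesgue_measurable continuous_intros)

lemma nn_integral_split_unit:
  fixes f :: "real \<Rightarrow> ennreal"
  assumes f [measurable]: "f \<in> borel_measurable lebesgue"
  shows "(\<integral>\<^sup>+x. f x \<partial>lebesgue) = (\<Sum>n. \<integral>\<^sup>+x. f (of_int (int_decode n) + x) \<partial>\<mu>\<^sub>I)"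
proof -
  define B :: "nat \<Rightarrow> real set" where "B n = {of_int (int_decode n) ..< of_int (int_decode n) + 1}" for n
  have fl: "x \<in> B n \<longleftrightarrow> int_encode \<lfloor>x\<rfloor> = n" for x n
    by (auto simp: B_def floor_eq_iff) (metis floor_unique int_decode_inverse int_encode_inverse)+
  have "(\<integral>\<^sup>+x \<in> (\<Union>n. B n). f x \<partial>lebesgue) = (\<Sum>n. (\<integral>\<^sup>+x \<in> B n. f x \<partial>lebesgue))"
    by (rule nn_integral_disjoint_family) (auto simp: disjoint_family_on_def fl, simp add: B_def)
  moreover have "(\<Union>n. B n) = UNIV" by (auto simp: fl)
  moreover have "(\<integral>\<^sup>+x \<in> B n. f x \<partial>lebesgue) = (\<integral>\<^sup>+x. f (of_int (int_decode n) + x) \<partial>\<mu>\<^sub>I)" for n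
  proof -
    have [measurable]: "B n \<in> sets lebesgue" by (simp add: B_def)
    have ne: "AE x in lebesgue. x \<noteq> (1::real)"
      using AE_not_in[of "{1::real}" lebesgue] by simp
    have "(\<integral>\<^sup>+x \<in> B n. f x \<partial>lebesgue)
        = (\<integral>\<^sup>+x. f (of_int (int_decode n) + 1 * x) * indicator (B n) (of_int (int_decode n) + 1 * x) \<partial>lebesgue)"
      by (subst nn_integral_real_affine_lebesgue[where c=1 and t="of_int (int_decode n)"]) auto
    also have "\<dots> = (\<integral>\<^sup>+x. f (of_int (int_decode n) + x) * indicator {0..1} x \<partial>lebesgue)"
      by (rule nn_integral_cong_AE, use ne in eventually_elim) (auto simp: B_def indicator_def)
    also have "\<dots> = (\<integral>\<^sup>+x. f (of_int (int_decode n) + x) \<partial>\<mu>\<^sub>I)"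
      by (simp add: nn_integral_restrict_space)
    finally show ?thesis .
  qed
  ultimately show ?thesis by simp
qed

lemma L2_unit_support:
  assumes "f \<in> borel_measurable lebesgue" "\<And>t. t \<notin> {0..1} \<Longrightarrow> f t = 0"
  shows "f \<in> L2 \<mu>\<^sub>I \<longleftrightarrow> f \<in> L2 lebesgue" "norm_I f = norm_R f"
proof -
  have eq: "(\<lambda>x. indicator {0..1} x * (cmod (f x))\<^sup>2) = (\<lambda>x. (cmod (f x))\<^sup>2)"
    using assms(2) by (force simp: indicator_def)
  have "f \<in> borel_measurable \<mu>\<^sub>I" using assms(1) by (rule measurable_restrict_space1)
  then show "f \<in> L2 \<mu>\<^sub>I \<longleftrightarrow> f \<in> L2 lebesgue"
    using assms(1) by (simp add: L2_def integrable_restrict_space eq)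
  show "norm_I f = norm_R f"
    by (simp add: l2_norm_def integral_restrict_space eq)
qed

lemma L2_support_integrable:
  assumes f: "f \<in> L2 lebesgue" and "\<And>t. t \<notin> {a..b::real} \<Longrightarrow> f t = 0"
  shows "integrable lebesgue f"
proof -
  have "integrable lebesgue (\<lambda>x. indicator {a..b} x + (cmod (f x))\<^sup>2)"
    using L2_integrable[OF f] by (intro Bochner_Integration.integrable_add) (auto simp: emeasure_lborel_Icc_eq)
  then show ?thesis
  proof (rule Bochner_Integration.integrable_bound)
    have "cmod z \<le> 1 + (cmod z)\<^sup>2" for z
    proof -
      have "2 * cmod z \<le> (cmod z)\<^sup>2 + 1" using sum_squares_bound[of "cmod z" 1] by simp
      then show ?thesis using zero_le_power2[of "cmod z"] by linarith
    qed
    then show "AE x in lebesgue. norm (f x) \<le> norm (indicator {a..b} x + (cmod (f x))\<^sup>2)"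
      using assms(2) by (intro AE_I2) (force simp: indicator_def)
  qed (use f in \<open>simp add: L2_def\<close>)
qed

text \<open>
  With the sign \<open>+\<close> in the exponent, translation by \<open>y\<close> becomes multiplication by
  \<open>cis (2 * pi * \<xi> * y)\<close>.
\<close>
definition fourier :: "(real \<Rightarrow> complex) \<Rightarrow> real \<Rightarrow> complex" where
  "fourier f \<xi> = (LINT t|lebesgue. cis (2 * pi * \<xi> * t) * f t)"

lemma fourier_integrable:
  "integrable lebesgue f \<Longrightarrow> integrable lebesgue (\<lambda>t. cis (r * t) * f t)"
  by (rule Bochner_Integration.integrable_bound[where f=f])
     (auto simp: norm_mult intro!: borel_measurable_times cis_measurable)

lemma tendsto_cis:
  fixes f :: "'a::t2_space \<Rightarrow> real"
  shows "(f \<longlongrightarrow> l) F \<Longrightarrow> ((\<lambda>x. cis (f x)) \<longlongrightarrow> cis l) F"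
  unfolding cis.ctr by (intro tendsto_Complex tendsto_cos tendsto_sin)

lemma continuous_fourier:
  assumes "integrable lebesgue f"
  shows "continuous_on UNIV (fourier f)"
proof (intro continuous_at_imp_continuous_on ballI)
  fix \<xi>
  show "isCont (fourier f) \<xi>"
  proof (unfold continuous_at_sequentially, intro allI impI, unfold o_def)
    fix s assume s: "s \<longlonglongrightarrow> \<xi>"
    show "(\<lambda>n. fourier f (s n)) \<longlonglongrightarrow> fourier f \<xi>"
      unfolding fourier_def
    proof (rule integral_dominated_convergence[where w="\<lambda>t. norm (f t)"])
      show "AE t in lebesgue. (\<lambda>n. cis (2 * pi * s n * t) * f t) \<longlonglongrightarrow> cis (2 * pi * \<xi> * t) * f t"
      proof (intro AE_I2 tendsto_mult tendsto_const)
        fix t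
        have "(\<lambda>n. 2 * pi * s n * t) \<longlonglongrightarrow> 2 * pi * \<xi> * t" using s by (intro tendsto_intros)
        then show "(\<lambda>n. cis (2 * pi * s n * t)) \<longlonglongrightarrow> cis (2 * pi * \<xi> * t)"
          by (rule tendsto_cis)
      qed
    qed (use assms fourier_integrable[OF assms] in \<open>auto simp: norm_mult\<close>)
  qed
qed

text \<open>
  The values of the transform at the points \<open>k + \<theta>\<close>, for integers \<open>k\<close>, are up to the sign of \<open>k\<close> the
  Fourier coefficients of \<open>t \<mapsto> cis (2 * pi * \<theta> * t) * f t\<close>. By Parseval's identity the sum of their
  squared moduli is the squared norm of \<open>f\<close> whatever \<open>\<theta>\<close> is; integration over \<open>\<theta> \<in> [0,1]\<close> gives the claim.
\<close>
lemma Plancherel_unit: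
  assumes f: "f \<in> L2 lebesgue" and supp: "\<And>t. t \<notin> {0..1} \<Longrightarrow> f t = 0"
  shows "(\<integral>\<^sup>+\<xi>. ennreal ((cmod (fourier f \<xi>))\<^sup>2) \<partial>lebesgue) = ennreal ((norm_R f)\<^sup>2)"
proof -
  have fm: "f \<in> borel_measurable lebesgue" using f by (simp add: L2_def)
  have fi: "integrable lebesgue f" by (rule L2_support_integrable[OF f supp])
  have cont: "continuous_on UNIV (fourier f)" by (rule continuous_fourier[OF fi])
  have [measurable]: "fourier f \<in> borel_measurable lebesgue" using cont by (rule continuous_lebesgue_measurable)
  define g where "g \<theta> t = cis (2 * pi * \<theta> * t) * f t" for \<theta> t
  have gL: "g \<theta> \<in> L2 lebesgue" for \<theta>
    unfolding g_def by (rule L2_mult_bounded[OF f cis_measurable, of _ 1]) simp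
  have gm: "g \<theta> \<in> borel_measurable lebesgue" for \<theta> using gL by (simp add: L2_def)
  have gs: "g \<theta> t = 0" if "t \<notin> {0..1}" for \<theta> t using supp[OF that] by (simp add: g_def)
  have "norm_R (g \<theta>) = norm_R f" for \<theta>
    by (simp add: l2_norm_def g_def norm_mult)
  then have gI: "g \<theta> \<in> L2 \<mu>\<^sub>I" "norm_I (g \<theta>) = norm_R f" for \<theta>
    using L2_unit_support[OF gm gs, of \<theta>] gL[of \<theta>] by metis+
  have coeff: "fourier f (of_int k + \<theta>) = fourier_coeff (g \<theta>) (- k)" for k \<theta>
  proof -
    have "fourier_coeff (g \<theta>) (- k) = (LINT t|lebesgue. indicator {0..1} t *\<^sub>R (g \<theta> t * cnj (exponential (- k) t)))"
      unfolding fourier_coeff_def l2_inner_def by (subst integral_restrict_space) auto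
    also have "\<dots> = (LINT t|lebesgue. g \<theta> t * exponential k t)"
      using gs by (intro Bochner_Integration.integral_cong) (auto simp: indicator_def cnj_exponential)
    also have "\<dots> = fourier f (of_int k + \<theta>)"
      unfolding fourier_def g_def exponential_cis
      by (intro Bochner_Integration.integral_cong refl) (simp add: distrib_left distrib_right cis_mult[symmetric] mult_ac)
    finally show ?thesis by simp
  qed
  have bij: "bij (\<lambda>n. - int_decode n)"
    using bij_comp[OF bij_int_decode bij_uminus] by (simp add: o_def)
  have "(\<integral>\<^sup>+\<xi>. ennreal ((cmod (fourier f \<xi>))\<^sup>2) \<partial>lebesgue)
      = (\<Sum>n. \<integral>\<^sup>+\<theta>. ennreal ((cmod (fourier f (of_int (int_decode n) + \<theta>)))\<^sup>2) \<partial>\<mu>\<^sub>I)"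
    by (rule nn_integral_split_unit) simp
  also have "\<dots> = (\<integral>\<^sup>+\<theta>. (\<Sum>n. ennreal ((cmod (fourier f (of_int (int_decode n) + \<theta>)))\<^sup>2)) \<partial>\<mu>\<^sub>I)"
  proof (rule nn_integral_suminf[symmetric])
    fix n
    have "continuous_on UNIV (\<lambda>\<theta>. fourier f (of_int (int_decode n) + \<theta>))"
      by (rule continuous_on_compose2[OF cont]) (auto intro!: continuous_intros)
    then have [measurable]: "(\<lambda>\<theta>. fourier f (of_int (int_decode n) + \<theta>)) \<in> borel_measurable \<mu>\<^sub>I"
      by (intro measurable_restrict_space1 continuous_lebesgue_measurable)
    show "(\<lambda>\<theta>. ennreal ((cmod (fourier f (of_int (int_decode n) + \<theta>)))\<^sup>2)) \<in> borel_measurable \<mu>\<^sub>I"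
      by measurable
  qed
  also have "\<dots> = (\<integral>\<^sup>+\<theta>. ennreal ((norm_R f)\<^sup>2) \<partial>\<mu>\<^sub>I)"
    unfolding coeff by (subst Parseval_ennreal[OF gI(1) bij]) (simp add: gI(2))
  also have "\<dots> = ennreal ((norm_R f)\<^sup>2)"
    by (simp add: emeasure_restrict_space)
  finally show ?thesis .
qed

definition bounded_support :: "(real \<Rightarrow> complex) \<Rightarrow> bool" where
  "bounded_support f \<longleftrightarrow> (\<exists>L>0. \<forall>t. t \<notin> {-L..L} \<longrightarrow> f t = 0)"

lemma bounded_support_integrable:
  "f \<in> L2 lebesgue \<Longrightarrow> bounded_support f \<Longrightarrow> integrable lebesgue f"
  unfolding bounded_support_def using L2_support_integrable by blast

text \<open>
  An affine change of variables moves the support into the unit interval.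
\<close>
lemma Plancherel:
  assumes f: "f \<in> L2 lebesgue" and "bounded_support f"
  shows "fourier f \<in> L2 lebesgue" "norm_R (fourier f) = norm_R f"
proof -
  obtain L where L: "L > 0" "\<And>t. t \<notin> {-L..L} \<Longrightarrow> f t = 0"
    using assms(2) by (auto simp: bounded_support_def)
  define F where "F t = f (- L + 2 * L * t)" for t
  have fm: "f \<in> borel_measurable lebesgue" using f by (simp add: L2_def)
  then have Fm: "F \<in> borel_measurable lebesgue" unfolding F_def by (rule measurable_affine)
  have Fs: "F t = 0" if "t \<notin> {0..1}" for t
  proof -
    have "\<not> (0 \<le> t \<and> t \<le> 1)" using that by simp
    then have "\<not> (0 \<le> 2 * L * t \<and> 2 * L * t \<le> 2 * L)"
      using L(1) by (auto simp: zero_le_mult_iff)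
    then show ?thesis unfolding F_def by (intro L(2)) auto
  qed
  have nf: "(\<integral>\<^sup>+x. ennreal ((cmod (f x))\<^sup>2) \<partial>lebesgue) = ennreal (2 * L) * (\<integral>\<^sup>+x. ennreal ((cmod (F x))\<^sup>2) \<partial>lebesgue)"
    unfolding F_def using L(1) fm
    by (subst nn_integral_real_affine_lebesgue[where c="2 * L" and t="-L"]) auto
  have "integrable lebesgue (\<lambda>x. (cmod (F x))\<^sup>2)"
    unfolding F_def using L(1) lebesgue_integrable_real_affine_iff[of "2 * L" "\<lambda>x. (cmod (f x))\<^sup>2" "- L"] L2_integrable[OF f]
    by simp
  then have FL: "F \<in> L2 lebesgue" using Fm by (simp add: L2_def)
  have fi: "integrable lebesgue f" by (rule bounded_support_integrable[OF assms])
  have [measurable]: "fourier f \<in> borel_measurable lebesgue"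
    by (rule continuous_lebesgue_measurable[OF continuous_fourier[OF fi]])
  have scale: "fourier f (0 + 1 / (2 * L) * \<xi>) = of_real (2 * L) * cis (- pi * \<xi>) * fourier F \<xi>" for \<xi>
  proof -
    have "fourier f (0 + 1 / (2 * L) * \<xi>)
        = \<bar>2 * L\<bar> *\<^sub>R (LINT t|lebesgue. cis (2 * pi * (0 + 1 / (2 * L) * \<xi>) * (- L + 2 * L * t)) * f (- L + 2 * L * t))"
      unfolding fourier_def using L(1) by (intro lebesgue_integral_real_affine) simp
    also have "(\<lambda>t. cis (2 * pi * (0 + 1 / (2 * L) * \<xi>) * (- L + 2 * L * t)) * f (- L + 2 * L * t))
        = (\<lambda>t. cis (- pi * \<xi>) * (cis (2 * pi * \<xi> * t) * F t))"
    proof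
      fix t
      have "2 * pi * (0 + 1 / (2 * L) * \<xi>) * (- L + 2 * L * t) = - pi * \<xi> + 2 * pi * \<xi> * t"
        using L(1) by (simp add: field_simps)
      then show "cis (2 * pi * (0 + 1 / (2 * L) * \<xi>) * (- L + 2 * L * t)) * f (- L + 2 * L * t)
          = cis (- pi * \<xi>) * (cis (2 * pi * \<xi> * t) * F t)"
        by (simp only: F_def cis_mult[symmetric] mult.assoc)
    qed
    finally show ?thesis using L(1) by (simp add: fourier_def scaleR_conv_of_real)
  qed
  have "(\<integral>\<^sup>+x. ennreal ((cmod (fourier f x))\<^sup>2) \<partial>lebesgue)
      = ennreal (1 / (2 * L)) * (\<integral>\<^sup>+x. ennreal ((cmod (fourier f (0 + 1 / (2 * L) * x)))\<^sup>2) \<partial>lebesgue)"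
    using L(1) by (subst nn_integral_real_affine_lebesgue[where c="1 / (2 * L)" and t=0]) auto
  also have "\<dots> = ennreal (1 / (2 * L)) * (\<integral>\<^sup>+x. ennreal ((2 * L)\<^sup>2) * ennreal ((cmod (fourier F x))\<^sup>2) \<partial>lebesgue)"
    unfolding scale using L(1) by (simp add: norm_mult power_mult_distrib ennreal_mult)
  also have "\<dots> = ennreal (1 / (2 * L)) * (ennreal ((2 * L)\<^sup>2) * (\<integral>\<^sup>+x. ennreal ((cmod (fourier F x))\<^sup>2) \<partial>lebesgue))"
    using continuous_lebesgue_measurable[OF continuous_fourier[OF L2_support_integrable[OF FL Fs]]]
    by (subst nn_integral_cmult) auto
  also have "\<dots> = ennreal (2 * L) * ennreal ((norm_R F)\<^sup>2)"
  proof -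
    have "ennreal (1 / (2 * L)) * ennreal ((2 * L)\<^sup>2) = ennreal (2 * L)"
      using L(1) by (simp add: power2_eq_square flip: ennreal_mult)
    moreover have "(\<integral>\<^sup>+x. ennreal ((cmod (fourier F x))\<^sup>2) \<partial>lebesgue) = ennreal ((norm_R F)\<^sup>2)"
      by (rule Plancherel_unit[OF FL]) (rule Fs)
    ultimately show ?thesis by (simp only: mult.assoc[symmetric])
  qed
  also have "\<dots> = ennreal ((norm_R f)\<^sup>2)"
    using nf unfolding nn_integral_L2[OF f] nn_integral_L2[OF FL] by simp
  finally have *: "fourier f \<in> L2 lebesgue \<and> (norm_R (fourier f))\<^sup>2 = (norm_R f)\<^sup>2"
    by (intro L2_nn_integralI) auto
  then show "fourier f \<in> L2 lebesgue" by simp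
  show "norm_R (fourier f) = norm_R f"
    using * by (metis l2_norm_nonneg power2_eq_iff_nonneg)
qed

lemma translation_L2:
  assumes "f \<in> L2 lebesgue"
  shows "translation y f \<in> L2 lebesgue" "norm_R (translation y f) = norm_R f"
proof -
  have "(\<lambda>t. f (- y + 1 * t)) \<in> borel_measurable lebesgue"
    using assms by (intro measurable_affine) (simp add: L2_def)
  moreover have "integrable lebesgue (\<lambda>t. (cmod (f (- y + 1 * t)))\<^sup>2)"
    using lebesgue_integrable_real_affine_iff[of 1 "\<lambda>x. (cmod (f x))\<^sup>2" "- y"] L2_integrable[OF assms] by simp
  ultimately show "translation y f \<in> L2 lebesgue" by (simp add: translation_def L2_def)
  show "norm_R (translation y f) = norm_R f"
    using lebesgue_integral_real_affine[of 1 "\<lambda>x. (cmod (f x))\<^sup>2" "- y"]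
    by (simp add: l2_norm_def translation_def)
qed

lemma translation_bounded_support:
  assumes "bounded_support f" shows "bounded_support (translation y f)"
proof -
  obtain L where L: "L > 0" "\<And>t. t \<notin> {-L..L} \<Longrightarrow> f t = 0"
    using assms by (auto simp: bounded_support_def)
  show ?thesis unfolding bounded_support_def translation_def
  proof (intro exI[of _ "L + \<bar>y\<bar>"] conjI allI impI)
    fix t assume "t \<notin> {- (L + \<bar>y\<bar>)..L + \<bar>y\<bar>}"
    then show "f (t - y) = 0" by (intro L(2)) auto
  qed (use L in auto)
qed

lemma bounded_support_lincomb:
  assumes "finite J" "\<And>n. n \<in> J \<Longrightarrow> bounded_support (F n)"
  shows "bounded_support (\<lambda>t. \<Sum>n\<in>J. a n * F n t)"
  using assms
proof (induction J)
  case empty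
  then show ?case by (auto simp: bounded_support_def intro: exI[of _ 1])
next
  case (insert n J)
  then have "bounded_support (F n)" "bounded_support (\<lambda>t. \<Sum>n\<in>J. a n * F n t)" by auto
  then obtain L K where LK: "L > 0" "\<And>t. t \<notin> {-L..L} \<Longrightarrow> F n t = 0"
     "K > 0" "\<And>t. t \<notin> {-K..K} \<Longrightarrow> (\<Sum>n\<in>J. a n * F n t) = 0"
    unfolding bounded_support_def by (elim exE conjE) blast
  show ?case unfolding bounded_support_def
  proof (intro exI[of _ "max L K"] conjI allI impI)
    fix t assume "t \<notin> {- max L K..max L K}"
    then have "F n t = 0" "(\<Sum>n\<in>J. a n * F n t) = 0" by (auto intro!: LK(2,4))
    then show "(\<Sum>n\<in>insert n J. a n * F n t) = 0" using insert(1,2) by simp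
  qed (use LK in auto)
qed

lemma fourier_translation:
  "fourier (translation y f) \<xi> = cis (2 * pi * \<xi> * y) * fourier f \<xi>"
proof -
  have "fourier (translation y f) \<xi> = (LINT t|lebesgue. cis (2 * pi * \<xi> * (y + 1 * t)) * f (y + 1 * t - y))"
    unfolding fourier_def translation_def
    by (subst lebesgue_integral_real_affine[where c=1 and t=y]) auto
  also have "\<dots> = (LINT t|lebesgue. cis (2 * pi * \<xi> * y) * (cis (2 * pi * \<xi> * t) * f t))"
    by (intro Bochner_Integration.integral_cong refl) (simp add: cis_mult distrib_left flip: mult.assoc)
  finally show ?thesis by (simp add: fourier_def)
qed

lemma fourier_lincomb:
  assumes "\<And>n. n \<in> J \<Longrightarrow> integrable lebesgue (F n)"
  shows "fourier (\<lambda>t. \<Sum>n\<in>J. a n * F n t) \<xi> = (\<Sum>n\<in>J. a n * fourier (F n) \<xi>)"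
proof -
  have "fourier (\<lambda>t. \<Sum>n\<in>J. a n * F n t) \<xi>
      = (LINT t|lebesgue. (\<Sum>n\<in>J. a n * (cis (2 * pi * \<xi> * t) * F n t)))"
    unfolding fourier_def by (simp add: sum_distrib_left mult.left_commute)
  also have "\<dots> = (\<Sum>n\<in>J. a n * fourier (F n) \<xi>)"
    using assms unfolding fourier_def
    by (subst Bochner_Integration.integral_sum) (auto intro!: integrable_mult_right fourier_integrable)
  finally show ?thesis .
qed

abbreviation exp_sum :: "'i set \<Rightarrow> ('i \<Rightarrow> complex) \<Rightarrow> ('i \<Rightarrow> real) \<Rightarrow> real \<Rightarrow> complex" where
  "exp_sum J a \<nu> \<xi> \<equiv> (\<Sum>n\<in>J. a n * cis (2 * pi * \<xi> * \<nu> n))"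

lemma exp_sum_bound: "cmod (exp_sum J a \<nu> \<xi>) \<le> (\<Sum>n\<in>J. cmod (a n))"
  by (rule order_trans[OF norm_sum]) (simp add: norm_mult)

lemma continuous_exp_sum: "continuous_on A (exp_sum J a \<nu>)"
  by (intro continuous_intros)

lemma exp_sum_measurable: "exp_sum J a \<nu> \<in> borel_measurable lebesgue"
  by (intro continuous_lebesgue_measurable continuous_exp_sum)

lemma exp_sum_mult_L2: "\<psi> \<in> L2 lebesgue \<Longrightarrow> (\<lambda>\<xi>. exp_sum J a \<nu> \<xi> * \<psi> \<xi>) \<in> L2 lebesgue"
  by (rule L2_mult_bounded[OF _ exp_sum_measurable exp_sum_bound])

lemma translates_norm_bounded_support:
  assumes f: "f \<in> L2 lebesgue" "bounded_support f" and J: "finite J"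
  shows "norm_R (\<lambda>t. \<Sum>n\<in>J. a n * translation (\<nu> n) f t)
      = norm_R (\<lambda>\<xi>. exp_sum J a \<nu> \<xi> * fourier f \<xi>)"
proof -
  let ?g = "\<lambda>t. \<Sum>n\<in>J. a n * translation (\<nu> n) f t"
  have g: "?g \<in> L2 lebesgue" "bounded_support ?g"
    using f J by (auto intro!: L2_lincomb translation_L2 bounded_support_lincomb translation_bounded_support)
  have "fourier ?g = (\<lambda>\<xi>. exp_sum J a \<nu> \<xi> * fourier f \<xi>)"
  proof
    fix \<xi>
    have "integrable lebesgue (translation (\<nu> n) f)" for n
      using f by (intro bounded_support_integrable translation_L2 translation_bounded_support)
    then show "fourier ?g \<xi> = exp_sum J a \<nu> \<xi> * fourier f \<xi>"
      by (simp add: fourier_lincomb fourier_translation sum_distrib_right mult.assoc)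
  qed
  then show ?thesis using Plancherel(2)[OF g] by simp
qed

text \<open>
  The Fourier-Plancherel transform, as a relation because elements of \<open>L\<^sup>2\<close> are represented by
  functions: \<open>\<psi>\<close> is the limit of the transforms of some approximation of \<open>\<phi>\<close> by functions of bounded
  support.
\<close>
definition fourier_transform_L2 :: "(real \<Rightarrow> complex) \<Rightarrow> (real \<Rightarrow> complex) \<Rightarrow> bool" where
  "fourier_transform_L2 \<phi> \<psi> \<longleftrightarrow> \<psi> \<in> L2 lebesgue \<and>
    (\<exists>f. (\<forall>k. f k \<in> L2 lebesgue \<and> bounded_support (f k)) \<and>
         (\<lambda>k. norm_R (\<lambda>t. \<phi> t - f k t)) \<longlonglongrightarrow> 0 \<and>
         (\<lambda>k. norm_R (\<lambda>t. \<psi> t - fourier (f k) t)) \<longlonglongrightarrow> 0)"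

text \<open>
  By Plancherel's theorem, the transforms of a rapidly convergent sequence of truncations of \<open>\<phi>\<close>
  converge just as rapidly.
\<close>
lemma fourier_transform_L2_exists:
  assumes \<phi>: "\<phi> \<in> L2 lebesgue"
  shows "\<exists>\<psi>. fourier_transform_L2 \<phi> \<psi>"
proof -
  have [measurable]: "\<phi> \<in> borel_measurable lebesgue" using \<phi> by (simp add: L2_def)
  define c where "c k t = (if \<bar>t\<bar> \<le> real k then \<phi> t else 0)" for k :: nat and t
  have cm: "c k \<in> borel_measurable lebesgue" for k
  proof -
    have "(\<lambda>t. indicator {- real k..real k} t * \<phi> t) \<in> borel_measurable lebesgue"
      using \<phi> by (intro borel_measurable_times borel_measurable_indicator) (auto simp: L2_def)
    moreover have "(\<lambda>t. indicator {- real k..real k} t * \<phi> t) = c k"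
      by (auto simp: c_def indicator_def fun_eq_iff)
    ultimately show ?thesis by simp
  qed
  have cL: "c k \<in> L2 lebesgue" for k
    by (rule L2_dominated[OF \<phi> cm]) (auto simp: c_def)
  have cs: "bounded_support (c k)" for k
    unfolding bounded_support_def by (intro exI[of _ "real k + 1"]) (auto simp: c_def)
  have lim: "(\<lambda>k. norm_R (\<lambda>t. \<phi> t - c k t)) \<longlonglongrightarrow> 0"
  proof (rule l2_norm_dominated_convergence[OF \<phi>])
    show "AE t in lebesgue. (\<lambda>k. \<phi> t - c k t) \<longlonglongrightarrow> 0"
    proof (intro AE_I2 tendsto_eventually)
      fix t :: real
      show "\<forall>\<^sub>F k in sequentially. \<phi> t - c k t = 0"
        using eventually_ge_at_top[of "nat \<lceil>\<bar>t\<bar>\<rceil>"]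
        by eventually_elim (auto simp: c_def nat_ceiling_le_eq)
    qed
    show "(\<lambda>t. \<phi> t - c k t) \<in> borel_measurable lebesgue" for k
      using cm[of k, measurable] by measurable
  qed (auto simp: c_def)
  have "\<exists>m. norm_R (\<lambda>t. \<phi> t - c m t) < (1/2) ^ j" for j
  proof -
    have "\<forall>\<^sub>F k in sequentially. norm_R (\<lambda>t. \<phi> t - c k t) < (1/2) ^ j"
      using lim by (rule order_tendstoD) simp
    then show ?thesis by (auto simp: eventually_sequentially)
  qed
  then obtain m where m: "\<And>j. norm_R (\<lambda>t. \<phi> t - c (m j) t) < (1/2) ^ j" by metis
  define f where "f j = c (m j)" for j
  have fL: "f j \<in> L2 lebesgue" "bounded_support (f j)" for j by (simp_all add: f_def cL cs)
  have fd: "fourier (\<lambda>t. f i t - f j t) \<xi> = fourier (f i) \<xi> - fourier (f j) \<xi>" for i j \<xi>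
    using bounded_support_integrable[OF fL] unfolding fourier_def
    by (simp add: right_diff_distrib fourier_integrable)
  have ds: "bounded_support (\<lambda>t. f i t - f j t)" for i j
    using bounded_support_lincomb[of "{True, False}" "\<lambda>b. if b then f i else f j" "\<lambda>b. if b then 1 else -1"] fL
    by simp
  have FL: "fourier (f j) \<in> L2 lebesgue" for j by (rule Plancherel[OF fL])
  have fdiff: "norm_R (\<lambda>t. f (Suc j) t - f j t) \<le> 2 * (1/2) ^ j" for j
  proof -
    have "norm_R (\<lambda>t. f (Suc j) t - f j t)
        \<le> norm_R (\<lambda>t. f (Suc j) t - \<phi> t) + norm_R (\<lambda>t. \<phi> t - f j t)"
      using l2_triangle[OF L2_diff[OF fL(1)[of "Suc j"] \<phi>] L2_diff[OF \<phi> fL(1)[of j]]] by simp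
    also have "\<dots> \<le> (1/2) ^ Suc j + (1/2) ^ j"
      using m[of "Suc j"] m[of j] by (intro add_mono) (simp_all add: f_def l2_norm_minus_commute[of _ "c _"])
    also have "(1/2::real) ^ Suc j + (1/2) ^ j \<le> 2 * (1/2) ^ j" by simp
    finally show ?thesis .
  qed
  have "summable (\<lambda>j. norm_R (\<lambda>\<xi>. fourier (f (Suc j)) \<xi> - fourier (f j) \<xi>))"
  proof (rule summable_comparison_test')
    show "summable (\<lambda>j. 2 * (1/2::real) ^ j)" by (intro summable_mult summable_geometric) simp
    fix j :: nat
    have "(\<lambda>\<xi>. fourier (f (Suc j)) \<xi> - fourier (f j) \<xi>) = fourier (\<lambda>t. f (Suc j) t - f j t)"
      by (rule ext) (simp add: fd)
    moreover have "norm_R (fourier (\<lambda>t. f (Suc j) t - f j t)) = norm_R (\<lambda>t. f (Suc j) t - f j t)"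
      by (intro Plancherel L2_diff fL ds)
    ultimately show "norm (norm_R (\<lambda>\<xi>. fourier (f (Suc j)) \<xi> - fourier (f j) \<xi>)) \<le> 2 * (1/2) ^ j"
      using fdiff by simp
  qed
  from L2_limit_of_fast_Cauchy[OF FL this] obtain \<psi> where \<psi>: "\<psi> \<in> L2 lebesgue"
    "(\<lambda>k. norm_R (\<lambda>x. \<psi> x - fourier (f k) x)) \<longlonglongrightarrow> 0" by auto
  moreover have "(\<lambda>k. norm_R (\<lambda>t. \<phi> t - f k t)) \<longlonglongrightarrow> 0"
  proof (rule Lim_null_comparison)
    show "(\<lambda>k. (1/2::real) ^ k) \<longlonglongrightarrow> 0" by (rule LIMSEQ_power_zero) simp
  qed (use m in \<open>auto simp: f_def less_imp_le\<close>)
  ultimately show ?thesis unfolding fourier_transform_L2_def using \<psi> fL by blast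
qed

lemma l2_norm_limit_unique:
  assumes "g \<in> L2 M" "\<And>k. u k \<in> L2 M" "h \<in> L2 N" "\<And>k. v k \<in> L2 N"
    "\<And>k. l2_norm M (u k) = l2_norm N (v k)"
    "\<And>k. l2_norm M (\<lambda>x. g x - u k x) \<le> C * \<alpha> k" "\<alpha> \<longlonglongrightarrow> 0"
    "\<And>k. l2_norm N (\<lambda>x. h x - v k x) \<le> C * \<beta> k" "\<beta> \<longlonglongrightarrow> 0"
  shows "l2_norm M g = l2_norm N h"
proof -
  have "(\<lambda>k. l2_norm M (\<lambda>x. g x - u k x)) \<longlonglongrightarrow> 0"
    by (rule Lim_null_comparison[OF _ tendsto_mult_right_zero[OF assms(7), of C]]) (simp add: assms(6))
  then have 1: "(\<lambda>k. l2_norm M (u k)) \<longlonglongrightarrow> l2_norm M g"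
    by (rule l2_norm_limit[OF assms(1,2)])
  have "(\<lambda>k. l2_norm N (\<lambda>x. h x - v k x)) \<longlonglongrightarrow> 0"
    by (rule Lim_null_comparison[OF _ tendsto_mult_right_zero[OF assms(9), of C]]) (simp add: assms(8))
  then have 2: "(\<lambda>k. l2_norm N (v k)) \<longlonglongrightarrow> l2_norm N h"
    by (rule l2_norm_limit[OF assms(3,4)])
  show ?thesis using LIMSEQ_unique[OF 1] 2 unfolding assms(5) by blast
qed

text \<open>
  For bounded support this is Plancherel's theorem applied to the combination itself. For fixed
  coefficients both sides depend continuously on \<open>\<phi>\<close> and \<open>\<psi>\<close>.
\<close>
theorem translates_norm:
  assumes \<phi>: "\<phi> \<in> L2 lebesgue" and F: "fourier_transform_L2 \<phi> \<psi>" and J: "finite J"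
  shows "norm_R (\<lambda>t. \<Sum>n\<in>J. a n * translation (\<nu> n) \<phi> t)
      = norm_R (\<lambda>\<xi>. exp_sum J a \<nu> \<xi> * \<psi> \<xi>)"
proof -
  obtain f where f: "\<And>k. f k \<in> L2 lebesgue" "\<And>k. bounded_support (f k)"
     "(\<lambda>k. norm_R (\<lambda>t. \<phi> t - f k t)) \<longlonglongrightarrow> 0"
     "(\<lambda>k. norm_R (\<lambda>t. \<psi> t - fourier (f k) t)) \<longlonglongrightarrow> 0" and \<psi>: "\<psi> \<in> L2 lebesgue"
    using F by (auto simp: fourier_transform_L2_def)
  have FL: "fourier (f k) \<in> L2 lebesgue" for k by (rule Plancherel[OF f(1,2)])
  let ?C = "\<Sum>n\<in>J. cmod (a n)"
  show ?thesis
  proof (rule l2_norm_limit_unique[where C="?C"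
      and u="\<lambda>k t. \<Sum>n\<in>J. a n * translation (\<nu> n) (f k) t"
      and v="\<lambda>k \<xi>. exp_sum J a \<nu> \<xi> * fourier (f k) \<xi>"
      and \<alpha>="\<lambda>k. norm_R (\<lambda>t. \<phi> t - f k t)"
      and \<beta>="\<lambda>k. norm_R (\<lambda>t. \<psi> t - fourier (f k) t)"])
    show "(\<lambda>t. \<Sum>n\<in>J. a n * translation (\<nu> n) \<phi> t) \<in> L2 lebesgue"
      by (intro L2_lincomb translation_L2 \<phi>)
    show "(\<lambda>\<xi>. exp_sum J a \<nu> \<xi> * \<psi> \<xi>) \<in> L2 lebesgue" by (rule exp_sum_mult_L2[OF \<psi>])
    show "(\<lambda>k. norm_R (\<lambda>t. \<phi> t - f k t)) \<longlonglongrightarrow> 0"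
      "(\<lambda>k. norm_R (\<lambda>t. \<psi> t - fourier (f k) t)) \<longlonglongrightarrow> 0" by (fact f)+
    fix k
    show "(\<lambda>t. \<Sum>n\<in>J. a n * translation (\<nu> n) (f k) t) \<in> L2 lebesgue"
      by (intro L2_lincomb translation_L2 f)
    show "(\<lambda>\<xi>. exp_sum J a \<nu> \<xi> * fourier (f k) \<xi>) \<in> L2 lebesgue" by (rule exp_sum_mult_L2[OF FL])
    show "norm_R (\<lambda>t. \<Sum>n\<in>J. a n * translation (\<nu> n) (f k) t)
        = norm_R (\<lambda>\<xi>. exp_sum J a \<nu> \<xi> * fourier (f k) \<xi>)"
      by (rule translates_norm_bounded_support[OF f(1,2) J])
    have "norm_R (\<lambda>t. (\<Sum>n\<in>J. a n * translation (\<nu> n) \<phi> t) - (\<Sum>n\<in>J. a n * translation (\<nu> n) (f k) t))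
       = norm_R (\<lambda>t. \<Sum>n\<in>J. a n * translation (\<nu> n) (\<lambda>t. \<phi> t - f k t) t)"
      by (simp add: translation_def right_diff_distrib sum_subtractf)
    also have "\<dots> \<le> (\<Sum>n\<in>J. norm_R (\<lambda>t. a n * translation (\<nu> n) (\<lambda>t. \<phi> t - f k t) t))"
      by (intro l2_norm_sum_le L2_cmult translation_L2 L2_diff \<phi> f)
    also have "\<dots> = ?C * norm_R (\<lambda>t. \<phi> t - f k t)"
      by (simp add: l2_norm_cmult translation_L2(2)[OF L2_diff[OF \<phi> f(1)]] sum_distrib_right)
    finally show "norm_R (\<lambda>t. (\<Sum>n\<in>J. a n * translation (\<nu> n) \<phi> t) - (\<Sum>n\<in>J. a n * translation (\<nu> n) (f k) t))
       \<le> ?C * norm_R (\<lambda>t. \<phi> t - f k t)" .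
    have "norm_R (\<lambda>\<xi>. exp_sum J a \<nu> \<xi> * \<psi> \<xi> - exp_sum J a \<nu> \<xi> * fourier (f k) \<xi>)
      = norm_R (\<lambda>\<xi>. exp_sum J a \<nu> \<xi> * (\<psi> \<xi> - fourier (f k) \<xi>))"
      by (simp add: right_diff_distrib)
    also have "\<dots> \<le> ?C * norm_R (\<lambda>\<xi>. \<psi> \<xi> - fourier (f k) \<xi>)"
      by (intro l2_norm_mult_bounded L2_diff \<psi> FL exp_sum_measurable exp_sum_bound sum_nonneg) simp
    finally show "norm_R (\<lambda>\<xi>. exp_sum J a \<nu> \<xi> * \<psi> \<xi> - exp_sum J a \<nu> \<xi> * fourier (f k) \<xi>)
       \<le> ?C * norm_R (\<lambda>\<xi>. \<psi> \<xi> - fourier (f k) \<xi>)" .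
  qed
qed

section \<open>Bessel, frame and Riesz bounds\<close>

lemma finite_union_of_coloring:
  assumes "finite (c ` I)" "\<And>k. k \<in> c ` I \<Longrightarrow> K {i \<in> I. c i = k}"
  shows "finite_union_of K I"
proof -
  have "partition_on I ((\<lambda>k. {i \<in> I. c i = k}) ` c ` I)"
    by (auto simp: partition_on_def disjoint_def)
  then show ?thesis unfolding finite_union_of_def
    using assms by (intro exI[of _ "(\<lambda>k. {i \<in> I. c i = k}) ` c ` I"]) auto
qed

lemma finite_union_of_mono:
  "finite_union_of K I \<Longrightarrow> (\<And>A. A \<subseteq> I \<Longrightarrow> K A \<Longrightarrow> K' A) \<Longrightarrow> finite_union_of K' I"
  unfolding finite_union_of_def by (metis partition_onD1 Union_upper)

lemma sum_eq_L2_set: "(\<Sum>i\<in>J. (f i)\<^sup>2) = (L2_set f J)\<^sup>2" for f :: "'i \<Rightarrow> real"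
  by (simp add: L2_set_def sum_nonneg)

lemma mult_self_le_cancel: "0 \<le> x \<Longrightarrow> 0 \<le> y \<Longrightarrow> x * x \<le> y * x \<Longrightarrow> x \<le> y" for x y :: real
  by (cases "x = 0") (auto intro: mult_right_le_imp_le)

lemma lincomb_norm_sq_le:
  fixes a :: "'i \<Rightarrow> complex"
  assumes "\<And>i. i \<in> J \<Longrightarrow> F i \<in> L2 M"
  defines "g \<equiv> \<lambda>x. \<Sum>i\<in>J. a i * F i x"
  shows "(l2_norm M g)\<^sup>2 \<le> L2_set (\<lambda>i. cmod (a i)) J * L2_set (\<lambda>i. cmod (l2_inner M g (F i))) J"
proof -
  have gL: "g \<in> L2 M" unfolding g_def using assms(1) by (rule L2_lincomb)
  have "(l2_norm M g)\<^sup>2 = cmod (l2_inner M g g)"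
    unfolding l2_inner_self norm_of_real by simp
  also have "l2_inner M g g = (\<Sum>i\<in>J. cnj (a i) * l2_inner M g (F i))"
    using l2_inner_sum_right[OF assms(1) gL, where a=a] unfolding g_def by simp
  also have "cmod \<dots> \<le> (\<Sum>i\<in>J. \<bar>cmod (a i)\<bar> * \<bar>cmod (l2_inner M g (F i))\<bar>)"
    by (rule order_trans[OF norm_sum]) (simp add: norm_mult)
  also have "\<dots> \<le> L2_set (\<lambda>i. cmod (a i)) J * L2_set (\<lambda>i. cmod (l2_inner M g (F i))) J"
    by (rule L2_set_mult_ineq)
  finally show ?thesis .
qed

definition upper_riesz_bound :: "'a measure \<Rightarrow> 'i set \<Rightarrow> ('i \<Rightarrow> 'a \<Rightarrow> complex) \<Rightarrow> real \<Rightarrow> bool" where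
  "upper_riesz_bound M I F B \<longleftrightarrow> (\<forall>J a. finite J \<longrightarrow> J \<subseteq> I \<longrightarrow>
     (l2_norm M (\<lambda>x. \<Sum>i\<in>J. a i * F i x))\<^sup>2 \<le> B * (\<Sum>i\<in>J. (cmod (a i))\<^sup>2))"

lemma bessel_finite_sum:
  assumes "bessel_in M V I F"
  shows "\<exists>B>0. \<forall>f\<in>V. \<forall>J. finite J \<longrightarrow> J \<subseteq> I \<longrightarrow>
    (\<Sum>i\<in>J. (cmod (l2_inner M f (F i)))\<^sup>2) \<le> B * (l2_norm M f)\<^sup>2"
proof -
  obtain B where B: "\<And>f. f \<in> V \<Longrightarrow> (\<lambda>i. (cmod (l2_inner M f (F i)))\<^sup>2) summable_on I"
    "\<And>f. f \<in> V \<Longrightarrow> (\<Sum>\<^sub>\<infinity>i\<in>I. (cmod (l2_inner M f (F i)))\<^sup>2) \<le> B * (l2_norm M f)\<^sup>2"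
    using assms by (auto simp: bessel_in_def)
  show ?thesis
  proof (intro exI[of _ "max B 1"] conjI ballI allI impI)
    fix f J assume f: "f \<in> V" "finite J" "J \<subseteq> I"
    have "(\<Sum>i\<in>J. (cmod (l2_inner M f (F i)))\<^sup>2) \<le> (\<Sum>\<^sub>\<infinity>i\<in>I. (cmod (l2_inner M f (F i)))\<^sup>2)"
      using f by (intro finite_sum_le_infsum B) auto
    also have "\<dots> \<le> B * (l2_norm M f)\<^sup>2" by (rule B(2)[OF f(1)])
    also have "\<dots> \<le> max B 1 * (l2_norm M f)\<^sup>2" by (intro mult_right_mono) auto
    finally show "(\<Sum>i\<in>J. (cmod (l2_inner M f (F i)))\<^sup>2) \<le> max B 1 * (l2_norm M f)\<^sup>2" .
  qed simp
qed

text \<open>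
  The analysis operator \<open>f \<mapsto> (\<langle>f, F i\<rangle>)\<^sub>i\<close> and the synthesis operator \<open>a \<mapsto> \<Sum> a i * F i\<close> are adjoint to
  each other, so a bound for either is a bound for the other. Taking for \<open>V\<close> only a space that
  contains the span makes this applicable to frame sequences.
\<close>
lemma bessel_imp_upper_riesz_bound:
  assumes F: "\<And>i. i \<in> I \<Longrightarrow> F i \<in> L2 M" and b: "bessel_in M V I F" and V: "lin_span I F \<subseteq> V"
  shows "\<exists>B>0. upper_riesz_bound M I F B"
proof -
  obtain B where B: "B > 0" "\<And>f J. f \<in> V \<Longrightarrow> finite J \<Longrightarrow> J \<subseteq> I \<Longrightarrow>
    (\<Sum>i\<in>J. (cmod (l2_inner M f (F i)))\<^sup>2) \<le> B * (l2_norm M f)\<^sup>2"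
    using bessel_finite_sum[OF b] by blast
  have "(l2_norm M (\<lambda>x. \<Sum>i\<in>J. a i * F i x))\<^sup>2 \<le> B * (\<Sum>i\<in>J. (cmod (a i))\<^sup>2)"
    if J: "finite J" "J \<subseteq> I" for J a
  proof -
    define g where "g = (\<lambda>x. \<Sum>i\<in>J. a i * F i x)"
    define n where "n = l2_norm M g"
    have gV: "g \<in> V" using V J by (auto simp: g_def lin_span_def)
    have "n\<^sup>2 \<le> L2_set (\<lambda>i. cmod (a i)) J * L2_set (\<lambda>i. cmod (l2_inner M g (F i))) J"
      unfolding n_def g_def by (rule lincomb_norm_sq_le) (use F J in auto)
    then have "(n\<^sup>2)\<^sup>2 \<le> (L2_set (\<lambda>i. cmod (a i)) J * L2_set (\<lambda>i. cmod (l2_inner M g (F i))) J)\<^sup>2"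
      by (intro power_mono) auto
    also have "\<dots> = (\<Sum>i\<in>J. (cmod (a i))\<^sup>2) * (\<Sum>i\<in>J. (cmod (l2_inner M g (F i)))\<^sup>2)"
      by (simp add: power_mult_distrib sum_eq_L2_set)
    also have "\<dots> \<le> (\<Sum>i\<in>J. (cmod (a i))\<^sup>2) * (B * n\<^sup>2)"
      unfolding n_def by (intro mult_left_mono B gV J sum_nonneg) auto
    finally have *: "n\<^sup>2 * n\<^sup>2 \<le> (B * (\<Sum>i\<in>J. (cmod (a i))\<^sup>2)) * n\<^sup>2"
      by (simp add: power2_eq_square mult_ac)
    have "n\<^sup>2 \<le> B * (\<Sum>i\<in>J. (cmod (a i))\<^sup>2)"
      by (rule mult_self_le_cancel[OF _ _ *]) (use B(1) in \<open>auto intro!: mult_nonneg_nonneg sum_nonneg\<close>)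
    then show ?thesis by (simp add: n_def g_def)
  qed
  then show ?thesis using B(1) by (auto simp: upper_riesz_bound_def)
qed

lemma upper_riesz_bound_imp_finite_bessel:
  assumes F: "\<And>i. i \<in> I \<Longrightarrow> F i \<in> L2 M" and u: "upper_riesz_bound M I F B" and B: "B \<ge> 0"
    and h: "h \<in> L2 M" and J: "finite J" "J \<subseteq> I"
  shows "(\<Sum>i\<in>J. (cmod (l2_inner M h (F i)))\<^sup>2) \<le> B * (l2_norm M h)\<^sup>2"
proof -
  define b where "b i = l2_inner M h (F i)" for i
  define s where "s = (\<Sum>i\<in>J. (cmod (b i))\<^sup>2)"
  define g where "g = (\<lambda>x. \<Sum>i\<in>J. b i * F i x)"
  have FJ: "\<And>i. i \<in> J \<Longrightarrow> F i \<in> L2 M" using F J by auto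
  have gL: "g \<in> L2 M" unfolding g_def by (rule L2_lincomb[OF FJ])
  have s0: "s \<ge> 0" by (simp add: s_def sum_nonneg)
  have "l2_inner M h g = (\<Sum>i\<in>J. cnj (b i) * b i)"
    unfolding g_def by (subst l2_inner_sum_right[OF FJ h]) (auto simp: b_def)
  also have "\<dots> = complex_of_real s"
    unfolding s_def mult.commute[of "cnj _"] complex_norm_square[symmetric] of_real_sum ..
  finally have "s = cmod (l2_inner M h g)" using s0 by simp
  also have "\<dots> \<le> l2_norm M h * l2_norm M g" by (rule l2_Cauchy_Schwarz[OF h gL])
  finally have "s\<^sup>2 \<le> (l2_norm M h * l2_norm M g)\<^sup>2" using s0 by (intro power_mono)
  also have "\<dots> \<le> (l2_norm M h)\<^sup>2 * (B * s)"
    using u J unfolding power_mult_distrib g_def s_def upper_riesz_bound_def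
    by (intro mult_left_mono) auto
  finally have *: "s * s \<le> (B * (l2_norm M h)\<^sup>2) * s" by (simp add: power2_eq_square mult_ac)
  have "s \<le> B * (l2_norm M h)\<^sup>2" by (rule mult_self_le_cancel[OF s0 _ *]) (use B in simp)
  then show ?thesis by (simp add: s_def b_def)
qed

lemma upper_riesz_bound_imp_bessel:
  assumes F: "\<And>i. i \<in> I \<Longrightarrow> F i \<in> L2 M" and u: "upper_riesz_bound M I F B" and B: "B \<ge> 0"
    and V: "V \<subseteq> L2 M" "\<And>i. i \<in> I \<Longrightarrow> F i \<in> V"
  shows "bessel_in M V I F"
  unfolding bessel_in_def
proof (intro conjI exI[of _ B] ballI V)
  fix f assume f: "f \<in> V"
  have *: "(\<Sum>i\<in>J. (cmod (l2_inner M f (F i)))\<^sup>2) \<le> B * (l2_norm M f)\<^sup>2" if "finite J" "J \<subseteq> I" for J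
    using f V by (intro upper_riesz_bound_imp_finite_bessel[OF F u B _ that]) auto
  show s: "(\<lambda>i. (cmod (l2_inner M f (F i)))\<^sup>2) summable_on I"
    using * by (intro nonneg_bdd_above_summable_on bdd_aboveI2[where M="B * (l2_norm M f)\<^sup>2"]) auto
  show "(\<Sum>\<^sub>\<infinity>i\<in>I. (cmod (l2_inner M f (F i)))\<^sup>2) \<le> B * (l2_norm M f)\<^sup>2"
    using * by (intro infsum_le_finite_sums s) auto
qed

lemma closed_span_L2: "closed_span M I F \<subseteq> L2 M"
  by (auto simp: closed_span_def l2_closure_def)

lemma lin_span_closed_span:
  assumes "\<And>i. i \<in> I \<Longrightarrow> F i \<in> L2 M"
  shows "lin_span I F \<subseteq> closed_span M I F"
proof
  fix g assume g: "g \<in> lin_span I F"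
  then have "g \<in> L2 M" using lin_span_L2[of I F M g] assms by blast
  moreover have "l2_norm M (\<lambda>x. g x - g x) = 0" by simp
  ultimately show "g \<in> closed_span M I F"
    using g unfolding closed_span_def l2_closure_def by force
qed

text \<open>
  Since the analysis operator is bounded, the lower frame inequality passes from the linear span
  to its closure.
\<close>
lemma frame_sequenceI:
  assumes F: "\<And>i. i \<in> I \<Longrightarrow> F i \<in> L2 M" and u: "upper_riesz_bound M I F B" and B: "B \<ge> 0"
    and A: "A > 0" and lower: "\<And>g. g \<in> lin_span I F \<Longrightarrow>
      \<exists>J. finite J \<and> J \<subseteq> I \<and> A * (l2_norm M g)\<^sup>2 \<le> (\<Sum>i\<in>J. (cmod (l2_inner M g (F i)))\<^sup>2)"
  shows "frame_sequence M I F"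
proof -
  let ?V = "closed_span M I F"
  have sub: "lin_span I F \<subseteq> ?V" by (rule lin_span_closed_span[OF F])
  have bess: "bessel_in M ?V I F"
    by (rule upper_riesz_bound_imp_bessel[OF F u B closed_span_L2]) (auto intro: subsetD[OF sub lin_span_base])
  have "A * (l2_norm M f)\<^sup>2 \<le> (\<Sum>\<^sub>\<infinity>i\<in>I. (cmod (l2_inner M f (F i)))\<^sup>2)" if f: "f \<in> ?V" for f
  proof -
    define S where "S = (\<Sum>\<^sub>\<infinity>i\<in>I. (cmod (l2_inner M f (F i)))\<^sup>2)"
    have S0: "S \<ge> 0" unfolding S_def by (intro infsum_nonneg) auto
    have fL: "f \<in> L2 M" using f closed_span_L2 by blast
    have "sqrt A * l2_norm M f \<le> sqrt S + \<epsilon>" if "\<epsilon> > 0" for \<epsilon>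
    proof -
      define \<eta> where "\<eta> = \<epsilon> / (sqrt A + sqrt B)"
      have AB: "sqrt A + sqrt B > 0" using A B by (simp add: add_pos_nonneg)
      then have "\<eta> > 0" using \<open>\<epsilon> > 0\<close> by (simp add: \<eta>_def)
      then obtain g where g: "g \<in> lin_span I F" "l2_norm M (\<lambda>x. f x - g x) < \<eta>"
        using f by (auto simp: closed_span_def l2_closure_def)
      have gL: "g \<in> L2 M" by (rule lin_span_L2[OF F g(1)])
      obtain J where J: "finite J" "J \<subseteq> I"
        "A * (l2_norm M g)\<^sup>2 \<le> (\<Sum>i\<in>J. (cmod (l2_inner M g (F i)))\<^sup>2)" using lower[OF g(1)] by blast
      have FJ: "F i \<in> L2 M" if "i \<in> J" for i using F J(2) that by auto
      have "sqrt A * l2_norm M g \<le> L2_set (\<lambda>i. cmod (l2_inner M g (F i))) J"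
        using real_sqrt_le_mono[OF J(3)] by (simp add: real_sqrt_mult L2_set_def)
      also have "\<dots> \<le> L2_set (\<lambda>i. cmod (l2_inner M f (F i)) + cmod (l2_inner M (\<lambda>x. f x - g x) (F i))) J"
      proof (rule L2_set_mono)
        fix i assume i: "i \<in> J"
        have "l2_inner M g (F i) = l2_inner M f (F i) - l2_inner M (\<lambda>x. f x - g x) (F i)"
          using fL gL FJ[OF i] by (simp add: l2_inner_diff_left)
        then show "cmod (l2_inner M g (F i)) \<le> cmod (l2_inner M f (F i)) + cmod (l2_inner M (\<lambda>x. f x - g x) (F i))"
          using norm_triangle_ineq4 by simp
      qed simp
      also have "\<dots> \<le> L2_set (\<lambda>i. cmod (l2_inner M f (F i))) J + L2_set (\<lambda>i. cmod (l2_inner M (\<lambda>x. f x - g x) (F i))) J"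
        by (rule L2_set_triangle_ineq)
      also have "\<dots> \<le> sqrt S + sqrt B * l2_norm M (\<lambda>x. f x - g x)"
      proof (rule add_mono)
        have "(\<Sum>i\<in>J. (cmod (l2_inner M f (F i)))\<^sup>2) \<le> S"
          unfolding S_def using bess f J by (intro finite_sum_le_infsum) (auto simp: bessel_in_def)
        then show "L2_set (\<lambda>i. cmod (l2_inner M f (F i))) J \<le> sqrt S" by (simp add: L2_set_def)
        have "(\<Sum>i\<in>J. (cmod (l2_inner M (\<lambda>x. f x - g x) (F i)))\<^sup>2) \<le> B * (l2_norm M (\<lambda>x. f x - g x))\<^sup>2"
          by (rule upper_riesz_bound_imp_finite_bessel[OF F u B L2_diff[OF fL gL] J(1,2)])
        from real_sqrt_le_mono[OF this]
        show "L2_set (\<lambda>i. cmod (l2_inner M (\<lambda>x. f x - g x) (F i))) J \<le> sqrt B * l2_norm M (\<lambda>x. f x - g x)"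
          by (simp add: L2_set_def real_sqrt_mult)
      qed
      finally have 1: "sqrt A * l2_norm M g \<le> sqrt S + sqrt B * l2_norm M (\<lambda>x. f x - g x)" .
      have "sqrt A * l2_norm M f \<le> sqrt A * (l2_norm M g + l2_norm M (\<lambda>x. f x - g x))"
        using l2_triangle_diff[OF fL gL] A by (intro mult_left_mono) auto
      also have "\<dots> \<le> sqrt S + (sqrt A + sqrt B) * l2_norm M (\<lambda>x. f x - g x)"
        using 1 by (simp add: algebra_simps)
      also have "\<dots> \<le> sqrt S + (sqrt A + sqrt B) * \<eta>"
        using g(2) AB by (intro add_left_mono mult_left_mono) auto
      also have "(sqrt A + sqrt B) * \<eta> = \<epsilon>" using AB by (simp add: \<eta>_def)
      finally show ?thesis .
    qed
    then have "sqrt A * l2_norm M f \<le> sqrt S" by (rule field_le_epsilon)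
    then have "(sqrt A * l2_norm M f)\<^sup>2 \<le> (sqrt S)\<^sup>2" using A by (intro power_mono) auto
    then show ?thesis using A S0 by (simp add: power_mult_distrib S_def)
  qed
  then show ?thesis using F A bess by (auto simp: frame_sequence_def frame_for_def)
qed

lemma riesz_imp_frame_sequence:
  assumes "riesz_basic_sequence M I F"
  shows "frame_sequence M I F"
proof -
  obtain A B where AB: "A > 0" "B > 0" and F: "\<And>i. i \<in> I \<Longrightarrow> F i \<in> L2 M" and
    R: "\<And>J a. finite J \<Longrightarrow> J \<subseteq> I \<Longrightarrow> A * (\<Sum>i\<in>J. (cmod (a i))\<^sup>2) \<le> (l2_norm M (\<lambda>x. \<Sum>i\<in>J. a i * F i x))\<^sup>2"
     "\<And>J a. finite J \<Longrightarrow> J \<subseteq> I \<Longrightarrow> (l2_norm M (\<lambda>x. \<Sum>i\<in>J. a i * F i x))\<^sup>2 \<le> B * (\<Sum>i\<in>J. (cmod (a i))\<^sup>2)"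
    using assms unfolding riesz_basic_sequence_def by (elim conjE exE) simp
  show ?thesis
  proof (rule frame_sequenceI[OF F _ less_imp_le[OF AB(2)] AB(1)])
    show "upper_riesz_bound M I F B" using R(2) by (simp add: upper_riesz_bound_def)
    fix g assume "g \<in> lin_span I F"
    then obtain J a where J: "finite J" "J \<subseteq> I" "g = (\<lambda>x. \<Sum>i\<in>J. a i * F i x)"
      by (auto simp: lin_span_def)
    define n where "n = (l2_norm M g)\<^sup>2"
    define s where "s = (\<Sum>i\<in>J. (cmod (l2_inner M g (F i)))\<^sup>2)"
    have s0: "s \<ge> 0" by (simp add: s_def sum_nonneg)
    have "n \<le> L2_set (\<lambda>i. cmod (a i)) J * L2_set (\<lambda>i. cmod (l2_inner M g (F i))) J"
      unfolding n_def J(3) by (rule lincomb_norm_sq_le) (use F J in auto)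
    then have "n\<^sup>2 \<le> (L2_set (\<lambda>i. cmod (a i)) J * L2_set (\<lambda>i. cmod (l2_inner M g (F i))) J)\<^sup>2"
      by (intro power_mono) (auto simp: n_def)
    also have "\<dots> = (\<Sum>i\<in>J. (cmod (a i))\<^sup>2) * s"
      by (simp add: power_mult_distrib sum_eq_L2_set s_def)
    finally have "A * n\<^sup>2 \<le> (A * (\<Sum>i\<in>J. (cmod (a i))\<^sup>2)) * s" using AB(1) by simp
    also have "\<dots> \<le> n * s" using R(1)[OF J(1,2), of a] s0 unfolding n_def J(3) by (intro mult_right_mono)
    finally have *: "(A * n) * n \<le> s * n" by (simp add: power2_eq_square mult_ac)
    have "A * n \<le> s"
      using mult_self_le_cancel[of "A * n" s] mult_left_mono[OF *, of A] AB(1) s0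
      by (simp add: n_def mult_ac)
    then show "\<exists>J. finite J \<and> J \<subseteq> I \<and> A * (l2_norm M g)\<^sup>2 \<le> (\<Sum>i\<in>J. (cmod (l2_inner M g (F i)))\<^sup>2)"
      using J(1,2) unfolding n_def s_def by blast
  qed
qed

lemma riesz_basic_sequenceI:
  assumes "\<And>i. i \<in> I \<Longrightarrow> F i \<in> L2 M" "upper_riesz_bound M I F B" "B > 0" "A > 0"
    "\<And>J a. finite J \<Longrightarrow> J \<subseteq> I \<Longrightarrow> A * (\<Sum>i\<in>J. (cmod (a i))\<^sup>2) \<le> (l2_norm M (\<lambda>x. \<Sum>i\<in>J. a i * F i x))\<^sup>2"
  shows "riesz_basic_sequence M I F"
  using assms unfolding riesz_basic_sequence_def upper_riesz_bound_def by blast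

lemma frame_sequence_upper_riesz_bound:
  assumes "frame_sequence M I F"
  shows "\<exists>B>0. upper_riesz_bound M I F B"
proof (rule bessel_imp_upper_riesz_bound)
  show F: "\<And>i. i \<in> I \<Longrightarrow> F i \<in> L2 M" and "bessel_in M (closed_span M I F) I F"
    using assms by (auto simp: frame_sequence_def frame_for_def)
  show "lin_span I F \<subseteq> closed_span M I F" by (rule lin_span_closed_span[OF F])
qed

lemma frame_sequence_imp_bessel_sequence:
  assumes "frame_sequence M I F"
  shows "bessel_sequence M I F"
proof -
  obtain B where "B > 0" "upper_riesz_bound M I F B"
    using frame_sequence_upper_riesz_bound[OF assms] by blast
  moreover have "\<And>i. i \<in> I \<Longrightarrow> F i \<in> L2 M" using assms by (simp add: frame_sequence_def)
  ultimately show ?thesis unfolding bessel_sequence_def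
    by (intro upper_riesz_bound_imp_bessel[where B=B]) auto
qed

text \<open>
  One step of the frame algorithm, truncated to a finite sum. With frame bounds \<open>A\<close> and \<open>B\<close> and
  \<open>b i = \<langle>g, F i\<rangle> / B\<close>, the squared norm of the remainder is at most \<open>\<parallel>g\<parallel>\<^sup>2\<close> minus \<open>1/B\<close> times the sum of the
  \<open>|\<langle>g, F i\<rangle>|\<^sup>2\<close> over \<open>J\<close>. A suitable finite \<open>J\<close> captures at least \<open>A/2 * \<parallel>g\<parallel>\<^sup>2\<close> of that sum, so the remainder
  shrinks by the fixed factor \<open>sqrt (1 - A / (2 * B))\<close>.
\<close>
lemma frame_sequence_partial_reconstruction:
  assumes "frame_sequence M I F"
  shows "\<exists>\<rho> K. 0 \<le> \<rho> \<and> \<rho> < 1 \<and> 0 \<le> K \<and> (\<forall>g\<in>lin_span I F. \<exists>J b. finite J \<and> J \<subseteq> I \<and>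
     l2_norm M (\<lambda>x. g x - (\<Sum>i\<in>J. b i * F i x)) \<le> \<rho> * l2_norm M g \<and>
     L2_set (\<lambda>i. cmod (b i)) J \<le> K * l2_norm M g)"
proof -
  have F: "\<And>i. i \<in> I \<Longrightarrow> F i \<in> L2 M" using assms by (simp add: frame_sequence_def)
  have sub: "lin_span I F \<subseteq> closed_span M I F" by (rule lin_span_closed_span[OF F])
  obtain A where A: "A > 0" "\<And>f. f \<in> closed_span M I F \<Longrightarrow>
     A * (l2_norm M f)\<^sup>2 \<le> (\<Sum>\<^sub>\<infinity>i\<in>I. (cmod (l2_inner M f (F i)))\<^sup>2)"
    and summ: "\<And>f. f \<in> closed_span M I F \<Longrightarrow> (\<lambda>i. (cmod (l2_inner M f (F i)))\<^sup>2) summable_on I"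
    using assms unfolding frame_sequence_def frame_for_def bessel_in_def by blast
  obtain B where B: "B > 0" "upper_riesz_bound M I F B"
    using frame_sequence_upper_riesz_bound[OF assms] by blast
  define \<rho> where "\<rho> = sqrt (max 0 (1 - A / (2 * B)))"
  define K where "K = 1 / sqrt B"
  have "\<exists>J b. finite J \<and> J \<subseteq> I \<and>
     l2_norm M (\<lambda>x. g x - (\<Sum>i\<in>J. b i * F i x)) \<le> \<rho> * l2_norm M g \<and>
     L2_set (\<lambda>i. cmod (b i)) J \<le> K * l2_norm M g" if g: "g \<in> lin_span I F" for g
  proof -
    have gL: "g \<in> L2 M" by (rule lin_span_L2[OF F g])
    define G where "G = (l2_norm M g)\<^sup>2"
    have "\<exists>J. finite J \<and> J \<subseteq> I \<and> A / 2 * G \<le> (\<Sum>i\<in>J. (cmod (l2_inner M g (F i)))\<^sup>2)"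
    proof (cases "G = 0")
      case False
      then have "A / 2 * G < A * G" using A(1) by (simp add: G_def)
      also have "\<dots> \<le> (\<Sum>\<^sub>\<infinity>i\<in>I. (cmod (l2_inner M g (F i)))\<^sup>2)" using A(2) g sub by (auto simp: G_def)
      finally have lt: "A / 2 * G < (\<Sum>\<^sub>\<infinity>i\<in>I. (cmod (l2_inner M g (F i)))\<^sup>2)" .
      show ?thesis
      proof (rule ccontr)
        assume "\<nexists>J. finite J \<and> J \<subseteq> I \<and> A / 2 * G \<le> (\<Sum>i\<in>J. (cmod (l2_inner M g (F i)))\<^sup>2)"
        then have "(\<Sum>\<^sub>\<infinity>i\<in>I. (cmod (l2_inner M g (F i)))\<^sup>2) \<le> A / 2 * G"
          using g sub by (intro infsum_le_finite_sums summ) (auto simp: not_le less_imp_le)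
        then show False using lt by simp
      qed
    qed (auto intro!: exI[of _ "{}"])
    then obtain J where J: "finite J" "J \<subseteq> I"
      "A / 2 * G \<le> (\<Sum>i\<in>J. (cmod (l2_inner M g (F i)))\<^sup>2)" by blast
    define s where "s = (\<Sum>i\<in>J. (cmod (l2_inner M g (F i)))\<^sup>2)"
    define b where "b i = complex_of_real (1 / B) * l2_inner M g (F i)" for i
    define h where "h = (\<lambda>x. \<Sum>i\<in>J. b i * F i x)"
    have FJ: "F i \<in> L2 M" if "i \<in> J" for i using F J(2) that by auto
    have hL: "h \<in> L2 M" unfolding h_def by (rule L2_lincomb[OF FJ])
    have bs: "(\<Sum>i\<in>J. (cmod (b i))\<^sup>2) = (1 / B)\<^sup>2 * s"
      by (simp add: b_def s_def norm_mult norm_divide power_mult_distrib power_divide sum_distrib_left sum_divide_distrib)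
    have "l2_inner M g h = (\<Sum>i\<in>J. cnj (b i) * l2_inner M g (F i))"
      unfolding h_def by (rule l2_inner_sum_right[OF FJ gL])
    also have "\<dots> = complex_of_real (1 / B * s)"
    proof -
      have "cnj (b i) * l2_inner M g (F i) = complex_of_real (1 / B * (cmod (l2_inner M g (F i)))\<^sup>2)" for i
        using complex_norm_square[of "l2_inner M g (F i)"] by (simp add: b_def mult_ac)
      then show ?thesis by (simp only: s_def of_real_sum sum_distrib_left)
    qed
    finally have Re: "Re (l2_inner M g h) = 1 / B * s" by simp
    have "(l2_norm M h)\<^sup>2 \<le> B * ((1 / B)\<^sup>2 * s)"
      using B(2) J(1,2) unfolding upper_riesz_bound_def h_def bs[symmetric] by blast
    also have "\<dots> = 1 / B * s" using B(1) by (simp add: power2_eq_square)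
    finally have hn: "(l2_norm M h)\<^sup>2 \<le> 1 / B * s" .
    have "(l2_norm M (\<lambda>x. g x - h x))\<^sup>2 \<le> G - 1 / B * s"
      using hn unfolding l2_norm_diff_sq[OF gL hL] Re G_def by simp
    also have "\<dots> \<le> G - 1 / B * (A / 2 * G)"
      using J(3) B(1) unfolding s_def by (intro diff_left_mono mult_left_mono) auto
    also have "\<dots> = (1 - A / (2 * B)) * G" using B(1) by (simp add: field_simps)
    also have "\<dots> \<le> \<rho>\<^sup>2 * G" unfolding \<rho>_def G_def by (intro mult_right_mono) auto
    finally have "(l2_norm M (\<lambda>x. g x - h x))\<^sup>2 \<le> (\<rho> * l2_norm M g)\<^sup>2"
      by (simp add: G_def power_mult_distrib)
    then have 1: "l2_norm M (\<lambda>x. g x - h x) \<le> \<rho> * l2_norm M g"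
      by (rule power2_le_imp_le) (simp add: \<rho>_def)
    have "s \<le> B * G" unfolding s_def G_def
      by (rule upper_riesz_bound_imp_finite_bessel[OF F B(2) less_imp_le[OF B(1)] gL J(1,2)])
    then have "(1 / B)\<^sup>2 * s \<le> (1 / B)\<^sup>2 * (B * G)" by (intro mult_left_mono) auto
    also have "\<dots> = (K * l2_norm M g)\<^sup>2"
      using B(1) by (simp add: K_def G_def power_mult_distrib power_divide power2_eq_square[of B])
    finally have "(L2_set (\<lambda>i. cmod (b i)) J)\<^sup>2 \<le> (K * l2_norm M g)\<^sup>2"
      unfolding sum_eq_L2_set[symmetric] bs .
    then have "L2_set (\<lambda>i. cmod (b i)) J \<le> K * l2_norm M g"
      by (rule power2_le_imp_le) (use B(1) in \<open>simp add: K_def\<close>)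
    then show ?thesis using J(1,2) 1 unfolding h_def by blast
  qed
  moreover have "0 \<le> \<rho>" "\<rho> < 1" "0 \<le> K" using A(1) B(1) by (auto simp: \<rho>_def K_def)
  ultimately show ?thesis by blast
qed

section \<open>Functions without negative frequencies\<close>

lemma fourier_coeff_shift:
  "fourier_coeff (\<lambda>t. exponential k t * f t) n = fourier_coeff f (n - k)"
  unfolding fourier_coeff_def l2_inner_def cnj_exponential
  by (intro Bochner_Integration.integral_cong refl)
     (simp add: mult.commute[of _ "f _"] mult.assoc exponential_mult)

lemma fourier_coeff_diff:
  "f \<in> L2 \<mu>\<^sub>I \<Longrightarrow> g \<in> L2 \<mu>\<^sub>I \<Longrightarrow> fourier_coeff (\<lambda>t. f t - g t) n = fourier_coeff f n - fourier_coeff g n"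
  unfolding fourier_coeff_def by (intro l2_inner_diff_left exponential_L2)

lemma fourier_coeff_sum:
  assumes "\<And>i. i \<in> J \<Longrightarrow> F i \<in> L2 \<mu>\<^sub>I"
  shows "fourier_coeff (\<lambda>t. \<Sum>i\<in>J. a i * F i t) n = (\<Sum>i\<in>J. a i * fourier_coeff (F i) n)"
  unfolding fourier_coeff_def by (intro l2_inner_sum_left exponential_L2 assms)

lemma fourier_coeff_lin_span:
  assumes "p \<in> lin_span A exponential" "n \<notin> A"
  shows "fourier_coeff p n = 0"
proof -
  obtain J a where J: "finite J" "J \<subseteq> A" "p = (\<lambda>x. \<Sum>i\<in>J. a i * exponential i x)"
    using assms(1) by (auto simp: lin_span_def)
  have "fourier_coeff p n = (\<Sum>i\<in>J. a i * (if i = n then 1 else 0))"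
    unfolding J(3) fourier_coeff_sum[OF exponential_L2]
    by (simp add: fourier_coeff_def exponential_orthonormal)
  also have "\<dots> = 0" using J(2) assms(2) by (intro sum.neutral) auto
  finally show ?thesis .
qed

lemma exp_lin_span_L2: "p \<in> lin_span A exponential \<Longrightarrow> p \<in> L2 \<mu>\<^sub>I"
  by (rule lin_span_L2[OF exponential_L2])

lemma fourier_coeff_nonzero_exists:
  assumes "f \<in> L2 \<mu>\<^sub>I" "\<not> (AE x in \<mu>\<^sub>I. f x = 0)"
  shows "\<exists>n. fourier_coeff f n \<noteq> 0"
proof (rule ccontr)
  assume "\<nexists>n. fourier_coeff f n \<noteq> 0"
  then have "((\<lambda>n::int. 0) has_sum (norm_I f)\<^sup>2) UNIV" using Parseval[OF assms(1)] by simp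
  then have "(norm_I f)\<^sup>2 = 0" using has_sum_unique has_sum_0 by (metis (no_types, lifting))
  then show False using l2_norm_eq_0_iff[OF assms(1)] assms(2) by simp
qed

lemma cutoff_L2:
  assumes "f \<in> L2 \<mu>\<^sub>I" "E \<in> sets lebesgue"
  shows "cutoff E f \<in> L2 \<mu>\<^sub>I" "norm_I (cutoff E f) \<le> norm_I f"
proof -
  have [measurable]: "f \<in> borel_measurable \<mu>\<^sub>I" using assms(1) by (simp add: L2_def)
  have "indicator E \<in> borel_measurable (lebesgue :: real measure)"
    using assms(2) by (rule borel_measurable_indicator)
  then have [measurable]: "(indicator E :: real \<Rightarrow> complex) \<in> borel_measurable \<mu>\<^sub>I"
    by (intro measurable_restrict_space1)
  have cm: "cutoff E f \<in> borel_measurable \<mu>\<^sub>I" unfolding cutoff_def by measurable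
  have le: "cmod (cutoff E f x) \<le> cmod (f x)" for x by (simp add: cutoff_def indicator_def)
  show L: "cutoff E f \<in> L2 \<mu>\<^sub>I" by (rule L2_dominated[OF assms(1) cm]) (simp add: le)
  show "norm_I (cutoff E f) \<le> norm_I f" by (rule l2_norm_mono[OF assms(1) L]) (simp add: le)
qed

lemma cutoff_diff: "cutoff E (\<lambda>t. f t - g t) = (\<lambda>t. cutoff E f t - cutoff E g t)"
  by (simp add: cutoff_def left_diff_distrib)

lemma indicator_unit_L2:
  assumes "E \<in> sets lebesgue"
  shows "(indicator E :: real \<Rightarrow> complex) \<in> L2 \<mu>\<^sub>I"
proof -
  have "(\<lambda>t. 1) \<in> L2 \<mu>\<^sub>I" by (rule bounded_L2_unit[where B=1]) auto
  from cutoff_L2(1)[OF this assms] show ?thesis by (simp add: cutoff_def)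
qed

lemma integral_indicator_unit:
  assumes "E \<in> sets lebesgue" "E \<subseteq> {0..1}"
  shows "(LINT x|\<mu>\<^sub>I. indicator E x :: real) = measure lebesgue E"
proof -
  have "(LINT x|\<mu>\<^sub>I. indicator E x :: real) = measure \<mu>\<^sub>I E" using assms by (simp add: Int_absorb2)
  also have "\<dots> = measure lebesgue E" using assms by (subst measure_restrict_space) auto
  finally show ?thesis .
qed

text \<open>
  The orthogonality relations say that \<open>|u|\<^sup>2\<close> has the Fourier coefficients of a constant \<open>D\<close>. Testing
  against bounded trigonometric polynomials that converge to the indicator of \<open>E\<close> shows that \<open>|u|\<^sup>2\<close>
  has integral \<open>D\<close> times the measure of \<open>E\<close> over \<open>E\<close>, where \<open>u\<close> vanishes.
\<close>
lemma constant_modulus_not_vanishing: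
  assumes u: "u \<in> L2 \<mu>\<^sub>I" and orth: "\<And>n. n \<ge> 1 \<Longrightarrow> l2_inner \<mu>\<^sub>I u (\<lambda>t. exponential n t * u t) = 0"
    and E: "E \<in> sets lebesgue" "E \<subseteq> {0..1}" "0 < measure lebesgue E"
    and zero: "norm_I (cutoff E u) = 0"
  shows "norm_I u = 0"
proof -
  define D where "D = (norm_I u)\<^sup>2"
  have ui: "integrable \<mu>\<^sub>I (\<lambda>t. complex_of_real ((cmod (u t))\<^sup>2))"
    using L2_integrable[OF u] by (rule integrable_of_real)
  have um [measurable]: "u \<in> borel_measurable \<mu>\<^sub>I" using u by (simp add: L2_def)
  \<comment> \<open>the squared modulus of \<open>u\<close> has the Fourier coefficients of the constant \<open>D\<close>\<close>
  have ue: "(LINT t|\<mu>\<^sub>I. complex_of_real ((cmod (u t))\<^sup>2) * exponential n t) = (if n = 0 then of_real D else 0)" for n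
  proof -
    have pos: "(LINT t|\<mu>\<^sub>I. complex_of_real ((cmod (u t))\<^sup>2) * exponential (- n) t) = 0" if "n \<ge> 1" for n
    proof -
      have "(LINT t|\<mu>\<^sub>I. complex_of_real ((cmod (u t))\<^sup>2) * exponential (- n) t)
          = l2_inner \<mu>\<^sub>I u (\<lambda>t. exponential n t * u t)"
        unfolding l2_inner_def
        by (intro Bochner_Integration.integral_cong refl)
           (simp only: complex_norm_square complex_cnj_mult cnj_exponential mult_ac)
      then show ?thesis using orth[OF that] by simp
    qed
    consider "n = 0" | "n \<le> -1" | "n \<ge> 1" by linarith
    then show ?thesis
    proof cases
      case 1
      have "(LINT t|\<mu>\<^sub>I. complex_of_real ((cmod (u t))\<^sup>2)) = complex_of_real (LINT t|\<mu>\<^sub>I. (cmod (u t))\<^sup>2)"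
        by (rule integral_complex_of_real)
      then show ?thesis using 1 by (simp add: D_def l2_norm_sq)
    next
      case 2
      then show ?thesis using pos[of "- n"] by simp
    next
      case 3
      have "(LINT t|\<mu>\<^sub>I. complex_of_real ((cmod (u t))\<^sup>2) * exponential n t)
          = cnj (LINT t|\<mu>\<^sub>I. complex_of_real ((cmod (u t))\<^sup>2) * exponential (- n) t)"
        by (subst Bochner_Integration.integral_cnj[symmetric])
           (simp only: complex_cnj_mult complex_cnj_complex_of_real cnj_exponential minus_minus)
      then show ?thesis using pos[OF 3] 3 by simp
    qed
  qed
  have ut: "(LINT t|\<mu>\<^sub>I. complex_of_real ((cmod (u t))\<^sup>2) * p t) = of_real D * (LINT t|\<mu>\<^sub>I. p t)"
    if p: "p \<in> trig_polys" for p
  proof -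
    obtain J a where J: "finite J" "p = (\<lambda>x. \<Sum>i\<in>J. a i * exponential i x)"
      using p by (auto simp: lin_span_def)
    have i1: "integrable \<mu>\<^sub>I (\<lambda>t. complex_of_real ((cmod (u t))\<^sup>2) * exponential n t)" for n
      by (rule Bochner_Integration.integrable_bound[OF ui])
         (auto simp: norm_mult intro!: borel_measurable_times exponential_measurable)
    have i2: "integrable \<mu>\<^sub>I (exponential n)" for n
      by (intro finite_measure.integrable_const_bound[OF finite_measure_unit, where B=1] exponential_measurable) auto
    have "(LINT t|\<mu>\<^sub>I. complex_of_real ((cmod (u t))\<^sup>2) * p t)
        = (LINT t|\<mu>\<^sub>I. (\<Sum>n\<in>J. a n * (complex_of_real ((cmod (u t))\<^sup>2) * exponential n t)))"
      unfolding J(2) by (simp add: sum_distrib_left mult.left_commute)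
    also have "\<dots> = (\<Sum>n\<in>J. a n * (if n = 0 then of_real D else 0))"
      by (subst Bochner_Integration.integral_sum) (auto intro!: integrable_mult_right i1 simp: ue simp del: of_real_power)
    also have "\<dots> = of_real D * (\<Sum>n\<in>J. a n * (LINT t|\<mu>\<^sub>I. exponential n t))"
      unfolding integral_exponential sum_distrib_left by (intro sum.cong) auto
    also have "(\<Sum>n\<in>J. a n * (LINT t|\<mu>\<^sub>I. exponential n t)) = (LINT t|\<mu>\<^sub>I. p t)"
      unfolding J(2) by (subst Bochner_Integration.integral_sum) (auto intro!: integrable_mult_right i2)
    finally show ?thesis .
  qed
  let ?X = "indicator E :: real \<Rightarrow> complex"
  have Xm [measurable]: "?X \<in> borel_measurable \<mu>\<^sub>I" using indicator_unit_L2[OF E(1)] by (simp add: L2_def)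
  have Xb: "cmod (?X x) \<le> 1" for x by (simp add: indicator_def)
  obtain t where t: "\<And>k. t k \<in> trig_polys" "\<And>k x. x \<in> {0..1} \<Longrightarrow> cmod (t k x) \<le> 1 + 1"
     "AE x in \<mu>\<^sub>I. (\<lambda>k. t k x) \<longlonglongrightarrow> ?X x"
    using trig_approx_bounded[OF Xm, of 1] Xb by blast
  have tm [measurable]: "t k \<in> borel_measurable \<mu>\<^sub>I" for k using trig_polys_L2[OF t(1)] by (simp add: L2_def)
  have um2: "(\<lambda>x. complex_of_real ((cmod (u x))\<^sup>2)) \<in> borel_measurable \<mu>\<^sub>I" by measurable
  have "(\<lambda>k. LINT x|\<mu>\<^sub>I. complex_of_real ((cmod (u x))\<^sup>2) * t k x) \<longlonglongrightarrow> (LINT x|\<mu>\<^sub>I. complex_of_real ((cmod (u x))\<^sup>2) * ?X x)"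
  proof (rule integral_dominated_convergence[where w="\<lambda>x. 2 * (cmod (u x))\<^sup>2"])
    show "integrable \<mu>\<^sub>I (\<lambda>x. 2 * (cmod (u x))\<^sup>2)" using L2_integrable[OF u] by simp
    show "AE x in \<mu>\<^sub>I. (\<lambda>k. complex_of_real ((cmod (u x))\<^sup>2) * t k x) \<longlonglongrightarrow> complex_of_real ((cmod (u x))\<^sup>2) * ?X x"
      using t(3) by eventually_elim (intro tendsto_intros)
    show "AE x in \<mu>\<^sub>I. norm (complex_of_real ((cmod (u x))\<^sup>2) * t k x) \<le> 2 * (cmod (u x))\<^sup>2" for k
    proof (intro AE_I2)
      fix x :: real assume "x \<in> space \<mu>\<^sub>I"
      then have "cmod (t k x) \<le> 2" using t(2)[of x k] by simp
      then have "(cmod (u x))\<^sup>2 * cmod (t k x) \<le> (cmod (u x))\<^sup>2 * 2" by (intro mult_left_mono) auto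
      then show "norm (complex_of_real ((cmod (u x))\<^sup>2) * t k x) \<le> 2 * (cmod (u x))\<^sup>2"
        by (simp add: norm_mult norm_power mult.commute)
    qed
  qed (use um2 in \<open>auto intro!: borel_measurable_times\<close>)
  moreover have "(LINT x|\<mu>\<^sub>I. complex_of_real ((cmod (u x))\<^sup>2) * ?X x) = 0"
  proof -
    have "AE x in \<mu>\<^sub>I. cutoff E u x = 0" using zero l2_norm_eq_0_iff[OF cutoff_L2(1)[OF u E(1)]] by simp
    then have "AE x in \<mu>\<^sub>I. complex_of_real ((cmod (u x))\<^sup>2) * ?X x = 0"
      by eventually_elim (auto simp: cutoff_def)
    then show ?thesis by (rule integral_eq_zero_AE)
  qed
  ultimately have "(\<lambda>k. of_real D * (LINT x|\<mu>\<^sub>I. t k x)) \<longlonglongrightarrow> 0"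
    unfolding ut[OF t(1)] by simp
  moreover have "(\<lambda>k. LINT x|\<mu>\<^sub>I. t k x) \<longlonglongrightarrow> (LINT x|\<mu>\<^sub>I. ?X x)"
  proof (rule integral_dominated_convergence[where w="\<lambda>x. 2"])
    show "integrable \<mu>\<^sub>I (\<lambda>x. 2 :: real)" by (rule finite_measure.integrable_const[OF finite_measure_unit])
    show "AE x in \<mu>\<^sub>I. norm (t k x) \<le> 2" for k using t(2)[of _ k] by (intro AE_I2) auto
  qed (use t(3) in auto)
  ultimately have "of_real D * (LINT x|\<mu>\<^sub>I. ?X x) = 0"
    using LIMSEQ_unique tendsto_mult_left by blast
  moreover have "(LINT x|\<mu>\<^sub>I. ?X x) = of_real (measure lebesgue E)"
  proof -
    have "(LINT x|\<mu>\<^sub>I. ?X x) = (LINT x|\<mu>\<^sub>I. complex_of_real (indicator E x))"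
      by (intro Bochner_Integration.integral_cong) (auto simp: indicator_def)
    also have "\<dots> = of_real (LINT x|\<mu>\<^sub>I. indicator E x)" by (rule integral_complex_of_real)
    also have "(LINT x|\<mu>\<^sub>I. indicator E x) = measure lebesgue E" by (rule integral_indicator_unit[OF E(1,2)])
    finally show ?thesis .
  qed
  ultimately have "D = 0" using E(3) by auto
  then show ?thesis by (simp add: D_def)
qed

text \<open>
  Beurling's argument. If \<open>f\<close> is not zero, shifting the frequencies produces a function \<open>g\<close> that still
  vanishes on \<open>E\<close> and whose lowest frequency is \<open>0\<close>. Let \<open>w\<close> be the element of smallest norm in
  the closure of \<open>g\<close> plus the span of the \<open>e\<^sub>n g\<close> for \<open>n \<ge> 1\<close>. Minimality makes \<open>w\<close> orthogonal to all \<open>e\<^sub>n w\<close>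
  with \<open>n \<ge> 1\<close>, so \<open>|w|\<close> is constant; as \<open>w\<close> vanishes on \<open>E\<close> too, it is zero. But its coefficient at
  frequency \<open>0\<close> is that of \<open>g\<close>.
\<close>
theorem analytic_vanishing:
  assumes f: "f \<in> L2 \<mu>\<^sub>I" and neg: "\<And>n. n < 0 \<Longrightarrow> fourier_coeff f n = 0"
    and E: "E \<in> sets lebesgue" "E \<subseteq> {0..1}" "0 < measure lebesgue E"
    and zero: "norm_I (cutoff E f) = 0"
  shows "norm_I f = 0"
proof (rule ccontr)
  assume "norm_I f \<noteq> 0"
  then obtain n where "fourier_coeff f n \<noteq> 0"
    using fourier_coeff_nonzero_exists[OF f] l2_norm_eq_0_iff[OF f] by blast
  with neg have "\<exists>m. fourier_coeff f (int m) \<noteq> 0" by (metis nonneg_int_cases not_le)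
  \<comment> \<open>the lowest frequency of \<open>f\<close>; dividing it out moves it to \<open>0\<close>\<close>
  define m where "m = (LEAST m. fourier_coeff f (int m) \<noteq> 0)"
  have m: "fourier_coeff f (int m) \<noteq> 0" unfolding m_def by (rule LeastI_ex) fact
  have below: "fourier_coeff f n = 0" if "n < int m" for n
  proof (cases "n < 0")
    case False
    then have "fourier_coeff f (int (nat n)) = 0"
      using that not_less_Least[of "nat n" "\<lambda>m. fourier_coeff f (int m) \<noteq> 0"] by (auto simp: m_def)
    then show ?thesis using False by simp
  qed (rule neg)
  define g where "g t = exponential (- int m) t * f t" for t
  have emult: "(\<lambda>t. exponential n t * h t) \<in> L2 \<mu>\<^sub>I" if "h \<in> L2 \<mu>\<^sub>I" for n h
    by (rule L2_mult_bounded[OF that exponential_measurable, of _ 1]) simp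
  have gL: "g \<in> L2 \<mu>\<^sub>I" unfolding g_def by (rule emult[OF f])
  have gc: "fourier_coeff g n = fourier_coeff f (n + int m)" for n
    unfolding g_def fourier_coeff_shift by simp
  define c where "c = fourier_coeff g 0"
  have c0: "c \<noteq> 0" using m by (simp add: c_def gc)
  let ?P = "lin_span {1..} exponential"
  define v where "v p t = (1 - p t) * g t" for p :: "real \<Rightarrow> complex" and t
  have PL: "p \<in> borel_measurable \<mu>\<^sub>I" if "p \<in> ?P" for p
    using exp_lin_span_L2[OF that] by (simp add: L2_def)
  have pg: "(\<lambda>t. p t * g t) \<in> L2 \<mu>\<^sub>I \<and> fourier_coeff (\<lambda>t. p t * g t) 0 = 0" if p: "p \<in> ?P" for p
  proof -
    obtain J a where J: "finite J" "J \<subseteq> {1..}" "p = (\<lambda>x. \<Sum>i\<in>J. a i * exponential i x)"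
      using p by (auto simp: lin_span_def)
    have eq: "(\<lambda>t. p t * g t) = (\<lambda>t. \<Sum>i\<in>J. a i * (exponential i t * g t))"
      unfolding J(3) by (simp add: sum_distrib_right mult.assoc)
    have "fourier_coeff (\<lambda>t. p t * g t) 0 = (\<Sum>i\<in>J. a i * fourier_coeff g (0 - i))"
      unfolding eq fourier_coeff_sum[OF emult[OF gL]] fourier_coeff_shift ..
    also have "\<dots> = 0" using J(2) below by (intro sum.neutral) (auto simp: gc)
    finally have "fourier_coeff (\<lambda>t. p t * g t) 0 = 0" .
    moreover have "(\<lambda>t. p t * g t) \<in> L2 \<mu>\<^sub>I" unfolding eq by (intro L2_lincomb emult gL)
    ultimately show ?thesis by blast
  qed
  have vL: "v p \<in> L2 \<mu>\<^sub>I" and vc: "fourier_coeff (v p) 0 = c" if "p \<in> ?P" for p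
    using pg[OF that] L2_diff[OF gL, of "\<lambda>t. p t * g t"] fourier_coeff_diff[OF gL, of "\<lambda>t. p t * g t" 0]
    by (simp_all add: v_def[abs_def] left_diff_distrib c_def)
  \<comment> \<open>\<open>v p\<close> runs through \<open>g\<close> plus the span of its shifts; \<open>d\<close> is the distance from \<open>0\<close> to this set\<close>
  define d where "d = Inf ((\<lambda>p. norm_I (v p)) ` ?P)"
  have dle: "d \<le> norm_I (v p)" if "p \<in> ?P" for p
    unfolding d_def using that by (intro cINF_lower bdd_belowI2[where m=0]) auto
  have d0: "0 \<le> d" unfolding d_def by (rule cINF_greatest) (use lin_span_zero in auto)
  have "\<exists>p\<in>?P. norm_I (v p) < sqrt (d\<^sup>2 + (1/4) ^ k)" for k
  proof -
    have "sqrt (d\<^sup>2) < sqrt (d\<^sup>2 + (1/4) ^ k)" by (intro real_sqrt_less_mono) simp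
    then have "d < sqrt (d\<^sup>2 + (1/4) ^ k)" using d0 by simp
    then show ?thesis unfolding d_def using lin_span_zero
      by (subst (asm) cINF_less_iff) (auto intro!: bdd_belowI2[where m=0])
  qed
  then obtain p where p: "\<And>k. p k \<in> ?P" "\<And>k. norm_I (v (p k)) < sqrt (d\<^sup>2 + (1/4) ^ k)" by metis
  define u where "u k = v (p k)" for k
  have uL: "u k \<in> L2 \<mu>\<^sub>I" for k unfolding u_def by (rule vL[OF p(1)])
  have un: "(norm_I (u k))\<^sup>2 \<le> d\<^sup>2 + (1/4) ^ k" for k
  proof -
    have "(norm_I (u k))\<^sup>2 \<le> (sqrt (d\<^sup>2 + (1/4) ^ k))\<^sup>2"
      unfolding u_def using p(2)[of k] by (intro power_mono) auto
    also have "\<dots> = d\<^sup>2 + (1/4) ^ k" by simp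
    finally show ?thesis .
  qed
  have step: "norm_I (\<lambda>x. u (Suc k) x - u k x) \<le> 2 * (1/2) ^ k" for k
  proof (rule power2_le_imp_le)
    \<comment> \<open>parallelogram law; the midpoint is admissible, so its norm is at least \<open>d\<close>\<close>
    let ?q = "\<lambda>t. (1/2) * (p (Suc k) t + p k t)"
    have q: "?q \<in> ?P" by (intro lin_span_cmult lin_span_add p)
    have "(\<lambda>x. u (Suc k) x + u k x) = (\<lambda>x. 2 * v ?q x)"
      by (rule ext) (simp add: u_def v_def algebra_simps)
    then have "2 * d \<le> norm_I (\<lambda>x. u (Suc k) x + u k x)"
      using dle[OF q] by (simp add: l2_norm_cmult)
    then have "(2 * d)\<^sup>2 \<le> (norm_I (\<lambda>x. u (Suc k) x + u k x))\<^sup>2" using d0 by (intro power_mono) auto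
    then have "(norm_I (\<lambda>x. u (Suc k) x - u k x))\<^sup>2
        \<le> 2 * (norm_I (u (Suc k)))\<^sup>2 + 2 * (norm_I (u k))\<^sup>2 - 4 * d\<^sup>2"
      unfolding l2_norm_add_sq[OF uL uL] l2_norm_diff_sq[OF uL uL] by (simp add: power_mult_distrib)
    also have "\<dots> \<le> 2 * (1/4) ^ Suc k + 2 * (1/4) ^ k"
      using un[of "Suc k"] un[of k] by linarith
    also have "\<dots> \<le> 4 * (1/4) ^ k" by simp
    also have "\<dots> = (2 * (1/2) ^ k)\<^sup>2"
      by (simp add: power_mult_distrib power2_eq_square flip: power_mult_distrib)
    finally show "(norm_I (\<lambda>x. u (Suc k) x - u k x))\<^sup>2 \<le> (2 * (1/2) ^ k)\<^sup>2" .
  qed simp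
  have "summable (\<lambda>k. norm_I (\<lambda>x. u (Suc k) x - u k x))"
  proof (rule summable_comparison_test')
    show "summable (\<lambda>j. 2 * (1/2::real) ^ j)" by (intro summable_mult summable_geometric) simp
  qed (use step in simp)
  from L2_limit_of_fast_Cauchy[OF uL this] obtain w where w: "w \<in> L2 \<mu>\<^sub>I"
    "(\<lambda>k. norm_I (\<lambda>x. w x - u k x)) \<longlonglongrightarrow> 0" by auto
  have wd: "(norm_I w)\<^sup>2 \<le> d\<^sup>2"
  proof (rule LIMSEQ_le)
    show "(\<lambda>k. (norm_I (u k))\<^sup>2) \<longlonglongrightarrow> (norm_I w)\<^sup>2"
      by (intro tendsto_power l2_norm_limit w uL)
    have "(\<lambda>k. d\<^sup>2 + (1/4::real) ^ k) \<longlonglongrightarrow> d\<^sup>2 + 0"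
      by (intro tendsto_add tendsto_const LIMSEQ_power_zero) simp
    then show "(\<lambda>k. d\<^sup>2 + (1/4::real) ^ k) \<longlonglongrightarrow> d\<^sup>2" by simp
  qed (use un in auto)
  have "(\<lambda>k. fourier_coeff (u k) 0) \<longlonglongrightarrow> fourier_coeff w 0"
    unfolding fourier_coeff_def by (rule l2_inner_limit[OF w(1) exponential_L2 uL w(2)])
  then have wc: "fourier_coeff w 0 = c"
    unfolding u_def vc[OF p(1)] by (simp add: LIMSEQ_const_iff)
  have "norm_I w = 0"
  proof (rule constant_modulus_not_vanishing[OF w(1) _ E])
    fix n :: int assume n: "n \<ge> 1"
    define r where "r = l2_inner \<mu>\<^sub>I w (\<lambda>t. exponential n t * w t)"
    have ineq: "d\<^sup>2 \<le> (norm_I w)\<^sup>2 + 2 * Re (cnj z * r) + (cmod z)\<^sup>2 * (norm_I w)\<^sup>2" for z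
    proof -
      let ?T = "\<lambda>h t. h t + z * (exponential n t * h t)"
      have TL: "?T h \<in> L2 \<mu>\<^sub>I" if "h \<in> L2 \<mu>\<^sub>I" for h
        by (intro L2_add L2_cmult emult that)
      have "d \<le> norm_I (?T (u k))" for k
      proof -
        let ?q = "\<lambda>t. p k t - z * exponential n t + z * (exponential n t * p k t)"
        obtain J a where J: "finite J" "J \<subseteq> {1..}" "p k = (\<lambda>x. \<Sum>i\<in>J. a i * exponential i x)"
          using p(1)[of k] by (auto simp: lin_span_def)
        have "(\<lambda>t. exponential n t * p k t) = (\<lambda>t. \<Sum>i\<in>J. a i * exponential (n + i) t)"
          unfolding J(3) by (simp add: sum_distrib_left mult.left_commute flip: exponential_mult)
        also have "\<dots> \<in> ?P"
          using J(2) n by (intro lin_span_sum lin_span_cmult lin_span_base) auto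
        finally have "?q \<in> ?P" using n
          by (intro lin_span_add lin_span_diff lin_span_cmult lin_span_base p) auto
        moreover have "?T (u k) = v ?q" by (rule ext) (simp add: u_def v_def algebra_simps)
        ultimately show ?thesis using dle by simp
      qed
      moreover have "(\<lambda>k. norm_I (?T (u k))) \<longlonglongrightarrow> norm_I (?T w)"
      proof (rule l2_norm_limit[OF TL[OF w(1)] TL[OF uL]], rule Lim_null_comparison)
        show "\<forall>\<^sub>F k in sequentially. norm (norm_I (\<lambda>x. ?T w x - ?T (u k) x))
            \<le> (1 + cmod z) * norm_I (\<lambda>x. w x - u k x)"
        proof (intro always_eventually allI)
          fix k
          have "(\<lambda>x. ?T w x - ?T (u k) x) = (\<lambda>x. (1 + z * exponential n x) * (w x - u k x))"
            by (simp add: algebra_simps)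
          moreover have "norm_I (\<lambda>x. (1 + z * exponential n x) * (w x - u k x))
              \<le> (1 + cmod z) * norm_I (\<lambda>x. w x - u k x)"
          proof (rule l2_norm_mult_bounded[OF L2_diff[OF w(1) uL]])
            show "(\<lambda>x. 1 + z * exponential n x) \<in> borel_measurable \<mu>\<^sub>I"
              by (intro borel_measurable_add borel_measurable_times exponential_measurable) auto
            show "cmod (1 + z * exponential n x) \<le> 1 + cmod z" for x
              by (rule order_trans[OF norm_triangle_ineq]) (simp add: norm_mult)
          qed simp
          ultimately show "norm (norm_I (\<lambda>x. ?T w x - ?T (u k) x))
            \<le> (1 + cmod z) * norm_I (\<lambda>x. w x - u k x)" by simp
        qed
        show "(\<lambda>k. (1 + cmod z) * norm_I (\<lambda>x. w x - u k x)) \<longlonglongrightarrow> 0"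
          by (rule tendsto_mult_right_zero[OF w(2)])
      qed
      ultimately have "d \<le> norm_I (?T w)" by (intro LIMSEQ_le_const) auto
      then have "d\<^sup>2 \<le> (norm_I (?T w))\<^sup>2" using d0 by (intro power_mono)
      also have "\<dots> = (norm_I w)\<^sup>2 + 2 * Re (l2_inner \<mu>\<^sub>I w (\<lambda>t. z * (exponential n t * w t)))
          + (norm_I (\<lambda>t. z * (exponential n t * w t)))\<^sup>2"
        by (rule l2_norm_add_sq[OF w(1) L2_cmult[OF emult[OF w(1)]]])
      also have "l2_inner \<mu>\<^sub>I w (\<lambda>t. z * (exponential n t * w t)) = cnj z * r"
        unfolding r_def by (subst (1 2) l2_inner_commute) (simp add: l2_inner_cmult_left)
      also have "norm_I (\<lambda>t. z * (exponential n t * w t)) = cmod z * norm_I w"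
        unfolding l2_norm_cmult by (simp add: l2_norm_def norm_mult)
      finally show ?thesis by (simp add: power_mult_distrib)
    qed
    \<comment> \<open>perturbing \<open>w\<close> by a small multiple of \<open>- r\<close> times \<open>e\<^sub>n w\<close> would lower the norm unless \<open>r = 0\<close>\<close>
    define s where "s = 1 / (d\<^sup>2 + 1)"
    have s: "s > 0" "s * d\<^sup>2 < 1" by (auto simp: s_def add_nonneg_pos)
    have re: "Re (cnj (- of_real s * r) * r) = - (s * (cmod r)\<^sup>2)"
      unfolding cmod_power2 by (simp add: power2_eq_square algebra_simps)
    have nm: "(cmod (- of_real s * r))\<^sup>2 = s\<^sup>2 * (cmod r)\<^sup>2" by (simp add: norm_mult power_mult_distrib)
    have "s\<^sup>2 * (cmod r)\<^sup>2 * (norm_I w)\<^sup>2 \<le> s\<^sup>2 * (cmod r)\<^sup>2 * d\<^sup>2"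
      using wd by (intro mult_left_mono) auto
    then have "d\<^sup>2 \<le> d\<^sup>2 - 2 * (s * (cmod r)\<^sup>2) + s\<^sup>2 * (cmod r)\<^sup>2 * d\<^sup>2"
      using ineq[of "- of_real s * r", unfolded re nm] wd by linarith
    then have "s * (cmod r)\<^sup>2 * (2 - s * d\<^sup>2) \<le> 0"
      by (simp add: algebra_simps power2_eq_square)
    then have "(cmod r)\<^sup>2 \<le> 0" using s by (simp add: mult_le_0_iff zero_less_mult_iff) 
    then have "r = 0" by simp
    then show "l2_inner \<mu>\<^sub>I w (\<lambda>t. exponential n t * w t) = 0" by (simp add: r_def)
  next
    have zf: "AE x in \<mu>\<^sub>I. cutoff E f x = 0" using zero l2_norm_eq_0_iff[OF cutoff_L2(1)[OF f E(1)]] by simp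
    have zu: "norm_I (cutoff E (u k)) = 0" for k
    proof -
      have "AE x in \<mu>\<^sub>I. cutoff E (u k) x = 0"
        using zf by eventually_elim (auto simp: cutoff_def u_def v_def g_def)
      then show ?thesis using l2_norm_eq_0_iff[OF cutoff_L2(1)[OF uL E(1)]] by simp
    qed
    have "norm_I (cutoff E w) \<le> norm_I (\<lambda>x. w x - u k x)" for k
      using l2_triangle_diff[OF cutoff_L2(1)[OF w(1) E(1)] cutoff_L2(1)[OF uL E(1)], of k]
        cutoff_L2(2)[OF L2_diff[OF w(1) uL] E(1), of k] zu[of k]
      by (simp add: cutoff_diff)
    then have "norm_I (cutoff E w) \<le> 0" using w(2) by (intro LIMSEQ_le_const) auto
    then show "norm_I (cutoff E w) = 0" using l2_norm_nonneg[of "\<mu>\<^sub>I" "cutoff E w"] by linarith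
  qed
  moreover have "cmod c \<le> norm_I w * norm_I (exponential 0)"
    unfolding wc[symmetric] fourier_coeff_def by (rule l2_Cauchy_Schwarz[OF w(1) exponential_L2])
  ultimately show False using c0 by simp
qed

section \<open>A generator whose integer translates model the truncated exponentials\<close>

text \<open>
  Placing the \<open>k\<close>-th Fourier coefficient on \<open>[k, k+1)\<close> embeds \<open>L\<^sup>2([0,1])\<close> isometrically into \<open>L\<^sup>2(\<real>)\<close> and
  turns multiplication by \<open>exponential k\<close> into translation by \<open>k\<close>.
\<close>
definition coeff_step :: "(real \<Rightarrow> complex) \<Rightarrow> real \<Rightarrow> complex" where
  "coeff_step g t = fourier_coeff g \<lfloor>t\<rfloor>"

lemma coeff_step_isometry:
  assumes g: "g \<in> L2 \<mu>\<^sub>I"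
  shows "coeff_step g \<in> L2 lebesgue" "norm_R (coeff_step g) = norm_I g"
proof -
  have "coeff_step g \<in> borel_measurable borel"
    unfolding coeff_step_def[abs_def] by (rule measurable_compose[OF measurable_real_floor]) simp
  then have m [measurable]: "coeff_step g \<in> borel_measurable lebesgue" by (intro measurable_completion) simp
  have ne: "AE x in \<mu>\<^sub>I. x \<noteq> 1"
    using AE_not_in[of "{1::real}" lebesgue] by (auto simp: AE_restrict_space_iff elim: eventually_mono)
  have "(\<integral>\<^sup>+t. ennreal ((cmod (coeff_step g t))\<^sup>2) \<partial>lebesgue)
      = (\<Sum>n. \<integral>\<^sup>+x. ennreal ((cmod (coeff_step g (of_int (int_decode n) + x)))\<^sup>2) \<partial>\<mu>\<^sub>I)"
    by (rule nn_integral_split_unit) simp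
  also have "\<dots> = (\<Sum>n. \<integral>\<^sup>+x. ennreal ((cmod (fourier_coeff g (int_decode n)))\<^sup>2) \<partial>\<mu>\<^sub>I)"
  proof (intro suminf_cong nn_integral_cong_AE)
    fix n
    show "AE x in \<mu>\<^sub>I. ennreal ((cmod (coeff_step g (of_int (int_decode n) + x)))\<^sup>2)
        = ennreal ((cmod (fourier_coeff g (int_decode n)))\<^sup>2)"
    proof (use ne AE_space in eventually_elim)
      fix x assume "x \<noteq> 1" "x \<in> space \<mu>\<^sub>I"
      then have "\<lfloor>of_int (int_decode n) + x\<rfloor> = int_decode n" by (simp add: floor_eq_iff)
      then show "ennreal ((cmod (coeff_step g (of_int (int_decode n) + x)))\<^sup>2)
        = ennreal ((cmod (fourier_coeff g (int_decode n)))\<^sup>2)" by (simp add: coeff_step_def)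
    qed
  qed
  also have "\<dots> = ennreal ((norm_I g)\<^sup>2)"
    using Parseval_ennreal[OF g bij_int_decode] by (simp add: emeasure_restrict_space)
  finally have *: "coeff_step g \<in> L2 lebesgue \<and> (norm_R (coeff_step g))\<^sup>2 = (norm_I g)\<^sup>2"
    by (intro L2_nn_integralI m) auto
  then show "coeff_step g \<in> L2 lebesgue" by simp
  show "norm_R (coeff_step g) = norm_I g"
    using * by (metis l2_norm_nonneg power2_eq_iff_nonneg)
qed

lemma coeff_step_lincomb:
  "(\<And>i. i \<in> J \<Longrightarrow> F i \<in> L2 \<mu>\<^sub>I) \<Longrightarrow>
   coeff_step (\<lambda>t. \<Sum>i\<in>J. a i * F i t) = (\<lambda>t. \<Sum>i\<in>J. a i * coeff_step (F i) t)"
  by (rule ext) (simp add: coeff_step_def fourier_coeff_sum)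

text \<open>
  Polarization of the isometry.
\<close>
lemma coeff_step_inner:
  assumes g: "g \<in> L2 \<mu>\<^sub>I" and h: "h \<in> L2 \<mu>\<^sub>I"
  shows "l2_inner lebesgue (coeff_step g) (coeff_step h) = l2_inner \<mu>\<^sub>I g h"
proof -
  have Re: "Re (l2_inner lebesgue (coeff_step g) (coeff_step h)) = Re (l2_inner \<mu>\<^sub>I g h)"
    if h: "h \<in> L2 \<mu>\<^sub>I" for h
  proof -
    have "coeff_step (\<lambda>t. g t + h t) = (\<lambda>t. coeff_step g t + coeff_step h t)"
      using g h by (intro ext) (simp add: coeff_step_def fourier_coeff_def l2_inner_add_left exponential_L2)
    then show ?thesis
      using coeff_step_isometry(2)[OF L2_add[OF g h]] l2_norm_add_sq[OF g h]
        l2_norm_add_sq[OF coeff_step_isometry(1)[OF g] coeff_step_isometry(1)[OF h]]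
        coeff_step_isometry(2)[OF g] coeff_step_isometry(2)[OF h] by simp
  qed
  have "coeff_step (\<lambda>t. \<i> * h t) = (\<lambda>t. \<i> * coeff_step h t)"
    by (intro ext) (simp add: coeff_step_def fourier_coeff_def l2_inner_cmult_left)
  moreover have "l2_inner M f (\<lambda>t. \<i> * k t) = - \<i> * l2_inner M f k" for M :: "real measure" and f k
    by (subst (1 2) l2_inner_commute) (simp add: l2_inner_cmult_left)
  ultimately have "Im (l2_inner lebesgue (coeff_step g) (coeff_step h)) = Im (l2_inner \<mu>\<^sub>I g h)"
    using Re[OF L2_cmult[OF h, of \<i>]] by simp
  then show ?thesis using Re[OF h] by (simp add: complex_eq_iff)
qed

definition cutoff_generator :: "real set \<Rightarrow> real \<Rightarrow> complex" where
  "cutoff_generator E = coeff_step (indicator E)"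

lemma cutoff_generator_translate:
  "translation (of_int k) (cutoff_generator E) = coeff_step (cutoff E (exponential k))"
proof
  fix t :: real
  have "\<lfloor>t - of_int k\<rfloor> = \<lfloor>t\<rfloor> - k" by simp
  then show "translation (of_int k) (cutoff_generator E) t = coeff_step (cutoff E (exponential k)) t"
    by (simp add: translation_def cutoff_generator_def coeff_step_def cutoff_def[abs_def] fourier_coeff_shift)
qed

lemma cutoff_lincomb:
  "cutoff E (\<lambda>t. \<Sum>i\<in>J. a i * F i t) = (\<lambda>t. \<Sum>i\<in>J. a i * cutoff E (F i) t)"
  by (simp add: cutoff_def sum_distrib_right mult.assoc)

context
  fixes E :: "real set" and h :: "'i \<Rightarrow> int"
  assumes E: "E \<in> sets lebesgue"
begin

lemma cutoff_exp_L2: "cutoff E (exponential k) \<in> L2 \<mu>\<^sub>I"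
  by (rule cutoff_L2(1)[OF exponential_L2 E])

lemma generator_translate_L2: "translation (of_int k) (cutoff_generator E) \<in> L2 lebesgue"
  unfolding cutoff_generator_translate by (rule coeff_step_isometry(1)[OF cutoff_exp_L2])

lemma generator_lincomb:
  "(\<lambda>t. \<Sum>i\<in>J. a i * translation (of_int (h i)) (cutoff_generator E) t)
    = coeff_step (cutoff E (\<lambda>t. \<Sum>i\<in>J. a i * exponential (h i) t))"
  unfolding cutoff_generator_translate cutoff_lincomb
  by (rule coeff_step_lincomb[symmetric]) (rule cutoff_exp_L2)

lemma generator_lincomb_norm:
  "norm_R (\<lambda>t. \<Sum>i\<in>J. a i * translation (of_int (h i)) (cutoff_generator E) t)
    = norm_I (cutoff E (\<lambda>t. \<Sum>i\<in>J. a i * exponential (h i) t))"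
  unfolding generator_lincomb
  by (rule coeff_step_isometry(2)) (intro cutoff_L2(1) L2_lincomb exponential_L2 E)

lemma exponential_sum_reindex:
  assumes "inj_on h J"
  shows "(\<lambda>t. \<Sum>i\<in>J. a i * exponential (h i) t)
    = (\<lambda>t. \<Sum>n\<in>h ` J. a (the_inv_into J h n) * exponential n t)"
  using assms by (simp add: sum.reindex the_inv_into_f_f)

lemma exponential_sum_norm_inj:
  assumes "finite J" "inj_on h J"
  shows "(norm_I (\<lambda>t. \<Sum>i\<in>J. a i * exponential (h i) t))\<^sup>2 = (\<Sum>i\<in>J. (cmod (a i))\<^sup>2)"
  unfolding exponential_sum_reindex[OF assms(2)] exponential_sum_norm[OF finite_imageI[OF assms(1)]]
  using assms(2) by (simp add: sum.reindex the_inv_into_f_f)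

lemma generator_upper_riesz_bound:
  assumes "inj_on h I"
  shows "upper_riesz_bound lebesgue I (\<lambda>i. translation (of_int (h i)) (cutoff_generator E)) 1"
  unfolding upper_riesz_bound_def
proof (intro allI impI)
  fix J a assume J: "finite J" "J \<subseteq> I"
  have "inj_on h J" using assms J(2) by (rule inj_on_subset)
  note norm = exponential_sum_norm_inj[OF J(1) this, of a]
  have "norm_I (cutoff E (\<lambda>t. \<Sum>i\<in>J. a i * exponential (h i) t))
      \<le> norm_I (\<lambda>t. \<Sum>i\<in>J. a i * exponential (h i) t)"
    by (intro cutoff_L2(2) L2_lincomb exponential_L2 E)
  from power_mono[OF this l2_norm_nonneg, of 2]
  show "(norm_R (\<lambda>t. \<Sum>i\<in>J. a i * translation (of_int (h i)) (cutoff_generator E) t))\<^sup>2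
      \<le> 1 * (\<Sum>i\<in>J. (cmod (a i))\<^sup>2)"
    unfolding generator_lincomb_norm norm mult_1 .
qed

text \<open>
  An element of the span corresponds to some \<open>q\<close> supported in \<open>E\<close>. Its inner products with the
  translates are those of \<open>q\<close> with the cut off exponentials, hence the Fourier coefficients of \<open>q\<close>,
  and Parseval's identity shows that the frame is tight. The lower bound \<open>1/2\<close> instead of \<open>1\<close> leaves
  room for finite sums.
\<close>
lemma generator_frame_sequence:
  assumes h: "bij h"
  shows "frame_sequence lebesgue UNIV (\<lambda>i. translation (of_int (h i)) (cutoff_generator E))"
proof (rule frame_sequenceI[OF _ generator_upper_riesz_bound])
  show "inj h" using h by (rule bij_is_inj)
  show "(0::real) \<le> 1" "0 < (1/2 :: real)" by simp_all
  show "translation (of_int (h i)) (cutoff_generator E) \<in> L2 lebesgue" for i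
    by (rule generator_translate_L2)
  fix g assume "g \<in> lin_span UNIV (\<lambda>i. translation (of_int (h i)) (cutoff_generator E))"
  then obtain J a where g: "g = (\<lambda>t. \<Sum>i\<in>J. a i * translation (of_int (h i)) (cutoff_generator E) t)"
    by (auto simp: lin_span_def)
  define q where "q = cutoff E (\<lambda>t. \<Sum>i\<in>J. a i * exponential (h i) t)"
  have qL: "q \<in> L2 \<mu>\<^sub>I" unfolding q_def by (intro cutoff_L2(1) L2_lincomb exponential_L2 E)
  have gq: "g = coeff_step q" unfolding g q_def by (rule generator_lincomb)
  have q0: "q t = 0" if "t \<notin> E" for t using that by (simp add: q_def cutoff_def)
  have inner: "l2_inner lebesgue g (translation (of_int (h i)) (cutoff_generator E)) = fourier_coeff q (h i)" for i
  proof -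
    have "l2_inner \<mu>\<^sub>I q (cutoff E (exponential (h i))) = fourier_coeff q (h i)"
      unfolding fourier_coeff_def l2_inner_def cutoff_def
      by (intro Bochner_Integration.integral_cong refl) (auto simp: q0 indicator_def)
    then show ?thesis unfolding gq cutoff_generator_translate coeff_step_inner[OF qL cutoff_exp_L2] .
  qed
  have gn: "norm_R g = norm_I q" unfolding gq by (rule coeff_step_isometry(2)[OF qL])
  show "\<exists>J. finite J \<and> J \<subseteq> UNIV \<and> 1/2 * (norm_R g)\<^sup>2
      \<le> (\<Sum>i\<in>J. (cmod (l2_inner lebesgue g (translation (of_int (h i)) (cutoff_generator E))))\<^sup>2)"
  proof (cases "norm_I q = 0")
    case False
    then have "1/2 * (norm_I q)\<^sup>2 < (norm_I q)\<^sup>2" by simp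
    moreover have "((\<lambda>i. (cmod (fourier_coeff q (h i)))\<^sup>2) has_sum (norm_I q)\<^sup>2) UNIV"
      using Parseval[OF qL] has_sum_reindex_bij_betw[OF h, where f="\<lambda>n. (cmod (fourier_coeff q n))\<^sup>2"
          and S="(norm_I q)\<^sup>2"] by blast
    ultimately have "\<forall>\<^sub>F J in finite_subsets_at_top UNIV. 1/2 * (norm_I q)\<^sup>2 < (\<Sum>i\<in>J. (cmod (fourier_coeff q (h i)))\<^sup>2)"
      unfolding has_sum_def by (intro order_tendstoD)
    then show ?thesis unfolding eventually_finite_subsets_at_top inner gn by (meson less_imp_le order_refl)
  qed (auto simp: gn intro!: exI[of _ "{}"])
qed

lemma riesz_generator_imp_lower_bound:
  assumes "riesz_basic_sequence lebesgue A (\<lambda>i. translation (of_int (h i)) (cutoff_generator E))" "inj_on h A"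
  shows "\<exists>c>0. \<forall>p\<in>lin_span (h ` A) exponential. c * norm_I p \<le> norm_I (cutoff E p)"
proof -
  obtain C where C: "C > 0" "\<And>J a. finite J \<Longrightarrow> J \<subseteq> A \<Longrightarrow> C * (\<Sum>i\<in>J. (cmod (a i))\<^sup>2)
      \<le> (norm_R (\<lambda>t. \<Sum>i\<in>J. a i * translation (of_int (h i)) (cutoff_generator E) t))\<^sup>2"
    using assms(1) unfolding riesz_basic_sequence_def by (elim conjE exE) simp
  have "sqrt C * norm_I p \<le> norm_I (cutoff E p)" if p: "p \<in> lin_span (h ` A) exponential" for p
  proof -
    obtain K b where K: "finite K" "K \<subseteq> h ` A" "p = (\<lambda>x. \<Sum>n\<in>K. b n * exponential n x)"
      using p by (auto simp: lin_span_def)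
    obtain J where J: "J \<subseteq> A" "finite J" "K = h ` J" using finite_subset_image[OF K(1,2)] by blast
    have inj: "inj_on h J" using assms(2) J(1) by (rule inj_on_subset)
    have peq: "p = (\<lambda>t. \<Sum>i\<in>J. b (h i) * exponential (h i) t)"
      unfolding K(3) J(3) using inj by (simp add: sum.reindex)
    have "C * (norm_I p)\<^sup>2 \<le> (norm_I (cutoff E p))\<^sup>2"
      using C(2)[OF J(2,1), of "\<lambda>i. b (h i)"] 
      unfolding generator_lincomb_norm peq exponential_sum_norm_inj[OF J(2) inj] .
    from real_sqrt_le_mono[OF this] show ?thesis by (simp add: real_sqrt_mult)
  qed
  then show ?thesis using C(1) by (intro exI[of _ "sqrt C"]) auto
qed

end

lemma lower_bound_imp_iso_onto_range:
  assumes E: "E \<in> sets lebesgue" and c: "c > 0"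
    "\<And>p. p \<in> lin_span A exponential \<Longrightarrow> c * norm_I p \<le> norm_I (cutoff E p)"
  shows "iso_onto_range \<mu>\<^sub>I (exp_space A) (cutoff E)"
proof -
  have "norm_I (cutoff E f) \<le> 1 * norm_I f \<and> c * norm_I f \<le> norm_I (cutoff E f)"
    if f: "f \<in> exp_space A" for f
  proof
  have fL: "f \<in> L2 \<mu>\<^sub>I" using f closed_span_L2 unfolding exp_space_def by blast
  show "norm_I (cutoff E f) \<le> 1 * norm_I f" using cutoff_L2(2)[OF fL E] by simp
  show "c * norm_I f \<le> norm_I (cutoff E f)"
  proof (rule field_le_epsilon)
    fix e :: real assume "e > 0"
    define d where "d = e / (c + 1)"
    have "d > 0" using \<open>e > 0\<close> c(1) by (simp add: d_def)
    then obtain g where g: "g \<in> lin_span A exponential" "norm_I (\<lambda>x. f x - g x) < d"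
      using f by (auto simp: exp_space_def closed_span_def l2_closure_def)
    have gL: "g \<in> L2 \<mu>\<^sub>I" by (rule exp_lin_span_L2[OF g(1)])
    have "c * norm_I f \<le> c * (norm_I g + norm_I (\<lambda>x. f x - g x))"
      using l2_triangle_diff[OF fL gL] c(1) by (intro mult_left_mono) auto
    also have "\<dots> \<le> norm_I (cutoff E g) + c * norm_I (\<lambda>x. f x - g x)"
      using c(2)[OF g(1)] by (simp add: distrib_left)
    also have "norm_I (cutoff E g) \<le> norm_I (cutoff E f) + norm_I (\<lambda>x. f x - g x)"
      using l2_triangle_diff[OF cutoff_L2(1)[OF gL E] cutoff_L2(1)[OF fL E]] cutoff_L2(2)[OF L2_diff[OF gL fL] E]
      by (simp add: cutoff_diff l2_norm_minus_commute[of _ g])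
    finally have "c * norm_I f \<le> norm_I (cutoff E f) + (c + 1) * norm_I (\<lambda>x. f x - g x)"
      by (simp add: distrib_right)
    also have "(c + 1) * norm_I (\<lambda>x. f x - g x) \<le> (c + 1) * d"
      using g(2) c(1) by (intro mult_left_mono) auto
    also have "(c + 1) * d = e" using c(1) by (simp add: d_def)
    finally show "c * norm_I f \<le> norm_I (cutoff E f) + e" by simp
  qed
  qed
  then show ?thesis using c(1) unfolding iso_onto_range_def by blast
qed

text \<open>
  Complex conjugation reflects the frequencies, which reduces the negative half-line to the
  nonnegative one.
\<close>
lemma one_sided_vanishing:
  assumes A: "A \<subseteq> {0..} \<or> A \<subseteq> {..<0}" and f: "f \<in> L2 \<mu>\<^sub>I"
    and coeff: "\<And>n. n \<notin> A \<Longrightarrow> fourier_coeff f n = 0"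
    and E: "E \<in> sets lebesgue" "E \<subseteq> {0..1}" "0 < measure lebesgue E"
    and zero: "norm_I (cutoff E f) = 0"
  shows "norm_I f = 0"
  using A
proof
  assume "A \<subseteq> {0..}"
  then show ?thesis by (intro analytic_vanishing[OF f _ E zero] coeff) auto
next
  assume *: "A \<subseteq> {..<0}"
  have "fourier_coeff (\<lambda>t. cnj (f t)) n = cnj (fourier_coeff f (- n))" for n
    unfolding fourier_coeff_def l2_inner_def
    by (subst Bochner_Integration.integral_cnj[symmetric]) (simp add: cnj_exponential)
  then have "fourier_coeff (\<lambda>t. cnj (f t)) n = 0" if "n < 0" for n
    using coeff[of "- n"] * that by force
  moreover have "norm_I (cutoff E (\<lambda>t. cnj (f t))) = 0"
    using zero by (simp add: l2_norm_def cutoff_def norm_mult)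
  ultimately have "norm_I (\<lambda>t. cnj (f t)) = 0"
    by (intro analytic_vanishing[OF L2_cnj[OF f] _ E])
  then show ?thesis by (simp add: l2_norm_def)
qed

text \<open>
  Iterating the partial reconstruction of the cut off \<open>p\<close> produces trigonometric polynomials \<open>s k\<close> with
  frequencies in \<open>A\<close> that agree with \<open>p\<close> on \<open>E\<close> in the limit, and whose norms are at most \<open>C\<close> times the norm
  of \<open>p\<close> on \<open>E\<close>. Their limit \<open>w\<close> coincides with \<open>p\<close> on \<open>E\<close>, hence everywhere because all frequencies lie
  on one side, and it inherits the norm bound.
\<close>
lemma frame_generator_imp_lower_bound:
  assumes fr: "frame_sequence lebesgue A (\<lambda>n. translation (of_int n) (cutoff_generator E))"
    and A: "A \<subseteq> {0..} \<or> A \<subseteq> {..<0}"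
    and E: "E \<in> sets lebesgue" "E \<subseteq> {0..1}" "0 < measure lebesgue E"
  shows "\<exists>c>0. \<forall>p\<in>lin_span A exponential. c * norm_I p \<le> norm_I (cutoff E p)"
proof -
  let ?S = "lin_span A exponential"
  let ?F = "\<lambda>n. translation (of_int n) (cutoff_generator E)"
  obtain \<rho> K where \<rho>: "0 \<le> \<rho>" "\<rho> < 1" "0 \<le> K" and rec: "\<And>g. g \<in> lin_span A ?F \<Longrightarrow> \<exists>J b. finite J \<and> J \<subseteq> A \<and>
     norm_R (\<lambda>x. g x - (\<Sum>i\<in>J. b i * ?F i x)) \<le> \<rho> * norm_R g \<and>
     L2_set (\<lambda>i. cmod (b i)) J \<le> K * norm_R g"
    using frame_sequence_partial_reconstruction[OF fr] by blast
  have "\<forall>p\<in>?S. \<exists>q. q \<in> ?S \<and> norm_I (cutoff E (\<lambda>t. p t - q t)) \<le> \<rho> * norm_I (cutoff E p) \<and>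
      norm_I q \<le> K * norm_I (cutoff E p)"
  proof
    fix p assume p: "p \<in> ?S"
    obtain I a where I: "finite I" "I \<subseteq> A" "p = (\<lambda>t. \<Sum>n\<in>I. a n * exponential n t)"
      using p by (auto simp: lin_span_def)
    define g where "g = (\<lambda>t. \<Sum>n\<in>I. a n * ?F n t)"
    have gS: "g \<in> lin_span A ?F" using I(1,2) by (auto simp: g_def lin_span_def)
    have gp: "g = coeff_step (cutoff E p)" unfolding g_def I(3)
      by (rule generator_lincomb[OF E(1), where h="\<lambda>n. n"])
    obtain J b where J: "finite J" "J \<subseteq> A"
     "norm_R (\<lambda>x. g x - (\<Sum>i\<in>J. b i * ?F i x)) \<le> \<rho> * norm_R g"
     "L2_set (\<lambda>i. cmod (b i)) J \<le> K * norm_R g" using rec[OF gS] by blast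
    define q where "q = (\<lambda>t. \<Sum>n\<in>J. b n * exponential n t)"
    have qS: "q \<in> ?S" using J(1,2) by (auto simp: q_def lin_span_def)
    have L: "p \<in> L2 \<mu>\<^sub>I" "q \<in> L2 \<mu>\<^sub>I" using p qS by (auto intro: exp_lin_span_L2)
    have gn: "norm_R g = norm_I (cutoff E p)"
      unfolding gp by (rule coeff_step_isometry(2)[OF cutoff_L2(1)[OF L(1) E(1)]])
    have gq: "(\<lambda>t. \<Sum>i\<in>J. b i * ?F i t) = coeff_step (cutoff E q)" unfolding q_def
      by (rule generator_lincomb[OF E(1), where h="\<lambda>n. n"])
    have "(\<lambda>x. g x - (\<Sum>i\<in>J. b i * ?F i x)) = coeff_step (cutoff E (\<lambda>t. p t - q t))"
      unfolding gp gq cutoff_diff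
      using cutoff_L2(1)[OF L(1) E(1)] cutoff_L2(1)[OF L(2) E(1)]
      by (intro ext) (simp add: fun_cong[OF gq] coeff_step_def fourier_coeff_diff)
    then have red: "norm_I (cutoff E (\<lambda>t. p t - q t)) \<le> \<rho> * norm_I (cutoff E p)"
      using J(3) coeff_step_isometry(2)[OF cutoff_L2(1)[OF L2_diff[OF L] E(1)]] gn by simp
    have "(norm_I q)\<^sup>2 = (L2_set (\<lambda>i. cmod (b i)) J)\<^sup>2"
      unfolding q_def exponential_sum_norm[OF J(1)] sum_eq_L2_set ..
    then have qn: "norm_I q = L2_set (\<lambda>i. cmod (b i)) J" by simp
    show "\<exists>q. q \<in> ?S \<and> norm_I (cutoff E (\<lambda>t. p t - q t)) \<le> \<rho> * norm_I (cutoff E p) \<and>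
      norm_I q \<le> K * norm_I (cutoff E p)"
      using qS red J(4) unfolding gn qn[symmetric] by (intro exI[of _ q] conjI)
  qed
  from bchoice[OF this] obtain Q where "\<forall>p\<in>?S. Q p \<in> ?S \<and>
      norm_I (cutoff E (\<lambda>t. p t - Q p t)) \<le> \<rho> * norm_I (cutoff E p) \<and>
      norm_I (Q p) \<le> K * norm_I (cutoff E p)" ..
  then have Q: "\<And>p. p \<in> ?S \<Longrightarrow> Q p \<in> ?S"
    "\<And>p. p \<in> ?S \<Longrightarrow> norm_I (cutoff E (\<lambda>t. p t - Q p t)) \<le> \<rho> * norm_I (cutoff E p)"
    "\<And>p. p \<in> ?S \<Longrightarrow> norm_I (Q p) \<le> K * norm_I (cutoff E p)" by simp_all
  define C where "C = K / (1 - \<rho>)"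
  have C0: "C \<ge> 0" using \<rho> by (simp add: C_def)
  have bound: "norm_I p \<le> C * norm_I (cutoff E p)" if p: "p \<in> ?S" for p
  proof -
    define N where "N = norm_I (cutoff E p)"
    define r where "r k = ((\<lambda>r t. r t - Q r t) ^^ k) p" for k
    have r0: "r 0 = p" and rS: "r (Suc k) = (\<lambda>t. r k t - Q (r k) t)" for k by (simp_all add: r_def)
    have rin: "r k \<in> ?S" for k by (induction k) (auto simp: r0 rS p intro: lin_span_diff Q)
    have rL: "r k \<in> L2 \<mu>\<^sub>I" for k by (rule exp_lin_span_L2[OF rin])
    have pL: "p \<in> L2 \<mu>\<^sub>I" by (rule exp_lin_span_L2[OF p])
    have rn: "norm_I (cutoff E (r k)) \<le> \<rho> ^ k * N" for k
    proof (induction k)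
      case (Suc k)
      have "norm_I (cutoff E (r (Suc k))) \<le> \<rho> * norm_I (cutoff E (r k))"
        unfolding rS by (rule Q(2)[OF rin])
      also have "\<dots> \<le> \<rho> * (\<rho> ^ k * N)" using Suc \<rho> by (intro mult_left_mono) auto
      finally show ?case by (simp add: mult.assoc)
    qed (simp add: r0 N_def)
    have Qn: "norm_I (Q (r k)) \<le> K * (\<rho> ^ k * N)" for k
      using Q(3)[OF rin[of k]] rn[of k] \<rho>(3) by (meson mult_left_mono order_trans)
    define s where "s k = (\<lambda>t. p t - r k t)" for k
    have sS: "s k \<in> ?S" for k unfolding s_def by (intro lin_span_diff p rin)
    have sL: "s k \<in> L2 \<mu>\<^sub>I" for k by (rule exp_lin_span_L2[OF sS])
    have sdiff: "(\<lambda>t. s (Suc k) t - s k t) = Q (r k)" for k by (simp add: s_def rS fun_eq_iff)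
    have geo: "summable (\<lambda>k. \<rho> ^ k)" using \<rho> by (intro summable_geometric) auto
    have "summable (\<lambda>k. norm_I (\<lambda>t. s (Suc k) t - s k t))"
    proof (rule summable_comparison_test')
      show "summable (\<lambda>k. K * (\<rho> ^ k * N))" by (intro summable_mult summable_mult2 geo)
    qed (use Qn sdiff in simp)
    from L2_limit_of_fast_Cauchy[OF sL this] obtain w where w: "w \<in> L2 \<mu>\<^sub>I"
      "(\<lambda>k. norm_I (\<lambda>x. w x - s k x)) \<longlonglongrightarrow> 0" by auto
    have sn: "norm_I (s k) \<le> C * N" for k
    proof -
      have "norm_I (s k) \<le> (\<Sum>j<k. K * (\<rho> ^ j * N))"
      proof (induction k)
        case 0
        have "s 0 = (\<lambda>t. 0)" by (simp add: s_def r0)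
        then show ?case by simp
      next
        case (Suc k)
        then show ?case
          using l2_triangle_diff[OF sL[of "Suc k"] sL[of k]] Qn[of k] unfolding sdiff by simp
      qed
      also have "\<dots> = K * N * (\<Sum>j<k. \<rho> ^ j)" by (simp add: sum_distrib_left mult_ac)
      also have "\<dots> \<le> K * N * (\<Sum>j. \<rho> ^ j)"
        using \<rho> by (intro mult_left_mono sum_le_suminf geo) (auto simp: N_def)
      also have "\<dots> = C * N" using \<rho> by (simp add: C_def suminf_geometric)
      finally show ?thesis .
    qed
    have "(\<lambda>k. norm_I (s k)) \<longlonglongrightarrow> norm_I w" by (rule l2_norm_limit[OF w(1) sL w(2)])
    then have wn: "norm_I w \<le> C * N" by (rule LIMSEQ_le_const2) (use sn in auto)
    have wc: "fourier_coeff w n = 0" if "n \<notin> A" for n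
    proof -
      have "(\<lambda>k. fourier_coeff (s k) n) \<longlonglongrightarrow> fourier_coeff w n"
        unfolding fourier_coeff_def by (rule l2_inner_limit[OF w(1) exponential_L2 sL w(2)])
      then show ?thesis using fourier_coeff_lin_span[OF sS that] by (simp add: LIMSEQ_const_iff)
    qed
    have "norm_I (cutoff E (\<lambda>t. p t - w t)) \<le> \<rho> ^ k * N + norm_I (\<lambda>x. w x - s k x)" for k
    proof -
      have "cutoff E (\<lambda>t. p t - w t) = (\<lambda>t. cutoff E (r k) t + cutoff E (\<lambda>t. s k t - w t) t)"
        by (rule ext) (simp add: cutoff_def s_def algebra_simps)
      then have "norm_I (cutoff E (\<lambda>t. p t - w t)) \<le> norm_I (cutoff E (r k)) + norm_I (cutoff E (\<lambda>t. s k t - w t))"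
        using l2_triangle[OF cutoff_L2(1)[OF rL E(1)] cutoff_L2(1)[OF L2_diff[OF sL w(1)] E(1)]] by simp
      then show ?thesis
        using rn[of k] cutoff_L2(2)[OF L2_diff[OF sL w(1)] E(1), of k] by (simp add: l2_norm_minus_commute[of _ "s k"])
    qed
    moreover have "(\<lambda>k. \<rho> ^ k * N + norm_I (\<lambda>x. w x - s k x)) \<longlonglongrightarrow> 0 * N + 0"
      using \<rho> by (intro tendsto_add tendsto_mult tendsto_const w(2) LIMSEQ_power_zero) auto
    ultimately have "norm_I (cutoff E (\<lambda>t. p t - w t)) \<le> 0" by (intro LIMSEQ_le_const) auto
    then have z: "norm_I (cutoff E (\<lambda>t. p t - w t)) = 0" by (simp add: order_antisym)
    have "fourier_coeff (\<lambda>t. p t - w t) n = 0" if "n \<notin> A" for n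
      using fourier_coeff_diff[OF pL w(1)] wc[OF that] fourier_coeff_lin_span[OF p that] by simp
    then have "norm_I (\<lambda>t. p t - w t) = 0"
      by (rule one_sided_vanishing[OF A L2_diff[OF pL w(1)] _ E z])
    then show ?thesis using l2_triangle_diff[OF pL w(1)] wn unfolding N_def by simp
  qed
  have "1 / (C + 1) * norm_I p \<le> norm_I (cutoff E p)" if "p \<in> ?S" for p
  proof -
    have "norm_I p \<le> (C + 1) * norm_I (cutoff E p)"
      using bound[OF that] by (simp add: distrib_right add_increasing2)
    then show ?thesis using C0 by (simp add: field_simps)
  qed
  then show ?thesis using C0 by (intro exI[of _ "1 / (C + 1)"]) auto
qed

lemma cutoff_generator_nonzero:
  assumes E: "E \<in> sets lebesgue" "E \<subseteq> {0..1}" "0 < measure lebesgue E"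
  shows "cutoff_generator E \<in> L2 lebesgue" "\<not> (AE t in lebesgue. cutoff_generator E t = 0)"
proof -
  have L: "(indicator E :: real \<Rightarrow> complex) \<in> L2 \<mu>\<^sub>I" by (rule indicator_unit_L2[OF E(1)])
  show gL: "cutoff_generator E \<in> L2 lebesgue" unfolding cutoff_generator_def by (rule coeff_step_isometry(1)[OF L])
  have "(norm_I (indicator E))\<^sup>2 = (LINT x|\<mu>\<^sub>I. indicator E x)"
    unfolding l2_norm_sq by (intro Bochner_Integration.integral_cong) (auto simp: indicator_def)
  also have "\<dots> = measure lebesgue E" by (rule integral_indicator_unit[OF E(1,2)])
  finally have "norm_R (cutoff_generator E) \<noteq> 0"
    unfolding cutoff_generator_def coeff_step_isometry(2)[OF L] using E(3) by auto
  then show "\<not> (AE t in lebesgue. cutoff_generator E t = 0)" using l2_norm_eq_0_iff[OF gL] by simp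
qed

theorem frame_translates_imp_cutoffs:
  assumes P4: frame_translates_finite_union_riesz
  shows cutoffs_partition_into_isomorphisms
  unfolding cutoffs_partition_into_isomorphisms_def
proof (intro allI impI)
  fix E :: "real set" assume E: "E \<in> sets lebesgue" "E \<subseteq> {0..1}" "0 < measure lebesgue E"
  have "finite_union_of (\<lambda>A. riesz_basic_sequence lebesgue A
      (\<lambda>n. translation (of_int (int_decode n)) (cutoff_generator E))) UNIV"
    by (rule P4[unfolded frame_translates_finite_union_riesz_def, rule_format,
          OF cutoff_generator_nonzero[OF E] generator_frame_sequence[OF E(1) bij_int_decode]])
  then obtain P where P: "finite P" "partition_on UNIV P" "\<And>A. A \<in> P \<Longrightarrow>
     riesz_basic_sequence lebesgue A (\<lambda>n. translation (of_int (int_decode n)) (cutoff_generator E))"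
    unfolding finite_union_of_def by blast
  have "partition_on (int_decode ` UNIV) ((`) int_decode ` P - {{}})"
    using P(2) by (rule partition_on_inj_image) (rule inj_int_decode)
  then have "partition_on UNIV ((`) int_decode ` P - {{}})" by (simp only: surj_int_decode)
  moreover have "iso_onto_range \<mu>\<^sub>I (exp_space (int_decode ` A)) (cutoff E)" if "A \<in> P" for A
    using riesz_generator_imp_lower_bound[OF E(1) P(3)[OF that]] lower_bound_imp_iso_onto_range[OF E(1)]
      inj_int_decode by blast
  ultimately show "\<exists>P. finite P \<and> partition_on (UNIV :: int set) P \<and>
      (\<forall>A\<in>P. iso_onto_range \<mu>\<^sub>I (exp_space A) (cutoff E))"
    using P(1) by (intro exI[of _ "(`) int_decode ` P - {{}}"]) auto
qed

text \<open>
  Applying the hypothesis to all integers at once would be useless: by \<open>generator_frame_sequence\<close>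
  the one-element partition already consists of a frame sequence. Half-lines do better.
\<close>
theorem bessel_finite_union_frame_imp_cutoffs:
  assumes P5: bessel_integer_translates_finite_union_frame
  shows cutoffs_partition_into_isomorphisms
  unfolding cutoffs_partition_into_isomorphisms_def
proof (intro allI impI)
  fix E :: "real set" assume E: "E \<in> sets lebesgue" "E \<subseteq> {0..1}" "0 < measure lebesgue E"
  have half: "\<exists>P. finite P \<and> partition_on I P \<and> (\<forall>A\<in>P. iso_onto_range \<mu>\<^sub>I (exp_space A) (cutoff E))"
    if I: "I \<subseteq> {0..} \<or> I \<subseteq> {..<0}" for I
  proof -
    have "upper_riesz_bound lebesgue I (\<lambda>n. translation (of_int n) (cutoff_generator E)) 1"
      using generator_upper_riesz_bound[OF E(1), where h="\<lambda>n. n"] by simp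
    then have "bessel_sequence lebesgue I (\<lambda>n. translation (of_int n) (cutoff_generator E))"
      unfolding bessel_sequence_def
      by (rule upper_riesz_bound_imp_bessel[rotated]) (auto intro: generator_translate_L2[OF E(1)])
    then obtain P where P: "finite P" "partition_on I P" "\<And>A. A \<in> P \<Longrightarrow>
        frame_sequence lebesgue A (\<lambda>n. translation (of_int n) (cutoff_generator E))"
      using P5 cutoff_generator_nonzero[OF E]
      unfolding bessel_integer_translates_finite_union_frame_def finite_union_of_def by meson
    have "iso_onto_range \<mu>\<^sub>I (exp_space A) (cutoff E)" if "A \<in> P" for A
    proof -
      have "A \<subseteq> {0..} \<or> A \<subseteq> {..<0}" using I partition_onD1[OF P(2)] that by blast
      from frame_generator_imp_lower_bound[OF P(3)[OF that] this E] show ?thesis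
        using lower_bound_imp_iso_onto_range[OF E(1)] by blast
    qed
    then show ?thesis using P(1,2) by blast
  qed
  obtain P1 P2 where P: "finite P1" "partition_on {0..} P1" "\<And>A. A \<in> P1 \<Longrightarrow> iso_onto_range \<mu>\<^sub>I (exp_space A) (cutoff E)"
    "finite P2" "partition_on {..<0} P2" "\<And>A. A \<in> P2 \<Longrightarrow> iso_onto_range \<mu>\<^sub>I (exp_space A) (cutoff E)"
    using half[of "{0..}"] half[of "{..<0}"] by blast
  have "partition_on (UNIV :: int set) (P1 \<union> P2)"
  proof -
    have U: "\<Union>P1 = {0::int..}" "\<Union>P2 = {..<0::int}"
      using partition_onD1[OF P(2)] partition_onD1[OF P(5)] by auto
    have "A \<inter> B = {}" if "A \<in> P1" "B \<in> P2" for A B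
    proof -
      have "A \<subseteq> {0..}" "B \<subseteq> {..<0}" using U that by auto
      then show ?thesis by fastforce
    qed
    then have "p \<inter> q = {}" if "p \<in> P1 \<union> P2" "q \<in> P1 \<union> P2" "p \<noteq> q" for p q
      using that partition_onD2[OF P(2)] partition_onD2[OF P(5)] by (metis Un_iff Int_commute disjointD)
    moreover have "\<Union>(P1 \<union> P2) = UNIV" unfolding Union_Un_distrib U by auto
    moreover have "{} \<notin> P1 \<union> P2" using partition_onD3[OF P(2)] partition_onD3[OF P(5)] by simp
    ultimately show ?thesis unfolding partition_on_def disjoint_def by simp
  qed
  then show "\<exists>P. finite P \<and> partition_on (UNIV :: int set) P \<and>
      (\<forall>A\<in>P. iso_onto_range \<mu>\<^sub>I (exp_space A) (cutoff E))"
    using P by (intro exI[of _ "P1 \<union> P2"]) auto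
qed

section \<open>From truncated exponentials to translates\<close>

text \<open>
  The modulus of \<open>cis (2 * pi * \<xi> * (s + x)) - cis (2 * pi * \<xi> * s)\<close> is independent of \<open>s\<close> and tends to \<open>0\<close>
  with \<open>x\<close>, for every \<open>\<xi>\<close>.
\<close>
lemma translates_equicontinuous:
  assumes \<phi>: "\<phi> \<in> L2 lebesgue" and F: "fourier_transform_L2 \<phi> \<psi>" and "0 < \<epsilon>"
  shows "\<exists>\<delta>>0. \<forall>x s. \<bar>x\<bar> \<le> \<delta> \<longrightarrow>
    norm_R (\<lambda>t. translation (s + x) \<phi> t - translation s \<phi> t) < \<epsilon>"
proof -
  have \<psi>: "\<psi> \<in> L2 lebesgue" using F by (simp add: fourier_transform_L2_def)
  have [measurable]: "\<psi> \<in> borel_measurable lebesgue" using \<psi> by (simp add: L2_def)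
  define D where "D x = norm_R (\<lambda>\<xi>. (cis (2 * pi * \<xi> * x) - 1) * \<psi> \<xi>)" for x
  have D: "norm_R (\<lambda>t. translation (s + x) \<phi> t - translation s \<phi> t) = D x" for s x
  proof -
    define a :: "nat \<Rightarrow> complex" where "a n = (if n = 0 then 1 else -1)" for n
    define \<nu> where "\<nu> n = (if n = 0 then s + x else s)" for n :: nat
    have "norm_R (\<lambda>t. translation (s + x) \<phi> t - translation s \<phi> t)
        = norm_R (\<lambda>t. \<Sum>n\<in>{0, 1}. a n * translation (\<nu> n) \<phi> t)"
      by (simp add: a_def \<nu>_def)
    also have "\<dots> = norm_R (\<lambda>\<xi>. exp_sum {0, 1} a \<nu> \<xi> * \<psi> \<xi>)"
      by (rule translates_norm[OF \<phi> F]) simp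
    also have "(\<lambda>\<xi>. exp_sum {0, 1} a \<nu> \<xi> * \<psi> \<xi>)
        = (\<lambda>\<xi>. cis (2 * pi * \<xi> * s) * ((cis (2 * pi * \<xi> * x) - 1) * \<psi> \<xi>))"
      by (rule ext) (simp add: a_def \<nu>_def distrib_left cis_mult[symmetric] algebra_simps)
    also have "norm_R \<dots> = D x" by (simp add: D_def l2_norm_def norm_mult)
    finally show ?thesis .
  qed
  have lim: "(\<lambda>n. D (X n)) \<longlonglongrightarrow> 0" if X: "X \<longlonglongrightarrow> 0" for X
  proof -
    have m: "(\<lambda>\<xi>. cis (2 * pi * \<xi> * x)) \<in> borel_measurable lebesgue" for x
      by (intro continuous_lebesgue_measurable continuous_intros)
    show ?thesis unfolding D_def
    proof (rule l2_norm_dominated_convergence[OF L2_cmult[OF \<psi>, of 2]])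
      show "AE \<xi> in lebesgue. (\<lambda>n. (cis (2 * pi * \<xi> * X n) - 1) * \<psi> \<xi>) \<longlonglongrightarrow> 0"
      proof (intro AE_I2)
        fix \<xi>
        have "(\<lambda>n. 2 * pi * \<xi> * X n) \<longlonglongrightarrow> 2 * pi * \<xi> * 0" using X by (intro tendsto_intros)
        then have "(\<lambda>n. (cis (2 * pi * \<xi> * X n) - 1) * \<psi> \<xi>) \<longlonglongrightarrow> (cis (2 * pi * \<xi> * 0) - 1) * \<psi> \<xi>"
          by (rule tendsto_mult[OF tendsto_diff[OF tendsto_cis tendsto_const] tendsto_const])
        then show "(\<lambda>n. (cis (2 * pi * \<xi> * X n) - 1) * \<psi> \<xi>) \<longlonglongrightarrow> 0" by simp
      qed
      show "(\<lambda>\<xi>. (cis (2 * pi * \<xi> * X n) - 1) * \<psi> \<xi>) \<in> borel_measurable lebesgue" for n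
        using m[of "X n", measurable] by measurable
      show "AE \<xi> in lebesgue. cmod ((cis (2 * pi * \<xi> * X n) - 1) * \<psi> \<xi>) \<le> cmod (2 * \<psi> \<xi>)" for n
      proof (intro AE_I2)
        fix \<xi>
        have "cmod (cis (2 * pi * \<xi> * X n) - 1) \<le> 2"
          by (rule order_trans[OF norm_triangle_ineq4]) simp
        then show "cmod ((cis (2 * pi * \<xi> * X n) - 1) * \<psi> \<xi>) \<le> cmod (2 * \<psi> \<xi>)"
          by (simp add: norm_mult mult_right_mono)
      qed
    qed
  qed
  have "\<exists>\<delta>>0. \<forall>x. \<bar>x\<bar> \<le> \<delta> \<longrightarrow> D x < \<epsilon>"
  proof (rule ccontr)
    assume "\<not> ?thesis"
    then have "\<forall>n. \<exists>x. \<bar>x\<bar> \<le> inverse (real (Suc n)) \<and> \<epsilon> \<le> D x" by (metis inverse_positive_iff_positive not_le of_nat_0_less_iff zero_less_Suc)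
    then obtain X where X: "\<And>n. \<bar>X n\<bar> \<le> inverse (real (Suc n))" "\<And>n. \<epsilon> \<le> D (X n)" by metis
    have "X \<longlonglongrightarrow> 0"
      by (rule Lim_null_comparison[OF _ LIMSEQ_inverse_real_of_nat]) (use X(1) in auto)
    from lim[OF this] have "\<epsilon> \<le> 0" by (rule LIMSEQ_le_const) (use X(2) in auto)
    then show False using \<open>0 < \<epsilon>\<close> by simp
  qed
  then show ?thesis unfolding D by blast
qed

text \<open>
  Translates by parameters close to \<open>s\<close> are almost parallel to the translate by \<open>s\<close>, so each of them
  contributes at least a fixed amount to the Bessel sum of that translate.
\<close>
lemma bessel_translates_locally_bounded:
  assumes \<phi>: "\<phi> \<in> L2 lebesgue" "norm_R \<phi> \<noteq> 0"
    and b: "bessel_sequence lebesgue \<Lambda> (\<lambda>n. translation (\<nu> n) \<phi>)"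
  shows "\<exists>\<delta>>0. \<exists>K. \<forall>s G. finite G \<longrightarrow> G \<subseteq> {n \<in> \<Lambda>. \<bar>\<nu> n - s\<bar> \<le> \<delta>} \<longrightarrow> card G \<le> K"
proof -
  obtain \<psi> where F: "fourier_transform_L2 \<phi> \<psi>" using fourier_transform_L2_exists[OF \<phi>(1)] by blast
  define N where "N = norm_R \<phi>"
  have N: "N > 0" using \<phi>(2) by (simp add: N_def less_le)
  obtain \<delta> where \<delta>: "\<delta> > 0" "\<And>x s. \<bar>x\<bar> \<le> \<delta> \<Longrightarrow>
    norm_R (\<lambda>t. translation (s + x) \<phi> t - translation s \<phi> t) < N"
    using translates_equicontinuous[OF \<phi>(1) F N] by blast
  obtain B where B: "B > 0" "\<And>f J. f \<in> L2 lebesgue \<Longrightarrow> finite J \<Longrightarrow> J \<subseteq> \<Lambda> \<Longrightarrow>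
    (\<Sum>n\<in>J. (cmod (l2_inner lebesgue f (translation (\<nu> n) \<phi>)))\<^sup>2) \<le> B * (norm_R f)\<^sup>2"
    using bessel_finite_sum[OF b[unfolded bessel_sequence_def]] by blast
  have "card G \<le> nat \<lceil>4 * B / N\<^sup>2\<rceil>" if G: "finite G" "G \<subseteq> {n \<in> \<Lambda>. \<bar>\<nu> n - s\<bar> \<le> \<delta>}" for s G
  proof -
    have T: "translation y \<phi> \<in> L2 lebesgue" "norm_R (translation y \<phi>) = N" for y
      using translation_L2[OF \<phi>(1)] by (simp_all add: N_def)
    have "N\<^sup>2 / 2 \<le> cmod (l2_inner lebesgue (translation s \<phi>) (translation (\<nu> n) \<phi>))" if "n \<in> G" for n
    proof -
      have "norm_R (\<lambda>t. translation s \<phi> t - translation (\<nu> n) \<phi> t) < N"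
        using \<delta>(2)[of "\<nu> n - s" s] that G(2) by (subst l2_norm_minus_commute) auto
      then have "(norm_R (\<lambda>t. translation s \<phi> t - translation (\<nu> n) \<phi> t))\<^sup>2 \<le> N\<^sup>2"
        by (intro power_mono) auto
      then have "N\<^sup>2 / 2 \<le> Re (l2_inner lebesgue (translation s \<phi>) (translation (\<nu> n) \<phi>))"
        unfolding l2_norm_diff_sq[OF T(1) T(1)] T(2) by simp
      also have "\<dots> \<le> cmod (l2_inner lebesgue (translation s \<phi>) (translation (\<nu> n) \<phi>))"
        by (rule complex_Re_le_cmod)
      finally show ?thesis .
    qed
    then have "(N\<^sup>2 / 2)\<^sup>2 \<le> (cmod (l2_inner lebesgue (translation s \<phi>) (translation (\<nu> n) \<phi>)))\<^sup>2" if "n \<in> G" for n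
      using that by (intro power_mono) auto
    then have "real (card G) * (N\<^sup>2 / 2)\<^sup>2 \<le> (\<Sum>n\<in>G. (cmod (l2_inner lebesgue (translation s \<phi>) (translation (\<nu> n) \<phi>)))\<^sup>2)"
      by (intro sum_bounded_below)
    also have "\<dots> \<le> B * N\<^sup>2" using B(2)[OF T(1)[of s] G(1)] G(2) T(2)[of s] by auto
    finally have "(real (card G) * N\<^sup>2) * N\<^sup>2 \<le> (4 * B) * N\<^sup>2" by (simp add: power2_eq_square)
    then have "real (card G) * N\<^sup>2 \<le> 4 * B" by (rule mult_right_le_imp_le) (use N in simp)
    then have "real (card G) \<le> 4 * B / N\<^sup>2" using N by (simp add: field_simps)
    then show ?thesis by linarith
  qed
  then show ?thesis using \<delta>(1) by blast
qed

lemma unit_interval_lower_set: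
  fixes \<psi> :: "real \<Rightarrow> complex"
  assumes \<psi>: "\<psi> \<in> L2 lebesgue" "norm_R \<psi> \<noteq> 0"
  shows "\<exists>(m::int) c E. c > 0 \<and> E \<in> sets lebesgue \<and> E \<subseteq> {0..1} \<and> 0 < measure lebesgue E \<and>
     (\<forall>t\<in>E. c \<le> cmod (\<psi> (of_int m + t)))"
proof -
  have \<psi>m [measurable]: "\<psi> \<in> borel_measurable lebesgue" using \<psi>(1) by (simp add: L2_def)
  have "(\<integral>\<^sup>+x. ennreal ((cmod (\<psi> x))\<^sup>2) \<partial>lebesgue) \<noteq> 0"
    unfolding nn_integral_L2[OF \<psi>(1)] using \<psi>(2) by simp
  then have "(\<Sum>n. \<integral>\<^sup>+x. ennreal ((cmod (\<psi> (of_int (int_decode n) + x)))\<^sup>2) \<partial>\<mu>\<^sub>I) \<noteq> 0"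
    by (subst (asm) nn_integral_split_unit) auto
  then have "\<not> (\<forall>n. (\<integral>\<^sup>+x. ennreal ((cmod (\<psi> (of_int (int_decode n) + x)))\<^sup>2) \<partial>\<mu>\<^sub>I) = 0)"
    by (rule contrapos_nn) simp
  then obtain n where n: "(\<integral>\<^sup>+x. ennreal ((cmod (\<psi> (of_int (int_decode n) + x)))\<^sup>2) \<partial>\<mu>\<^sub>I) \<noteq> 0"
    by blast
  define m where "m = int_decode n"
  define f where "f t = \<psi> (of_int m + t)" for t
  have fm [measurable]: "f \<in> borel_measurable lebesgue"
    using measurable_affine[OF \<psi>m, of "of_int m" 1] by (simp add: f_def[abs_def])
  define S where "S j = {t \<in> {0..1}. inverse (real (Suc j)) \<le> cmod (f t)}" for j
  have Sm: "S j \<in> sets lebesgue" for j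
  proof -
    have "S j = {0..1} \<inter> ((\<lambda>t. cmod (f t)) -` {inverse (real (Suc j))..} \<inter> space lebesgue)"
      by (auto simp: S_def)
    also have "\<dots> \<in> sets lebesgue"
      by (intro sets.Int measurable_sets[of "\<lambda>t. cmod (f t)" lebesgue borel]) auto
    finally show ?thesis .
  qed
  have "\<exists>j. 0 < measure lebesgue (S j)"
  proof (rule ccontr)
    assume "\<nexists>j. 0 < measure lebesgue (S j)"
    then have z: "measure lebesgue (S j) = 0" for j using measure_nonneg[of lebesgue "S j"] by (metis less_le)
    have "S j \<in> null_sets lebesgue" for j
    proof -
      have "emeasure lebesgue (S j) \<le> emeasure lebesgue {0..1::real}"
        by (intro emeasure_mono) (auto simp: S_def)
      then have "emeasure lebesgue (S j) \<noteq> top" by (auto simp: top_unique)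
      then have "emeasure lebesgue (S j) = 0" using z[of j] by (simp add: emeasure_eq_ennreal_measure)
      then show ?thesis using Sm by (simp add: null_sets_def)
    qed
    then have "AE t in lebesgue. \<forall>j. t \<notin> S j" by (simp add: AE_all_countable AE_not_in)
    then have "AE t in lebesgue. t \<in> {0..1} \<longrightarrow> f t = 0"
    proof eventually_elim
      case (elim t)
      show ?case
      proof (rule impI, rule ccontr)
        assume t: "t \<in> {0..1}" "f t \<noteq> 0"
        then obtain j where "inverse (real (Suc j)) < cmod (f t)" using reals_Archimedean[of "cmod (f t)"] by auto
        then have "t \<in> S j" using t by (simp add: S_def)
        then show False using elim by blast
      qed
    qed
    then have "AE t in \<mu>\<^sub>I. f t = 0" by (simp add: AE_restrict_space_iff)
    then have "(\<integral>\<^sup>+x. ennreal ((cmod (f x))\<^sup>2) \<partial>\<mu>\<^sub>I) = (\<integral>\<^sup>+x. 0 \<partial>\<mu>\<^sub>I)"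
      by (intro nn_integral_cong_AE) (auto elim: eventually_mono)
    then show False using n by (simp add: f_def m_def)
  qed
  then obtain j where "0 < measure lebesgue (S j)" by blast
  moreover have "S j \<subseteq> {0..1}" "\<forall>t\<in>S j. inverse (real (Suc j)) \<le> cmod (\<psi> (of_int m + t))"
    by (auto simp: S_def f_def)
  moreover have "inverse (real (Suc j)) > 0" by simp
  ultimately show ?thesis using Sm[of j] by blast
qed

text \<open>
  The difference \<open>cis (2 * pi * \<delta> n * t) - 1\<close> is the integral over \<open>s \<in> [0,t]\<close> of the derivative of
  \<open>cis (2 * pi * \<delta> n * s)\<close>. For fixed \<open>s\<close> that derivative only changes the coefficients of the integer
  frequencies \<open>k n\<close>, which multiplies their moduli by at most \<open>2 * pi * d\<close>, and orthonormality computes the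
  norm in \<open>t\<close>. It remains to integrate over \<open>s \<in> [0,1]\<close> and to exchange the integrals.
\<close>
lemma exponential_perturbation:
  assumes J: "finite J" and k: "inj_on k J" and \<delta>: "\<And>n. n \<in> J \<Longrightarrow> 0 \<le> \<delta> n" "\<And>n. n \<in> J \<Longrightarrow> \<delta> n \<le> d"
  shows "norm_I (\<lambda>t. \<Sum>n\<in>J. a n * exponential (k n) t * (cis (2 * pi * \<delta> n * t) - 1))
    \<le> 2 * pi * d * L2_set (\<lambda>n. cmod (a n)) J"
proof (cases "J = {}")
  case False
  have d0: "0 \<le> d" using False \<delta> by (meson all_not_in_conv order_trans)
  define f where "f t = (\<Sum>n\<in>J. a n * exponential (k n) t * (cis (2 * pi * \<delta> n * t) - 1))" for t
  define u where "u s t = (\<Sum>n\<in>J. (a n * (\<i> * of_real (2 * pi * \<delta> n)) * cis (2 * pi * \<delta> n * s)) * exponential (k n) t)" for s t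
  have ucont: "continuous_on A (\<lambda>s. u s t)" for A t
    unfolding u_def by (intro continuous_intros)
  have fm: "f \<in> borel_measurable \<mu>\<^sub>I"
  proof -
    have "continuous_on UNIV f" unfolding f_def exponential_def by (intro continuous_intros)
    then show ?thesis by (intro measurable_restrict_space1 continuous_lebesgue_measurable)
  qed
  have uL: "(\<lambda>s. complex_of_real (cmod (u s t))) \<in> L2 \<mu>\<^sub>I" for t
  proof -
    have c: "continuous_on {0..1} (\<lambda>s. complex_of_real (cmod (u s t)))"
      by (intro continuous_intros ucont)
    obtain B where "\<forall>z\<in>(\<lambda>s. complex_of_real (cmod (u s t))) ` {0..1}. cmod z \<le> B"
      using compact_continuous_image[OF c compact_Icc, THEN compact_imp_bounded] unfolding bounded_iff by blast
    then have "\<And>s. s \<in> {0..1} \<Longrightarrow> cmod (complex_of_real (cmod (u s t))) \<le> B" by blast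
    then show ?thesis
      by (intro bounded_L2_unit) (auto intro!: continuous_imp_measurable_on_sets_lebesgue c)
  qed
  have pointwise: "cmod (f t) \<le> norm_I (\<lambda>s. u s t)" if t: "t \<in> {0..1}" for t
  proof -
    have deriv: "((\<lambda>s. cis (2 * pi * \<delta> n * s)) has_vector_derivative
        (\<i> * of_real (2 * pi * \<delta> n)) * cis (2 * pi * \<delta> n * s)) (at s within {0..t})" for n s
    proof -
      have "((\<lambda>z. exp (\<i> * of_real (2 * pi * \<delta> n) * z)) has_field_derivative
          (\<i> * of_real (2 * pi * \<delta> n)) * exp (\<i> * of_real (2 * pi * \<delta> n) * of_real s)) (at (of_real s))"
        by (auto intro!: derivative_eq_intros)
      from has_vector_derivative_real_field[OF this, of "{0..t}"] show ?thesis
        by (simp add: cis_conv_exp mult.assoc)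
    qed
    have "((\<lambda>s. u s t) has_integral
        ((\<Sum>n\<in>J. a n * exponential (k n) t * cis (2 * pi * \<delta> n * t)) - (\<Sum>n\<in>J. a n * exponential (k n) t * cis (2 * pi * \<delta> n * 0)))) {0..t}"
    proof (rule fundamental_theorem_of_calculus)
      fix s
      show "((\<lambda>s. \<Sum>n\<in>J. a n * exponential (k n) t * cis (2 * pi * \<delta> n * s)) has_vector_derivative u s t) (at s within {0..t})"
        unfolding u_def
      proof (rule has_vector_derivative_sum)
        fix n
        have "((\<lambda>s. a n * exponential (k n) t * cis (2 * pi * \<delta> n * s)) has_vector_derivative
          a n * exponential (k n) t * ((\<i> * of_real (2 * pi * \<delta> n)) * cis (2 * pi * \<delta> n * s))) (at s within {0..t})"
          by (rule has_vector_derivative_mult_right[OF deriv])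
        then show "((\<lambda>s. a n * exponential (k n) t * cis (2 * pi * \<delta> n * s)) has_vector_derivative
          a n * (\<i> * of_real (2 * pi * \<delta> n)) * cis (2 * pi * \<delta> n * s) * exponential (k n) t) (at s within {0..t})"
          by (simp only: mult_ac)
      qed
    qed (use t in auto)
    then have int: "integral {0..t} (\<lambda>s. u s t) = f t"
      unfolding f_def by (intro integral_unique) (simp add: right_diff_distrib sum_subtractf)
    have i1: "(\<lambda>s. cmod (u s t)) integrable_on {0..r}" for r
      by (intro integrable_continuous_real continuous_intros ucont)
    have "cmod (f t) \<le> integral {0..t} (\<lambda>s. cmod (u s t))"
      unfolding int[symmetric] by (intro integral_norm_bound_integral integrable_continuous_real ucont i1) auto
    also have "\<dots> \<le> integral {0..1} (\<lambda>s. cmod (u s t))"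
      using t by (intro integral_subset_le i1) auto
    also have "\<dots> = (LINT s|\<mu>\<^sub>I. cmod (u s t))"
    proof (rule lebesgue_integral_eq_integral[symmetric])
      show "integrable \<mu>\<^sub>I (\<lambda>s. cmod (u s t))"
        by (intro continuous_imp_integrable_real continuous_intros ucont)
    qed simp
    also have "\<dots> = cmod (l2_inner \<mu>\<^sub>I (\<lambda>s. complex_of_real (cmod (u s t))) (\<lambda>s. 1))"
      by (simp add: l2_inner_def)
    also have "\<dots> \<le> norm_I (\<lambda>s. complex_of_real (cmod (u s t))) * norm_I (\<lambda>s. 1)"
      by (intro l2_Cauchy_Schwarz uL bounded_L2_unit[where B=1]) auto
    also have "\<dots> = norm_I (\<lambda>s. u s t)"
      by (simp add: l2_norm_def measure_restrict_space)
    finally show ?thesis .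
  qed
  have uL2: "(\<lambda>s. u s t) \<in> L2 \<mu>\<^sub>I" for t
    by (rule L2_dominated[OF uL[of t]]) (auto intro!: continuous_imp_measurable_on_sets_lebesgue ucont)
  interpret I: finite_measure "\<mu>\<^sub>I" by (rule finite_measure_unit)
  interpret P: pair_sigma_finite "\<mu>\<^sub>I" "\<mu>\<^sub>I" ..
  have um: "(\<lambda>(t, s). ennreal ((cmod (u s t))\<^sup>2)) \<in> borel_measurable (\<mu>\<^sub>I \<Otimes>\<^sub>M \<mu>\<^sub>I)"
  proof -
    have [measurable]: "(\<lambda>s. cis (2 * pi * \<delta> n * s)) \<in> borel_measurable \<mu>\<^sub>I" for n
      by (intro measurable_restrict_space1 cis_measurable)
    have [measurable]: "exponential (k n) \<in> borel_measurable \<mu>\<^sub>I" for n by (rule exponential_measurable)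
    show ?thesis unfolding u_def case_prod_beta by measurable
  qed
  have "(\<integral>\<^sup>+t. ennreal ((cmod (f t))\<^sup>2) \<partial>\<mu>\<^sub>I) \<le> (\<integral>\<^sup>+t. \<integral>\<^sup>+s. ennreal ((cmod (u s t))\<^sup>2) \<partial>\<mu>\<^sub>I \<partial>\<mu>\<^sub>I)"
    unfolding nn_integral_L2[OF uL2]
    by (intro nn_integral_mono ennreal_leI power_mono pointwise) auto
  also have "\<dots> = (\<integral>\<^sup>+s. \<integral>\<^sup>+t. ennreal ((cmod (u s t))\<^sup>2) \<partial>\<mu>\<^sub>I \<partial>\<mu>\<^sub>I)"
    by (rule P.Fubini'[OF um, symmetric])
  also have "\<dots> \<le> (\<integral>\<^sup>+s. ennreal ((2 * pi * d * L2_set (\<lambda>n. cmod (a n)) J)\<^sup>2) \<partial>\<mu>\<^sub>I)"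
  proof (intro nn_integral_mono)
    fix s
    have L: "u s \<in> L2 \<mu>\<^sub>I" unfolding u_def by (intro L2_lincomb exponential_L2)
    have "(norm_I (u s))\<^sup>2 = (\<Sum>n\<in>J. (cmod (a n * (\<i> * of_real (2 * pi * \<delta> n)) * cis (2 * pi * \<delta> n * s)))\<^sup>2)"
      unfolding u_def by (rule exponential_sum_norm_inj[OF _ J k, of UNIV]) simp
    also have "\<dots> \<le> (\<Sum>n\<in>J. (2 * pi * d)\<^sup>2 * (cmod (a n))\<^sup>2)"
    proof (rule sum_mono)
      fix n assume n: "n \<in> J"
      have "cmod (a n * (\<i> * of_real (2 * pi * \<delta> n)) * cis (2 * pi * \<delta> n * s)) = 2 * pi * \<delta> n * cmod (a n)"
        using \<delta>(1)[OF n] by (simp add: norm_mult)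
      also have "\<dots> \<le> 2 * pi * d * cmod (a n)" using \<delta>(2)[OF n] by (intro mult_right_mono) auto
      finally have "(cmod (a n * (\<i> * of_real (2 * pi * \<delta> n)) * cis (2 * pi * \<delta> n * s)))\<^sup>2 \<le> (2 * pi * d * cmod (a n))\<^sup>2"
        by (intro power_mono) auto
      then show "(cmod (a n * (\<i> * of_real (2 * pi * \<delta> n)) * cis (2 * pi * \<delta> n * s)))\<^sup>2 \<le> (2 * pi * d)\<^sup>2 * (cmod (a n))\<^sup>2"
        by (simp add: power_mult_distrib)
    qed
    also have "\<dots> = (2 * pi * d * L2_set (\<lambda>n. cmod (a n)) J)\<^sup>2"
      by (simp add: sum_distrib_left[symmetric] sum_eq_L2_set power_mult_distrib)
    finally show "(\<integral>\<^sup>+t. ennreal ((cmod (u s t))\<^sup>2) \<partial>\<mu>\<^sub>I) \<le> ennreal ((2 * pi * d * L2_set (\<lambda>n. cmod (a n)) J)\<^sup>2)"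
      unfolding nn_integral_L2[OF L] by (rule ennreal_leI)
  qed
  also have "\<dots> = ennreal ((2 * pi * d * L2_set (\<lambda>n. cmod (a n)) J)\<^sup>2)"
    by (simp add: emeasure_restrict_space)
  finally have le: "(\<integral>\<^sup>+t. ennreal ((cmod (f t))\<^sup>2) \<partial>\<mu>\<^sub>I) \<le> ennreal ((2 * pi * d * L2_set (\<lambda>n. cmod (a n)) J)\<^sup>2)" .
  have "f \<in> L2 \<mu>\<^sub>I"
  proof -
    have "integrable \<mu>\<^sub>I (\<lambda>t. (cmod (f t))\<^sup>2)"
      using le fm by (intro integrableI_bounded) (auto intro: le_less_trans)
    then show ?thesis using fm by (simp add: L2_def)
  qed
  then have "(norm_I f)\<^sup>2 \<le> (2 * pi * d * L2_set (\<lambda>n. cmod (a n)) J)\<^sup>2"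
    using le by (simp add: nn_integral_L2)
  then have "norm_I f \<le> 2 * pi * d * L2_set (\<lambda>n. cmod (a n)) J"
    by (rule power2_le_imp_le) (use d0 in simp)
  then show ?thesis by (simp add: f_def[abs_def])
qed simp

lemma weighted_norm_lower_bound:
  assumes \<psi>: "\<psi> \<in> L2 lebesgue" and E: "E \<in> sets lebesgue" "E \<subseteq> {0..1}" and c: "c > 0"
    "\<And>t. t \<in> E \<Longrightarrow> c \<le> cmod (\<psi> (of_int m + t))"
  shows "c * norm_I (cutoff E (\<lambda>t. exp_sum J a \<nu> (of_int m + t)))
     \<le> norm_R (\<lambda>\<xi>. exp_sum J a \<nu> \<xi> * \<psi> \<xi>)"
proof -
  let ?g = "exp_sum J a \<nu>"
  define \<Psi> where "\<Psi> = translation (- of_int m) (\<lambda>\<xi>. ?g \<xi> * \<psi> \<xi>)"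
  have \<Psi>: "\<Psi> \<in> L2 lebesgue" "norm_R \<Psi> = norm_R (\<lambda>\<xi>. ?g \<xi> * \<psi> \<xi>)"
    unfolding \<Psi>_def by (intro translation_L2 exp_sum_mult_L2 \<psi>)+
  have \<Psi>t: "\<Psi> t = ?g (of_int m + t) * \<psi> (of_int m + t)" for t
    by (simp add: \<Psi>_def translation_def add.commute)
  define G where "G = (\<lambda>t. of_real c * cutoff E (\<lambda>t. ?g (of_int m + t)) t)"
  have Gm: "G \<in> borel_measurable lebesgue"
  proof -
    have "(\<lambda>t. ?g (of_int m + 1 * t)) \<in> borel_measurable lebesgue"
      by (rule measurable_affine[OF exp_sum_measurable])
    moreover have "(indicator E :: real \<Rightarrow> complex) \<in> borel_measurable lebesgue"
      using E(1) by (rule borel_measurable_indicator)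
    ultimately show ?thesis unfolding G_def cutoff_def by (intro borel_measurable_times) auto
  qed
  have le: "cmod (G t) \<le> cmod (\<Psi> t)" for t
  proof (cases "t \<in> E")
    case True
    then show ?thesis unfolding G_def \<Psi>t cutoff_def norm_mult
      using c(1) mult_right_mono[OF c(2)[OF True], of "cmod (?g (of_int m + t))"] by (simp add: mult.commute)
  qed (simp add: G_def cutoff_def)
  have GL: "G \<in> L2 lebesgue" by (rule L2_dominated[OF \<Psi>(1) Gm]) (simp add: le)
  have "G t = 0" if "t \<notin> {0..1}" for t
  proof -
    have "t \<notin> E" using that E(2) by blast
    then show ?thesis by (simp add: G_def cutoff_def)
  qed
  then have "norm_I G = norm_R G" by (intro L2_unit_support(2)[OF Gm])
  moreover have "norm_I G = c * norm_I (cutoff E (\<lambda>t. ?g (of_int m + t)))"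
    unfolding G_def l2_norm_cmult using c(1) by simp
  ultimately show ?thesis using l2_norm_mono[OF \<Psi>(1) GL] le \<Psi>(2) by simp
qed

text \<open>
  The index \<open>n\<close> is coloured by the residue modulo \<open>N\<close> of \<open>m n = \<lfloor>N * \<nu> n\<rfloor>\<close>, by its rank among the finitely
  many indices with the same value of \<open>m\<close>, and by the part of the partition from the hypothesis that
  contains \<open>k n = m n div N\<close>. Within one colour, \<open>k\<close> is injective, since \<open>k n\<close> and the residue
  determine \<open>m n\<close>, and \<open>m n\<close> and the rank determine \<open>n\<close>.
\<close>
theorem cutoffs_imp_bessel_translates_riesz:
  fixes \<nu> :: "'i::countable \<Rightarrow> real"
  assumes P1: cutoffs_partition_into_isomorphisms
    and \<phi>: "\<phi> \<in> L2 lebesgue" "\<not> (AE t in lebesgue. \<phi> t = 0)"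
    and b: "bessel_sequence lebesgue \<Lambda> (\<lambda>n. translation (\<nu> n) \<phi>)"
  shows "finite_union_of (\<lambda>A. riesz_basic_sequence lebesgue A (\<lambda>n. translation (\<nu> n) \<phi>)) \<Lambda>"
proof -
  have \<phi>n: "norm_R \<phi> \<noteq> 0" using \<phi> l2_norm_eq_0_iff by blast
  have TL: "translation y \<phi> \<in> L2 lebesgue" for y by (rule translation_L2(1)[OF \<phi>(1)])
  obtain B where B: "B > 0" "upper_riesz_bound lebesgue \<Lambda> (\<lambda>n. translation (\<nu> n) \<phi>) B"
  proof -
    have "lin_span \<Lambda> (\<lambda>n. translation (\<nu> n) \<phi>) \<subseteq> L2 lebesgue" using lin_span_L2[OF TL] by blast
    then show ?thesis using bessel_imp_upper_riesz_bound[OF TL b[unfolded bessel_sequence_def]] that by blast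
  qed
  obtain \<psi> where F: "fourier_transform_L2 \<phi> \<psi>" using fourier_transform_L2_exists[OF \<phi>(1)] by blast
  have \<psi>: "\<psi> \<in> L2 lebesgue" using F by (simp add: fourier_transform_L2_def)
  have "norm_R \<psi> \<noteq> 0"
    using translates_norm[OF \<phi>(1) F, of "{0::nat}" "\<lambda>_. 1" "\<lambda>_. 0"] \<phi>n by (simp add: translation_def)
  from unit_interval_lower_set[OF \<psi> this] obtain m0 :: int and c E where c: "c > 0"
    and E: "E \<in> sets lebesgue" "E \<subseteq> {0..1}" "0 < measure lebesgue E"
    and \<psi>E: "\<And>t. t \<in> E \<Longrightarrow> c \<le> cmod (\<psi> (of_int m0 + t))"
    by blast
  obtain P where P: "finite P" "partition_on (UNIV :: int set) P"
    "\<And>A. A \<in> P \<Longrightarrow> iso_onto_range \<mu>\<^sub>I (exp_space A) (cutoff E)"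
    using P1[unfolded cutoffs_partition_into_isomorphisms_def, rule_format, OF E] by blast
  have Pne: "P \<noteq> {}" using partition_onD1[OF P(2)] by auto
  have "\<forall>A\<in>P. \<exists>\<gamma>>0. \<forall>f\<in>exp_space A. \<gamma> * norm_I f \<le> norm_I (cutoff E f)"
    using P(3) unfolding iso_onto_range_def by blast
  from bchoice[OF this] obtain \<Gamma> where
    "\<forall>A\<in>P. \<Gamma> A > 0 \<and> (\<forall>f\<in>exp_space A. \<Gamma> A * norm_I f \<le> norm_I (cutoff E f))" ..
  then have \<Gamma>: "\<And>A. A \<in> P \<Longrightarrow> \<Gamma> A > 0"
     "\<And>A f. A \<in> P \<Longrightarrow> f \<in> exp_space A \<Longrightarrow> \<Gamma> A * norm_I f \<le> norm_I (cutoff E f)" by simp_all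
  define \<gamma> where "\<gamma> = Min (\<Gamma> ` P)"
  have \<gamma>: "\<gamma> > 0" using P(1) Pne \<Gamma>(1) by (simp add: \<gamma>_def)
  have low: "\<gamma> * norm_I p \<le> norm_I (cutoff E p)"
    if "A \<in> P" "p \<in> lin_span A exponential" for A p
  proof -
    have "p \<in> exp_space A" using subsetD[OF lin_span_closed_span[where I=A and F=exponential and M="\<mu>\<^sub>I", OF exponential_L2] that(2)]
      unfolding exp_space_def .
    moreover have "\<gamma> \<le> \<Gamma> A" using P(1) that(1) by (simp add: \<gamma>_def)
    ultimately show ?thesis using \<Gamma>(2)[OF that(1)]
      by (meson l2_norm_nonneg mult_right_mono order_trans)
  qed
  obtain \<delta>0 K where K: "\<delta>0 > 0"
    "\<And>s G. finite G \<Longrightarrow> G \<subseteq> {n \<in> \<Lambda>. \<bar>\<nu> n - s\<bar> \<le> \<delta>0} \<Longrightarrow> card G \<le> K"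
    using bessel_translates_locally_bounded[OF \<phi>(1) \<phi>n b] by blast
  \<comment> \<open>\<open>N\<close> is chosen after \<open>\<gamma>\<close>: the perturbation may use up half of the lower bound\<close>
  obtain N :: nat where N: "N > 0" "1 / real N \<le> \<delta>0" "2 * pi * (1 / real N) \<le> \<gamma> / 2"
  proof -
    define r where "r = min \<delta>0 (\<gamma> / (4 * pi))"
    have "r > 0" using K(1) \<gamma> by (simp add: r_def)
    then obtain N where "inverse (real (Suc N)) < r" using reals_Archimedean by blast
    then have "1 / real (Suc N) \<le> \<delta>0" "1 / real (Suc N) \<le> \<gamma> / (4 * pi)" by (auto simp: r_def inverse_eq_divide)
    then show ?thesis using that[of "Suc N"] mult_left_mono[of "1 / real (Suc N)" "\<gamma> / (4 * pi)" "2 * pi"] by simp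
  qed
  define m where "m n = \<lfloor>real N * \<nu> n\<rfloor>" for n
  define k where "k n = m n div int N" for n
  define \<delta> where "\<delta> n = \<nu> n - of_int (m n) / real N" for n
  have \<delta>: "0 \<le> \<delta> n" "\<delta> n \<le> 1 / real N" for n
  proof -
    have "of_int (m n) \<le> real N * \<nu> n" "real N * \<nu> n \<le> of_int (m n) + 1" by (auto simp: m_def)
    moreover have "real N * \<delta> n = real N * \<nu> n - of_int (m n)"
      using N(1) by (simp add: \<delta>_def right_diff_distrib)
    ultimately have "0 \<le> real N * \<delta> n" "real N * \<delta> n \<le> 1" by linarith+
    then show "0 \<le> \<delta> n" "\<delta> n \<le> 1 / real N"
      using N(1) by (simp_all add: zero_le_mult_iff pos_le_divide_eq mult.commute)
  qed
  have fiber: "finite {j \<in> \<Lambda>. m j = z} \<and> card {j \<in> \<Lambda>. m j = z} \<le> K" for z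
  proof (rule finite_if_finite_subsets_card_bdd)
    fix G assume G: "G \<subseteq> {j \<in> \<Lambda>. m j = z}" "finite G"
    have "G \<subseteq> {n \<in> \<Lambda>. \<bar>\<nu> n - of_int z / real N\<bar> \<le> \<delta>0}"
    proof
      fix n assume "n \<in> G"
      then have "n \<in> \<Lambda>" "m n = z" using G by auto
      then show "n \<in> {n \<in> \<Lambda>. \<bar>\<nu> n - of_int z / real N\<bar> \<le> \<delta>0}"
        using \<delta>[of n] N(2) by (simp add: \<delta>_def)
    qed
    then show "card G \<le> K" by (rule K(2)[OF G(2)])
  qed
  define rank where "rank n = card {j \<in> \<Lambda>. m j = m n \<and> to_nat j < to_nat n}" for n
  have rank_le: "rank n \<le> K" for n
  proof -
    have "rank n \<le> card {j \<in> \<Lambda>. m j = m n}"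
      unfolding rank_def using fiber[of "m n"] by (intro card_mono) auto
    then show ?thesis using fiber[of "m n"] by simp
  qed
  have rank_less: "rank n < rank n'" if "n \<in> \<Lambda>" "m n = m n'" "to_nat n < to_nat n'" for n n'
  proof -
    have "{j \<in> \<Lambda>. m j = m n \<and> to_nat j < to_nat n} \<subset> {j \<in> \<Lambda>. m j = m n' \<and> to_nat j < to_nat n'}"
      using that by auto
    moreover have "finite {j \<in> \<Lambda>. m j = m n' \<and> to_nat j < to_nat n'}"
      using fiber[of "m n'"] by (auto intro: finite_subset[of _ "{j \<in> \<Lambda>. m j = m n'}"])
    ultimately show ?thesis unfolding rank_def by (rule psubset_card_mono[rotated])
  qed
  have "\<exists>A. A \<in> P \<and> z \<in> A" for z using partition_onD1[OF P(2)] by blast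
  then obtain cl where cl: "\<And>z. cl z \<in> P" "\<And>z. z \<in> cl z" by metis
  define color where "color n = (m n mod int N, rank n, cl (k n))" for n
  show ?thesis
  proof (rule finite_union_of_coloring[where c=color])
    have "color ` \<Lambda> \<subseteq> {0..<int N} \<times> {..K} \<times> P"
      using N(1) rank_le cl(1) by (auto simp: color_def)
    then show "finite (color ` \<Lambda>)" by (rule finite_subset) (use P(1) in auto)
    fix \<kappa> assume \<kappa>: "\<kappa> \<in> color ` \<Lambda>"
    obtain i0 r0 A where i0: "\<kappa> = (i0, r0, A)" by (cases \<kappa>)
    have A: "A \<in> P" using \<kappa> cl(1) by (auto simp: i0 color_def)
    define C where "C = {n \<in> \<Lambda>. color n = \<kappa>}"
    have Cn: "n \<in> \<Lambda>" "m n mod int N = i0" "rank n = r0" "k n \<in> A" if "n \<in> C" for n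
      using that cl(2)[of "k n"] by (auto simp: C_def color_def i0)
    have mk: "m n = k n * int N + i0" if "n \<in> C" for n
      using Cn(2)[OF that] div_mult_mod_eq[of "m n" "int N"] by (simp add: k_def)
    have kinj: "inj_on k C"
    proof (rule inj_onI)
      fix n n' assume n: "n \<in> C" "n' \<in> C" "k n = k n'"
      then have "m n = m n'" using mk by simp
      moreover have "rank n = rank n'" using Cn(3) n by simp
      ultimately have "to_nat n = to_nat n'"
        using rank_less[of n n'] rank_less[of n' n] Cn(1) n by (metis less_irrefl linorder_neqE_nat)
      then show "n = n'" by simp
    qed
    have \<nu>k: "\<nu> n = of_int (k n) + of_int i0 / real N + \<delta> n" if "n \<in> C" for n
      using N(1) mk[OF that] by (simp add: \<delta>_def add_divide_distrib)
    show "riesz_basic_sequence lebesgue {n \<in> \<Lambda>. color n = \<kappa>} (\<lambda>n. translation (\<nu> n) \<phi>)"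
      unfolding C_def[symmetric]
    proof (rule riesz_basic_sequenceI[OF TL _ B(1)])
      show "upper_riesz_bound lebesgue C (\<lambda>n. translation (\<nu> n) \<phi>) B"
        using B(2) Cn(1) unfolding upper_riesz_bound_def by (meson subset_iff)
      show "(c * (\<gamma> / 2))\<^sup>2 > 0" using c \<gamma> by simp
      fix J a assume J: "finite J" "J \<subseteq> C"
      define b where "b n = a n * cis (2 * pi * of_int m0 * \<nu> n)" for n
      define S where "S = L2_set (\<lambda>n. cmod (b n)) J"
      have Sa: "S\<^sup>2 = (\<Sum>n\<in>J. (cmod (a n))\<^sup>2)"
        unfolding S_def sum_eq_L2_set[symmetric] by (simp add: b_def norm_mult)
      have S0: "S \<ge> 0" by (simp add: S_def)
      define p where "p t = (\<Sum>n\<in>J. b n * exponential (k n) t)" for t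
      define f where "f t = (\<Sum>n\<in>J. b n * exponential (k n) t * (cis (2 * pi * \<delta> n * t) - 1))" for t
      have inj: "inj_on k J" using kinj J(2) by (rule inj_on_subset)
      have pA: "p \<in> lin_span A exponential"
        unfolding p_def using J(2) Cn(4) by (intro lin_span_sum lin_span_cmult lin_span_base) auto
      have pL: "p \<in> L2 \<mu>\<^sub>I" by (rule exp_lin_span_L2[OF pA])
      have "(norm_I p)\<^sup>2 = S\<^sup>2"
        unfolding p_def S_def sum_eq_L2_set[symmetric] by (rule exponential_sum_norm_inj[OF E(1) J(1) inj])
      then have pn: "norm_I p = S" using S0 by simp
      have fL: "f \<in> L2 \<mu>\<^sub>I"
      proof -
        have "continuous_on UNIV f" unfolding f_def exponential_def by (intro continuous_intros)
        then have fm: "f \<in> borel_measurable \<mu>\<^sub>I" by (intro measurable_restrict_space1 continuous_lebesgue_measurable)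
        have "cmod (f t) \<le> (\<Sum>n\<in>J. cmod (b n) * 2)" for t
          unfolding f_def
        proof (rule order_trans[OF norm_sum sum_mono])
          fix n
          have "cmod (cis (2 * pi * \<delta> n * t) - 1) \<le> 2" by (rule order_trans[OF norm_triangle_ineq4]) simp
          then show "cmod (b n * exponential (k n) t * (cis (2 * pi * \<delta> n * t) - 1)) \<le> cmod (b n) * 2"
            by (simp add: norm_mult mult_left_mono)
        qed
        then show ?thesis by (rule bounded_L2_unit[OF fm])
      qed
      have fn: "norm_I f \<le> \<gamma> / 2 * S"
      proof -
        have "norm_I f \<le> 2 * pi * (1 / real N) * S"
          unfolding f_def S_def by (rule exponential_perturbation[OF J(1) inj \<delta>])
        also have "\<dots> \<le> \<gamma> / 2 * S" by (rule mult_right_mono[OF N(3) S0])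
        finally show ?thesis .
      qed
      \<comment> \<open>the factor with \<open>i0\<close> is the same for all indices of the colour and has modulus one\<close>
      have gpf: "exp_sum J a \<nu> (of_int m0 + t) = cis (2 * pi * (of_int i0 / real N) * t) * (p t + f t)" for t
      proof -
        have "a n * cis (2 * pi * (of_int m0 + t) * \<nu> n)
            = cis (2 * pi * (of_int i0 / real N) * t) * (b n * exponential (k n) t * cis (2 * pi * \<delta> n * t))" if n: "n \<in> J" for n
        proof -
          have "2 * pi * (of_int m0 + t) * \<nu> n
            = 2 * pi * of_int m0 * \<nu> n + (2 * pi * (of_int i0 / real N) * t + (2 * pi * (of_int (k n) * t) + 2 * pi * \<delta> n * t))"
            using \<nu>k[of n] n J(2) by (simp add: subset_iff algebra_simps)
          then show ?thesis by (simp only: b_def exponential_cis cis_mult[symmetric] mult_ac)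
        qed
        then have "exp_sum J a \<nu> (of_int m0 + t)
            = (\<Sum>n\<in>J. cis (2 * pi * (of_int i0 / real N) * t) * (b n * exponential (k n) t * cis (2 * pi * \<delta> n * t)))"
          by (intro sum.cong refl)
        also have "\<dots> = cis (2 * pi * (of_int i0 / real N) * t) * (p t + f t)"
          by (simp add: p_def f_def sum_distrib_left sum.distrib[symmetric] algebra_simps)
        finally show ?thesis .
      qed
      have "norm_I (cutoff E (\<lambda>t. exp_sum J a \<nu> (of_int m0 + t))) = norm_I (cutoff E (\<lambda>t. p t + f t))"
        unfolding gpf by (simp add: l2_norm_def cutoff_def norm_mult)
      also have "\<dots> \<ge> \<gamma> / 2 * S"
      proof -
        have pf: "(\<lambda>t. p t + f t) \<in> L2 \<mu>\<^sub>I" by (rule L2_add[OF pL fL])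
        have "\<gamma> * S \<le> norm_I (cutoff E p)" using low[OF A pA] pn by simp
        also have "\<dots> \<le> norm_I (cutoff E (\<lambda>t. p t + f t)) + norm_I (\<lambda>t. cutoff E p t - cutoff E (\<lambda>t. p t + f t) t)"
          by (rule l2_triangle_diff[OF cutoff_L2(1)[OF pL E(1)] cutoff_L2(1)[OF pf E(1)]])
        also have "norm_I (\<lambda>t. cutoff E p t - cutoff E (\<lambda>t. p t + f t) t) = norm_I (cutoff E f)"
          by (simp add: l2_norm_def cutoff_def algebra_simps norm_mult)
        also have "\<dots> \<le> \<gamma> / 2 * S" using cutoff_L2(2)[OF fL E(1)] fn by simp
        finally show ?thesis by simp
      qed
      finally have "c * (\<gamma> / 2 * S) \<le> c * norm_I (cutoff E (\<lambda>t. exp_sum J a \<nu> (of_int m0 + t)))"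
        using c by (intro mult_left_mono) auto
      also have "\<dots> \<le> norm_R (\<lambda>\<xi>. exp_sum J a \<nu> \<xi> * \<psi> \<xi>)"
        by (rule weighted_norm_lower_bound[OF \<psi> E(1,2) c \<psi>E])
      also have "\<dots> = norm_R (\<lambda>t. \<Sum>n\<in>J. a n * translation (\<nu> n) \<phi> t)"
        by (rule translates_norm[OF \<phi>(1) F J(1), symmetric])
      finally have "(c * (\<gamma> / 2 * S))\<^sup>2 \<le> (norm_R (\<lambda>t. \<Sum>n\<in>J. a n * translation (\<nu> n) \<phi> t))\<^sup>2"
        using c \<gamma> S0 by (intro power_mono) auto
      moreover have "(c * (\<gamma> / 2 * S))\<^sup>2 = (c * (\<gamma> / 2))\<^sup>2 * S\<^sup>2" by (simp add: power_mult_distrib power_divide)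
      ultimately show "(c * (\<gamma> / 2))\<^sup>2 * (\<Sum>n\<in>J. (cmod (a n))\<^sup>2)
          \<le> (norm_R (\<lambda>t. \<Sum>n\<in>J. a n * translation (\<nu> n) \<phi> t))\<^sup>2" using Sa by simp
    qed
  qed
qed

theorem theorem7p3:
  "(cutoffs_partition_into_isomorphisms \<longleftrightarrow> bessel_translates_finite_union_riesz) \<and>
   (bessel_translates_finite_union_riesz \<longleftrightarrow> bessel_integer_translates_finite_union_riesz) \<and>
   (bessel_integer_translates_finite_union_riesz \<longleftrightarrow> frame_translates_finite_union_riesz) \<and>
   (frame_translates_finite_union_riesz \<longleftrightarrow> bessel_integer_translates_finite_union_frame)"
proof -
  have "bessel_translates_finite_union_riesz" if cutoffs_partition_into_isomorphisms
    unfolding bessel_translates_finite_union_riesz_def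
    by (intro ballI allI impI cutoffs_imp_bessel_translates_riesz[OF that])
  moreover have "bessel_integer_translates_finite_union_riesz" if cutoffs_partition_into_isomorphisms
    unfolding bessel_integer_translates_finite_union_riesz_def
    by (intro ballI allI impI cutoffs_imp_bessel_translates_riesz[OF that])
  moreover have "frame_translates_finite_union_riesz" if bessel_translates_finite_union_riesz
    unfolding frame_translates_finite_union_riesz_def
    by (intro ballI allI impI that[unfolded bessel_translates_finite_union_riesz_def, rule_format]
          frame_sequence_imp_bessel_sequence)
  moreover have "bessel_integer_translates_finite_union_frame" if bessel_integer_translates_finite_union_riesz
    unfolding bessel_integer_translates_finite_union_frame_def
  proof (intro allI ballI impI)
    fix \<Lambda> :: "int set" and \<phi>
    assume "\<phi> \<in> L2 lebesgue" "\<not> (AE t in lebesgue. \<phi> t = 0)"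
      "bessel_sequence lebesgue \<Lambda> (\<lambda>n. translation (of_int n) \<phi>)"
    from that[unfolded bessel_integer_translates_finite_union_riesz_def, rule_format, OF this]
    show "finite_union_of (\<lambda>A. frame_sequence lebesgue A (\<lambda>n. translation (of_int n) \<phi>)) \<Lambda>"
      by (rule finite_union_of_mono) (rule riesz_imp_frame_sequence)
  qed
  ultimately show ?thesis
    using frame_translates_imp_cutoffs bessel_finite_union_frame_imp_cutoffs by argo
qed

end
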